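(* Assume the setting of the context, including $(C_1)$. Suppose that $(H_1)$, $(R)$ and $(H_2)$ hold and that the Melnikov function $$M_\lambda(\alpha):=\int_0^{T}\dot\psi_\lambda(t+\alpha)\gamma(t)\,dt$$ has a simple zero at some $\alpha=\alpha_0$. Then there exists $\rho>0$ such that for any $\varepsilon$ sufficiently small there exists a unique $\alpha(\varepsilon)$ ($C^1$ with respect to $\varepsilon$) such that $|\alpha(\varepsilon)-\alpha_0|\to0$ as $\varepsilon\to0$ and such that the equation $$\ddot\psi=f(\psi)+\varepsilon\gamma(t)\,h\Big(H^{-1}\Big(\tfrac{\dot\psi^2}{2}-F(\psi)-d\Big)\Big)$$ has a unique $p$-periodic solution $\psi(t,\varepsilon)$ satisfying $$\|\psi(t,\varepsilon)-\psi_\lambda(t+\alpha(\varepsilon))\|_2\le\rho .$$ Moreover $\|\psi(t,\varepsilon)-\psi_\lambda(t+\alpha(\varepsilon))\|_2\to0$ as $\varepsilon\to0$.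
   Context: Setting: $f,h$ are $C^2$ real functions of a real variable, $\gamma:\mathbb R\to\mathbb R$ is $C^2$ and $1$-periodic, $\varepsilon\in\mathbb R$ is a small parameter, $d\in\mathbb R$ is a fixed constant, $F(\psi)=\int_0^\psi f(u)\,du$, $H(z)=\int_0^z h(u)\,du$. $(C_1)$: $H:I\to J$ is a diffeomorphism between open intervals $I,J\subseteq\mathbb R$, i.e. $h(z)\ne0$ for any $z\in I$; $H^{-1}:J\to I$ is its inverse. $(H_1)$: the unperturbed equation $\ddot\psi=f(\psi)$ has a family of periodic solutions $\psi_\lambda(t)=\psi_\lambda(t+T_\lambda)$ with periods $T_\lambda\in\mathbb R$, and $\dot\psi_\lambda(t)$ is the unique, up to a multiplicative constant, $T_\lambda$-periodic solution of the variational equation $\ddot\psi=f'(\psi_\lambda(t))\psi$. $(R)$: for the given $\lambda\in\mathbb R$, $T_\lambda=p/q$ with $p,q\in\mathbb N$. Put $T:=p=qT_\lambda$. $(H_2)$: $c_\lambda-d\in J$, where $c_\lambda$ is the constant value (in $t$) of $\frac{\dot\psi_\lambda(t)^2}{2}-F(\psi_\lambda(t))$. A solution of the perturbed equation is required to satisfy $\frac{\dot\psi(t)^2}{2}-F(\psi(t))-d\in J$ for all $t\in\mathbb R$. The norm is the usual maximum norm on $C^2$ $T$-periodic functions, $\|u\|_2=\max\{\|u\|_0,\|\dot u\|_0,\|\ddot u\|_0\}$ with $\|\cdot\|_0$ the maximum norm. A simple zero of $M_\lambda$ is a point $\alpha_0$ with $M_\lambda(\alpha_0)=0$, $M_\l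ambda'(\alpha_0)\neq0$.
   Formalization: Uniqueness of ψ(t,ε) is claimed for ε≠0 only (at ε=0 all nearby shifts of ψ_λ are solutions); uniqueness of α(ε), false literally since small shifts of α also work, is claimed near α₀ under the condition that ψ−ψ_λ(·+α) is L²(0,p)-orthogonal to ψ̇_λ(·+α). *)

theory Defs
  imports "HOL-Analysis.Analysis"
begin

definition C2 :: "(real \<Rightarrow> real) \<Rightarrow> bool" where
  "C2 g \<longleftrightarrow> g C1_differentiable_on UNIV \<and> deriv g C1_differentiable_on UNIV"

definition periodic :: "(real \<Rightarrow> real) \<Rightarrow> real \<Rightarrow> bool" where
  "periodic g T \<longleftrightarrow> (\<forall>t. g (t + T) = g t)"

text \<open>The interval integral is oriented, so this is the primitive vanishing at 0 also for negative
  arguments.\<close>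

definition primitive :: "(real \<Rightarrow> real) \<Rightarrow> real \<Rightarrow> real" where
  "primitive g x = (LBINT u=0..x. g u)"

definition diffeo :: "real set \<Rightarrow> real set \<Rightarrow> (real \<Rightarrow> real) \<Rightarrow> bool" where
  "diffeo A B g \<longleftrightarrow> bij_betw g A B \<and> g C1_differentiable_on A \<and> inv_into A g C1_differentiable_on B"

definition cond_C1 :: "(real \<Rightarrow> real) \<Rightarrow> real set \<Rightarrow> real set \<Rightarrow> bool" where
  "cond_C1 h I J \<longleftrightarrow> open I \<and> is_interval I \<and> open J \<and> is_interval J \<and>
     diffeo I J (primitive h) \<and> (\<forall>z\<in>I. h z \<noteq> 0)"

text \<open>Global solutions of \<open>x'' = G t x x'\<close>. Periodic solutions are defined on the whole line anyway.\<close>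

definition solves2 :: "(real \<Rightarrow> real \<Rightarrow> real \<Rightarrow> real) \<Rightarrow> (real \<Rightarrow> real) \<Rightarrow> bool" where
  "solves2 G x \<longleftrightarrow> (\<forall>t. (x has_real_derivative deriv x t) (at t) \<and>
     (deriv x has_real_derivative G t (x t) (deriv x t)) (at t))"

definition energy :: "(real \<Rightarrow> real) \<Rightarrow> (real \<Rightarrow> real) \<Rightarrow> real \<Rightarrow> real" where
  "energy f x t = (deriv x t)\<^sup>2 / 2 - primitive f (x t)"

text \<open>The condition on a single member \<open>x\<close>, of period \<open>T\<close>, of the unperturbed family. The period is
  any positive period, not necessarily the minimal one.\<close>

definition nondegenerate_periodic :: "(real \<Rightarrow> real) \<Rightarrow> (real \<Rightarrow> real) \<Rightarrow> real \<Rightarrow> bool" where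
  "nondegenerate_periodic f x T \<longleftrightarrow> T > 0 \<and> solves2 (\<lambda>t u v. f u) x \<and> periodic x T \<and>
     (\<forall>w. solves2 (\<lambda>t u v. deriv f (x t) * u) w \<and> periodic w T \<longleftrightarrow>
          (\<exists>k. w = (\<lambda>t. k * deriv x t)))"

definition cond_H1 ::
  "(real \<Rightarrow> real) \<Rightarrow> real set \<Rightarrow> (real \<Rightarrow> real \<Rightarrow> real) \<Rightarrow> (real \<Rightarrow> real) \<Rightarrow> bool" where
  "cond_H1 f \<Lambda> \<psi> Tper \<longleftrightarrow> (\<forall>l\<in>\<Lambda>. nondegenerate_periodic f (\<psi> l) (Tper l))"

definition melnikov :: "(real \<Rightarrow> real) \<Rightarrow> (real \<Rightarrow> real) \<Rightarrow> real \<Rightarrow> real \<Rightarrow> real" where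
  "melnikov x \<gamma> T a = (LBINT t=0..T. deriv x (t + a) * \<gamma> t)"

definition simple_zero :: "(real \<Rightarrow> real) \<Rightarrow> real \<Rightarrow> bool" where
  "simple_zero g a \<longleftrightarrow> g a = 0 \<and> g differentiable (at a) \<and> deriv g a \<noteq> 0"

definition perturbed_solution ::
  "(real \<Rightarrow> real) \<Rightarrow> (real \<Rightarrow> real) \<Rightarrow> (real \<Rightarrow> real) \<Rightarrow> real set \<Rightarrow> real set \<Rightarrow> real \<Rightarrow> real
    \<Rightarrow> (real \<Rightarrow> real) \<Rightarrow> bool" where
  "perturbed_solution f h \<gamma> I J d \<epsilon> x \<longleftrightarrow>
     solves2 (\<lambda>t u v. f u + \<epsilon> * \<gamma> t * h (inv_into I (primitive h) (v\<^sup>2 / 2 - primitive f u - d))) x \<and>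
     (\<forall>t. energy f x t - d \<in> J)"

text \<open>Meaningful for bounded functions only; it is applied to continuous periodic ones, for which the
  supremum is the maximum over a period.\<close>

definition max_norm :: "(real \<Rightarrow> real) \<Rightarrow> real" where
  "max_norm u = (SUP t. \<bar>u t\<bar>)"

definition C2_norm :: "(real \<Rightarrow> real) \<Rightarrow> real" where
  "C2_norm u = Max {max_norm u, max_norm (deriv u), max_norm (deriv (deriv u))}"

definition shift_diff :: "(real \<Rightarrow> real) \<Rightarrow> (real \<Rightarrow> real) \<Rightarrow> real \<Rightarrow> real \<Rightarrow> real" where
  "shift_diff \<phi> x a t = \<phi> t - x (t + a)"

text \<open>The Lyapunov--Schmidt normalisation that makes the phase \<open>a\<close> of a solution \<open>\<phi>\<close> near the orbit
  of \<open>x\<close> well defined: the deviation from \<open>x (t + a)\<close> is orthogonal in \<open>L\<^sup>2(0,T)\<close> to the kernel of the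
  variational equation along \<open>x (t + a)\<close>. Without it, every phase close to a given one would serve
  equally well.\<close>

definition phase_normalised :: "(real \<Rightarrow> real) \<Rightarrow> real \<Rightarrow> real \<Rightarrow> (real \<Rightarrow> real) \<Rightarrow> bool" where
  "phase_normalised x T a \<phi> \<longleftrightarrow> (LBINT t=0..T. shift_diff \<phi> x a t * deriv x (t + a)) = 0"

definition periodic_solution_near ::
  "(real \<Rightarrow> real) \<Rightarrow> (real \<Rightarrow> real) \<Rightarrow> (real \<Rightarrow> real) \<Rightarrow> real set \<Rightarrow> real set \<Rightarrow> real
    \<Rightarrow> (real \<Rightarrow> real) \<Rightarrow> real \<Rightarrow> real \<Rightarrow> real \<Rightarrow> real \<Rightarrow> (real \<Rightarrow> real) \<Rightarrow> bool" where
  "periodic_solution_near f h \<gamma> I J d x T \<rho> \<epsilon> a \<phi> \<longleftrightarrow>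
     perturbed_solution f h \<gamma> I J d \<epsilon> \<phi> \<and> periodic \<phi> T \<and> C2_norm (shift_diff \<phi> x a) \<le> \<rho>"

end

theory Submission
  imports Defs
begin

text \<open>Write \<open>y (t) = \<psi> (t - \<alpha>)\<close>, so that the phase enters only through \<open>\<gamma> (t - \<alpha>)\<close>, and let
  \<open>z = H\<^sup>-\<^sup>1 (y'\<^sup>2 / 2 - F y - d)\<close>. The perturbed equation is equivalent to \<open>y'' = f y + \<epsilon> \<gamma> (t - \<alpha>) h z\<close>,
  \<open>z' = \<epsilon> \<gamma> (t - \<alpha>) y'\<close>, together with the energy relation at one time. Hence for \<open>\<epsilon> \<noteq> 0\<close> a periodic
  solution satisfies \<open>\<integral> \<gamma> (t - \<alpha>) y' = 0\<close> exactly, and at \<open>\<epsilon> = 0\<close> this is the equation \<open>M \<alpha> = 0\<close>.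
  Periodicity of \<open>y\<close>, the phase condition, the Melnikov condition and the energy relation are
  equations for the initial values of \<open>y\<close>, \<open>y'\<close>, \<open>z\<close> and for \<open>\<alpha>\<close>, with parameter \<open>\<epsilon>\<close>; they are of class
  \<open>C\<^sup>1\<close> because the flow is. Nondegeneracy of the orbit and \<open>M' \<alpha>0 \<noteq> 0\<close> make the derivative invertible,
  and the inverse function theorem gives the branch. A nearby solution with arbitrary phase is
  brought to normalised phase by the intermediate value theorem, which gives the remaining uniqueness.\<close>

subsection \<open>Ordinary differential equations with continuously differentiable right-hand side\<close>

text \<open>At \<epsilon> = 0 the data are degenerate: every shift of the orbit is periodic and
  \<open>z\<close> is constant whatever the data, so periodicity of \<open>z\<close> says nothing
  there. Dividing that condition by \<epsilon> restores the information, and the division is built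
  into the system: for \<epsilon> \<noteq> 0 the variable \<open>m\<close> is
  \<open>(z t - z a) / \<epsilon>\<close>, yet its equation \<open>m' = \<gamma> v\<close> is
  regular at \<epsilon> = 0. Everything thus stays in five dimensions, with no function spaces.
  Reading \<open>m\<close> off a given solution does require \<epsilon> \<noteq> 0, and uniqueness
  is claimed only there; at \<epsilon> = 0 all nearby shifts compete. Since \<open>h\<close> lives
  on the whole line, the extended flow is blind to \<open>I\<close> and \<open>J\<close>. These
  enter only in the passage between \<open>z\<close> and the energy, and \<open>z\<close> stays near
  \<open>z0\<close> inside the open set \<open>I\<close>. A solution is determined by its values at
  one time, so uniqueness among functions close in the C2 norm needs only closeness of
  \<open>y\<close>, \<open>v\<close>, \<open>z\<close> at a time \<open>a\<close> chosen with
  \<open>x' a \<noteq> 0\<close>.\<close>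

lemma gronwall_vector:
  fixes R R' :: "real \<Rightarrow> 'a::real_normed_vector"
  assumes "a \<le> b" and "0 < L" and "0 \<le> e"
    and R: "\<And>t. t \<in> {a..b} \<Longrightarrow> (R has_vector_derivative R' t) (at t within {a..b})"
    and bnd: "\<And>t. t \<in> {a..b} \<Longrightarrow> norm (R' t) \<le> L * norm (R t) + e"
    and t: "t \<in> {a..b}"
  shows "norm (R t) \<le> 2 * (norm (R a) + e * (b - a)) * exp (2 * L * (b - a))"
proof -
  define N where "N = norm (R a) + e * (b - a)"
  have N0: "0 \<le> N" using assms by (simp add: N_def)
  \<comment> \<open>The weight decays at twice the growth rate. Integrating \<open>L\<close> times
    the majorant up to the maximum point of \<open>g\<close> then returns only half of that maximum,
    which is absorbed on the left; both factors 2 of the bound come from here.\<close>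
  define g where "g t = exp (- 2 * L * (t - a)) * norm (R t)" for t
  have gR: "norm (R t) = g t * exp (2 * L * (t - a))" for t
    by (simp add: g_def exp_minus field_simps flip: exp_add)
  have contR: "continuous_on {a..b} R"
    using R has_vector_derivative_continuous continuous_on_eq_continuous_within by blast
  have "continuous_on {a..b} g"
    unfolding g_def by (intro continuous_intros contR)
  then obtain s where s: "s \<in> {a..b}" and smax: "\<And>t. t \<in> {a..b} \<Longrightarrow> g t \<le> g s"
    using continuous_attains_sup[of "{a..b}" g] \<open>a \<le> b\<close> by auto
  have "g s \<le> 2 * N"
  proof (cases "s = a")
    case True
    moreover have "norm (R a) \<le> N" using assms by (simp add: N_def)
    ultimately show ?thesis using N0 by (simp add: g_def)
  next
    case False
    then have as: "a < s" using s by auto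
    define \<phi> where "\<phi> t = g s / 2 * exp (2 * L * (t - a)) + e * t" for t
    have "norm (R s - R a) \<le> \<phi> s - \<phi> a"
    proof (rule differentiable_bound_general[OF as, where f' = R' and
          \<phi>' = "\<lambda>t. L * (g s * exp (2 * L * (t - a))) + e"])
      show "continuous_on {a..s} R" using contR s by (auto intro: continuous_on_subset)
      show "continuous_on {a..s} \<phi>" unfolding \<phi>_def by (intro continuous_intros)
      show "(R has_vector_derivative R' x) (at x)" if "a < x" "x < s" for x
        using R[of x] that s at_within_Icc_at[of a x b] by auto
      show "(\<phi> has_vector_derivative L * (g s * exp (2 * L * (x - a))) + e) (at x)" for x
        unfolding \<phi>_def has_real_derivative_iff_has_vector_derivative[symmetric]
        by (auto intro!: derivative_eq_intros)
      show "norm (R' x) \<le> L * (g s * exp (2 * L * (x - a))) + e" if "a < x" "x < s" for x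
      proof -
        have x: "x \<in> {a..b}" using that s by auto
        have "L * norm (R x) \<le> L * (g s * exp (2 * L * (x - a)))"
          unfolding gR using smax[OF x] \<open>0 < L\<close> by simp
        then show ?thesis using bnd[OF x] by linarith
      qed
    qed
    moreover have "\<phi> s - \<phi> a \<le> g s / 2 * exp (2 * L * (s - a)) + e * (b - a)"
    proof -
      have "e * s - e * a \<le> e * (b - a)"
        using s \<open>0 \<le> e\<close> by (simp add: mult_left_mono flip: right_diff_distrib)
      moreover have "0 \<le> g s" by (simp add: g_def)
      ultimately show ?thesis by (simp add: \<phi>_def)
    qed
    moreover have "norm (R s) \<le> norm (R a) + norm (R s - R a)"
      by (metis add.commute diff_add_cancel norm_triangle_ineq)
    ultimately have "g s * exp (2 * L * (s - a)) \<le> N + g s / 2 * exp (2 * L * (s - a))"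
      unfolding gR[of s, symmetric] by (simp add: N_def)
    then have "g s * exp (2 * L * (s - a)) \<le> 2 * N" by simp
    moreover have "g s * 1 \<le> g s * exp (2 * L * (s - a))"
      using as \<open>0 < L\<close> by (intro mult_left_mono) (auto simp: g_def)
    ultimately show ?thesis by linarith
  qed
  then have "g t \<le> 2 * N" using smax[OF t] by linarith
  then have "norm (R t) \<le> 2 * N * exp (2 * L * (t - a))"
    unfolding gR by simp
  also have "\<dots> \<le> 2 * N * exp (2 * L * (b - a))"
    using t N0 \<open>0 < L\<close> by (intro mult_left_mono) auto
  finally show ?thesis by (simp add: N_def)
qed

section \<open>Solutions on a compact interval\<close>

definition solves_on :: "(real \<Rightarrow> 'a \<Rightarrow> 'a::real_normed_vector) \<Rightarrow> real \<Rightarrow> real \<Rightarrow> (real \<Rightarrow> 'a) \<Rightarrow> bool" where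
  "solves_on V a b X \<longleftrightarrow> (\<forall>t\<in>{a..b}. (X has_vector_derivative V t (X t)) (at t within {a..b}))"

lemma solves_onD: "solves_on V a b X \<Longrightarrow> t \<in> {a..b} \<Longrightarrow> (X has_vector_derivative V t (X t)) (at t within {a..b})"
  by (simp add: solves_on_def)

lemma solves_on_continuous: "solves_on V a b X \<Longrightarrow> continuous_on {a..b} X"
  by (metis continuous_on_eq_continuous_within has_vector_derivative_continuous solves_onD)

lemma solves_on_cong:
  assumes "\<And>t. t \<in> {a..b} \<Longrightarrow> V t (X t) = W t (X t)" "solves_on V a b X"
  shows "solves_on W a b X"
  using assms by (simp add: solves_on_def)

text \<open>The unknown is rescaled to \<open>Y t = exp (- 2 * L * (t - a)) X t\<close>. In this
  weight the integral operator \<open>K\<close> contracts by 1/2 on all of \<open>{a..b}\<close>,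
  whatever its length, so a single fixed point argument suffices.\<close>

lemma picard_lipschitz:
  fixes V :: "real \<Rightarrow> 'a \<Rightarrow> 'a::euclidean_space"
  assumes "a \<le> b" and "0 < L"
    and cont: "continuous_on ({a..b} \<times> UNIV) (\<lambda>(t, X). V t X)"
    and lip: "\<And>t X Y. t \<in> {a..b} \<Longrightarrow> norm (V t X - V t Y) \<le> L * norm (X - Y)"
  obtains X where "X a = \<xi>" "solves_on V a b X"
proof -
  \<comment> \<open>Clamping time to \<open>{a..b}\<close> places the iteration in the complete
    space of bounded continuous functions on the line.\<close>
  define c where "c t = max a (min b t)" for t
  have c: "c t \<in> {a..b}" for t using \<open>a \<le> b\<close> by (auto simp: c_def)
  have cid: "c t = t" if "t \<in> {a..b}" for t using that by (auto simp: c_def)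
  define w where "w t = exp (2 * L * (t - a))" for t
  define W where "W Y r = V r (w r *\<^sub>R Y r)" for Y :: "real \<Rightarrow> 'a" and r
  define k where "k Y s = (1 / w s) *\<^sub>R (\<xi> + integral {a..s} (W Y))" for Y s
  define K where "K Y = Bcontfun (\<lambda>t. k (apply_bcontfun Y) (c t))" for Y
  have wpos: "0 < w t" for t by (simp add: w_def)
  have Wcont: "continuous_on {a..b} (W Y)" if "continuous_on {a..b} Y" for Y
    unfolding W_def
    by (rule continuous_on_compose2[OF cont, of _ "\<lambda>r. (r, w r *\<^sub>R Y r)", simplified])
      (auto simp: w_def intro!: continuous_intros that)
  have kcont: "continuous_on {a..b} (k Y)" if "continuous_on {a..b} Y" for Y
    unfolding k_def w_def
    by (intro continuous_intros indefinite_integral_continuous_1 integrable_continuous_interval Wcont that) auto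
  have "(\<lambda>t. k (apply_bcontfun Y) (c t)) \<in> bcontfun" for Y
  proof -
    have "continuous_on UNIV (\<lambda>t. k (apply_bcontfun Y) (c t))"
      by (rule continuous_on_compose2[OF kcont, of _ UNIV c])
        (use c in \<open>auto simp: c_def intro!: continuous_intros\<close>)
    moreover have "bounded (range (\<lambda>t. k (apply_bcontfun Y) (c t)))"
    proof (rule bounded_subset)
      show "bounded (k (apply_bcontfun Y) ` {a..b})"
        by (intro compact_imp_bounded compact_continuous_image kcont) auto
    qed (use c in auto)
    ultimately show ?thesis by (simp add: bcontfun_def)
  qed
  then have Kapp: "apply_bcontfun (K Y) t = k (apply_bcontfun Y) (c t)" for Y t
    by (simp add: K_def Bcontfun_inverse)
  have contr: "dist (K Y) (K Z) \<le> 1 / 2 * dist Y Z" for Y Z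
  proof (rule dist_bound)
    fix t
    define s where "s = c t"
    have s: "s \<in> {a..b}" using c s_def by simp
    define D where "D = dist Y Z"
    have int: "W (apply_bcontfun U) integrable_on {a..s}" for U
      using s by (intro integrable_continuous_interval continuous_on_subset[OF Wcont]) auto
    have hi: "((\<lambda>r. L * w r * D) has_integral (D / 2 * w s - D / 2 * w a)) {a..s}"
      using s by (intro fundamental_theorem_of_calculus)
        (auto simp: w_def has_real_derivative_iff_has_vector_derivative[symmetric]
          intro!: derivative_eq_intros)
    have "norm (integral {a..s} (\<lambda>r. W (apply_bcontfun Y) r - W (apply_bcontfun Z) r))
        \<le> integral {a..s} (\<lambda>r. L * w r * D)"
    proof (rule integral_norm_bound_integral)
      show "(\<lambda>r. W (apply_bcontfun Y) r - W (apply_bcontfun Z) r) integrable_on {a..s}"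
        by (intro integrable_diff int)
      show "(\<lambda>r. L * w r * D) integrable_on {a..s}" using hi by blast
      fix r assume "r \<in> {a..s}"
      then have r: "r \<in> {a..b}" using s by auto
      have "norm (W (apply_bcontfun Y) r - W (apply_bcontfun Z) r)
          \<le> L * norm (w r *\<^sub>R apply_bcontfun Y r - w r *\<^sub>R apply_bcontfun Z r)"
        unfolding W_def by (rule lip[OF r])
      also have "\<dots> = L * w r * dist (apply_bcontfun Y r) (apply_bcontfun Z r)"
        using wpos[of r] by (simp add: dist_norm flip: scaleR_diff_right)
      also have "\<dots> \<le> L * w r * D"
        using dist_bounded[of Y r Z] wpos[of r] \<open>0 < L\<close> by (simp add: D_def)
      finally show "norm (W (apply_bcontfun Y) r - W (apply_bcontfun Z) r) \<le> L * w r * D" .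
    qed
    also have "\<dots> \<le> D / 2 * w s"
      using wpos[of a] unfolding integral_unique[OF hi] by (simp add: D_def)
    finally have *: "norm (integral {a..s} (W (apply_bcontfun Y)) - integral {a..s} (W (apply_bcontfun Z))) \<le> D / 2 * w s"
      by (simp add: integral_diff int)
    have "dist (apply_bcontfun (K Y) t) (apply_bcontfun (K Z) t)
       = (1 / w s) * norm (integral {a..s} (W (apply_bcontfun Y)) - integral {a..s} (W (apply_bcontfun Z)))"
      using wpos[of s] by (simp add: Kapp k_def dist_norm s_def[symmetric] flip: scaleR_diff_right)
    also have "\<dots> \<le> (1 / w s) * (D / 2 * w s)"
      using * wpos[of s] by (intro mult_left_mono) auto
    also have "\<dots> = 1 / 2 * dist Y Z" using wpos[of s] by (simp add: D_def)
    finally show "dist (apply_bcontfun (K Y) t) (apply_bcontfun (K Z) t) \<le> 1 / 2 * dist Y Z" .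
  qed
  obtain Y where Y: "K Y = Y"
    using banach_fix_type[of "1/2" K] contr by auto
  define X where "X t = w t *\<^sub>R apply_bcontfun Y t" for t
  have Xeq: "X t = \<xi> + integral {a..t} (\<lambda>r. V r (X r))" if "t \<in> {a..b}" for t
  proof -
    have "apply_bcontfun Y t = k (apply_bcontfun Y) t"
      using Kapp[of Y t] Y cid[OF that] by simp
    then show ?thesis using wpos[of t] by (simp add: X_def k_def W_def[abs_def])
  qed
  have Vcont: "continuous_on {a..b} (\<lambda>r. V r (X r))"
    using Wcont[of "apply_bcontfun Y"] by (simp add: W_def[abs_def] X_def)
  have "solves_on V a b X"
    unfolding solves_on_def
  proof
    fix t assume t: "t \<in> {a..b}"
    have "((\<lambda>t. \<xi> + integral {a..t} (\<lambda>r. V r (X r))) has_vector_derivative V t (X t)) (at t within {a..b})"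
      using integral_has_vector_derivative[OF Vcont t] by (auto intro!: derivative_eq_intros)
    then show "(X has_vector_derivative V t (X t)) (at t within {a..b})"
      by (rule has_vector_derivative_transform[rotated 2]) (use t Xeq in auto)
  qed
  moreover have "X a = \<xi>" using Xeq[of a] \<open>a \<le> b\<close> by simp
  ultimately show thesis using that by blast
qed

text \<open>Both points of the difference quotient move. Fixing one at \<open>x\<close> gives the
  derivative; for \<open>x'\<close> near \<open>x\<close>, one difference
  \<open>f (x' + s \<eta>) - f x'\<close> is approximated by both \<open>f' x\<close> and
  \<open>f' x'\<close>, which forces these to be close. Continuity of the derivative thus comes
  without a separate study of how it depends on the point.\<close>

lemma strict_derivative:
  fixes f :: "'a::real_normed_vector \<Rightarrow> 'b::real_normed_vector" and f' :: "'a \<Rightarrow> ('a \<Rightarrow>\<^sub>L 'b)"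
  assumes "open S"
    and strict: "\<And>x e. x \<in> S \<Longrightarrow> 0 < e \<Longrightarrow> \<exists>\<delta>>0. \<forall>y\<in>ball x \<delta>. \<forall>z\<in>ball x \<delta>.
       norm (f y - f z - f' x (y - z)) \<le> e * norm (y - z)"
  shows strict_has_derivative: "x \<in> S \<Longrightarrow> (f has_derivative f' x) (at x)"
    and strict_continuous_derivative: "continuous_on S f'"
proof -
  show "(f has_derivative f' x) (at x)" if "x \<in> S"
    unfolding has_derivative_at_alt
  proof (intro conjI allI impI blinfun.bounded_linear_right)
    fix e :: real assume "0 < e"
    from strict[OF that this] obtain \<delta> where \<delta>: "0 < \<delta>"
      and *: "\<And>y z. y \<in> ball x \<delta> \<Longrightarrow> z \<in> ball x \<delta> \<Longrightarrow> norm (f y - f z - f' x (y - z)) \<le> e * norm (y - z)"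
      by blast
    then show "\<exists>d>0. \<forall>y. norm (y - x) < d \<longrightarrow> norm (f y - f x - f' x (y - x)) \<le> e * norm (y - x)"
      by (intro exI[of _ \<delta>]) (auto simp: dist_norm norm_minus_commute)
  qed
  show "continuous_on S f'"
    unfolding continuous_on_iff
  proof (intro ballI allI impI)
    fix x and e :: real assume x: "x \<in> S" and "0 < e"
    then have e3: "0 < e / 3" by simp
    from strict[OF x this] obtain \<delta> where \<delta>: "0 < \<delta>"
      and 1: "\<And>y z. y \<in> ball x \<delta> \<Longrightarrow> z \<in> ball x \<delta> \<Longrightarrow> norm (f y - f z - f' x (y - z)) \<le> e / 3 * norm (y - z)"
      by blast
    show "\<exists>d>0. \<forall>x'\<in>S. dist x' x < d \<longrightarrow> dist (f' x') (f' x) < e"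
    proof (intro exI conjI ballI impI, rule \<delta>)
      fix x' assume x': "x' \<in> S" and d: "dist x' x < \<delta>"
      from strict[OF x' e3] obtain \<delta>' where \<delta>': "0 < \<delta>'"
        and 2: "\<And>y z. y \<in> ball x' \<delta>' \<Longrightarrow> z \<in> ball x' \<delta>' \<Longrightarrow> norm (f y - f z - f' x' (y - z)) \<le> e / 3 * norm (y - z)"
        by blast
      have "norm (f' x' - f' x) \<le> 2 * e / 3"
      proof (rule norm_blinfun_bound)
        fix \<eta> :: 'a
        show "norm ((f' x' - f' x) \<eta>) \<le> 2 * e / 3 * norm \<eta>"
        proof -
          \<comment> \<open>A displacement shorter than \<open>m\<close> stays in both balls. The
            \<open>+ 1\<close> in the next line covers \<eta> = 0.\<close>
          define m where "m = min \<delta>' (\<delta> - dist x' x)"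
          define s where "s = m / (norm \<eta> + 1)"
          have m: "0 < m" using \<delta>' d by (simp add: m_def)
          have s: "0 < s" using m norm_ge_zero[of \<eta>] by (simp add: s_def add_nonneg_pos)
          have "s * norm \<eta> < s * (norm \<eta> + 1)" using s by simp
          also have "\<dots> = m" using norm_ge_zero[of \<eta>] by (simp add: s_def add_nonneg_pos less_imp_neq[THEN not_sym])
          finally have sm: "norm (s *\<^sub>R \<eta>) < m" using s by simp
          have in1: "x' + s *\<^sub>R \<eta> \<in> ball x \<delta>"
            using sm dist_triangle[of x "x' + s *\<^sub>R \<eta>" x'] by (simp add: m_def dist_norm norm_minus_commute)
          have in2: "x' \<in> ball x \<delta>" using d by (simp add: dist_commute)
          have in3: "x' + s *\<^sub>R \<eta> \<in> ball x' \<delta>'" "x' \<in> ball x' \<delta>'"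
            using sm \<delta>' by (simp_all add: m_def dist_norm)
          let ?D = "f (x' + s *\<^sub>R \<eta>) - f x'"
          have "norm (?D - f' x (s *\<^sub>R \<eta>)) \<le> e / 3 * norm (s *\<^sub>R \<eta>)"
            using 1[OF in1 in2] by simp
          moreover have "norm (?D - f' x' (s *\<^sub>R \<eta>)) \<le> e / 3 * norm (s *\<^sub>R \<eta>)"
            using 2[OF in3] by simp
          moreover have eq: "(f' x' - f' x) (s *\<^sub>R \<eta>) = (?D - f' x (s *\<^sub>R \<eta>)) - (?D - f' x' (s *\<^sub>R \<eta>))"
            by (simp add: blinfun.diff_left)
          ultimately have "norm ((f' x' - f' x) (s *\<^sub>R \<eta>)) \<le> e / 3 * norm (s *\<^sub>R \<eta>) + e / 3 * norm (s *\<^sub>R \<eta>)"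
            unfolding eq using norm_triangle_ineq4[of "?D - f' x (s *\<^sub>R \<eta>)" "?D - f' x' (s *\<^sub>R \<eta>)"] by linarith
          then have "s * norm ((f' x' - f' x) \<eta>) \<le> s * (2 * e / 3 * norm \<eta>)"
            using s by (simp add: blinfun.scaleR_right)
          then show ?thesis using s by simp
        qed
      qed (use \<open>0 < e\<close> in simp)
      then show "dist (f' x') (f' x) < e" using \<open>0 < e\<close> by (simp add: dist_norm)
    qed
  qed
qed

lemma solves_on_dist_le:
  fixes V :: "real \<Rightarrow> 'a \<Rightarrow> 'a::real_normed_vector"
  assumes "a \<le> b" "0 < L" and X: "solves_on V a b X" and Y: "solves_on V a b Y"
    and lip: "\<And>t. t \<in> {a..b} \<Longrightarrow> norm (V t (X t) - V t (Y t)) \<le> L * norm (X t - Y t)"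
    and t: "t \<in> {a..b}"
  shows "norm (X t - Y t) \<le> 2 * exp (2 * L * (b - a)) * norm (X a - Y a)"
  using gronwall_vector[of a b L 0 "\<lambda>t. X t - Y t" "\<lambda>t. V t (X t) - V t (Y t)" t]
    assms has_vector_derivative_diff[OF solves_onD[OF X] solves_onD[OF Y]]
  by (simp add: mult_ac)

section \<open>Flow of a C1 field and its derivative in the initial value\<close>

locale c1_field =
  fixes V :: "real \<Rightarrow> 'a \<Rightarrow> 'a::euclidean_space" and DV :: "real \<Rightarrow> 'a \<Rightarrow> ('a \<Rightarrow>\<^sub>L 'a)" and a b :: real
  assumes ab: "a < b"
    and deriv_V: "\<And>t X. t \<in> {a..b} \<Longrightarrow> (V t has_derivative DV t X) (at X)"
    and cont_V: "continuous_on ({a..b} \<times> UNIV) (\<lambda>(t, X). V t X)"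
    and cont_DV: "continuous_on ({a..b} \<times> UNIV) (\<lambda>(t, X). DV t X)"
begin

lemma bounded_DV: "\<exists>L>0. \<forall>t\<in>{a..b}. \<forall>X\<in>cball 0 R. norm (DV t X) \<le> L"
proof -
  have "compact ((\<lambda>(t, X). DV t X) ` ({a..b} \<times> cball 0 R))"
    by (intro compact_continuous_image continuous_on_subset[OF cont_DV] compact_Times) auto
  then obtain L where "0 < L" "\<forall>x\<in>(\<lambda>(t, X). DV t X) ` ({a..b} \<times> cball 0 R). norm x \<le> L"
    using compact_imp_bounded bounded_pos by metis
  then show ?thesis by (intro exI[of _ L]) force+
qed

lemma lipschitz_if_bounded_DV:
  assumes "\<And>X. X \<in> cball 0 R \<Longrightarrow> norm (DV t X) \<le> L" "t \<in> {a..b}" "X \<in> cball 0 R" "Y \<in> cball 0 R"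
  shows "norm (V t X - V t Y) \<le> L * norm (X - Y)"
  using assms
  by (intro differentiable_bound[of "cball 0 R" "V t" "\<lambda>X. DV t X"])
    (auto intro!: has_derivative_at_withinI deriv_V simp flip: norm_blinfun.rep_eq)

lemma solves_on_unique:
  assumes X: "solves_on V a b X" and Y: "solves_on V a b Y" and "X a = Y a" and t: "t \<in> {a..b}"
  shows "X t = Y t"
proof -
  have "compact (X ` {a..b} \<union> Y ` {a..b})"
    by (intro compact_Un compact_continuous_image solves_on_continuous[OF X] solves_on_continuous[OF Y] compact_Icc)
  then obtain R where R: "\<And>x. x \<in> X ` {a..b} \<union> Y ` {a..b} \<Longrightarrow> norm x \<le> R"
    using compact_imp_bounded bounded_pos by metis
  obtain L where L: "0 < L" "\<And>t X. t \<in> {a..b} \<Longrightarrow> X \<in> cball 0 R \<Longrightarrow> norm (DV t X) \<le> L"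
    using bounded_DV[of R] by blast
  have "norm (X t - Y t) \<le> 2 * exp (2 * L * (b - a)) * norm (X a - Y a)"
  proof (rule solves_on_dist_le[OF _ L(1) X Y _ t])
    show "norm (V t (X t) - V t (Y t)) \<le> L * norm (X t - Y t)" if "t \<in> {a..b}" for t
      using that by (intro lipschitz_if_bounded_DV[of R]) (auto intro!: L R)
  qed (use ab in auto)
  then show ?thesis using assms by simp
qed

lemma cont_linearised:
  assumes "continuous_on {a..b} X"
  shows "continuous_on {a..b} (\<lambda>t. DV t (X t))"
  by (rule continuous_on_compose2[OF cont_DV, of _ "\<lambda>t. (t, X t)", simplified])
    (auto intro!: continuous_intros assms)

text \<open>The variational equation is again a field of this kind, so the uniqueness and
  compactness results apply to it as well.\<close>

lemma linearised_field:
  assumes "continuous_on {a..b} X"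
  shows "c1_field (\<lambda>t. blinfun_apply (DV t (X t))) (\<lambda>t _. DV t (X t)) a b"
proof
  show "continuous_on ({a..b} \<times> UNIV) (\<lambda>(t, Y). DV t (X t) Y)"
    unfolding case_prod_beta
    by (intro continuous_intros continuous_on_compose2[OF cont_linearised[OF assms]]) auto
  show "continuous_on ({a..b} \<times> UNIV) (\<lambda>(t, Y). DV t (X t))"
    unfolding case_prod_beta
    by (intro continuous_intros continuous_on_compose2[OF cont_linearised[OF assms]]) auto
qed (auto simp: ab blinfun.bounded_linear_right bounded_linear_imp_has_derivative)

lemma linearised_solution:
  assumes "continuous_on {a..b} X"
  shows "\<exists>w. w a = \<eta> \<and> solves_on (\<lambda>t. blinfun_apply (DV t (X t))) a b w"
proof -
  interpret lin: c1_field "\<lambda>t. blinfun_apply (DV t (X t))" "\<lambda>t _. DV t (X t)" a b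
    by (rule linearised_field[OF assms])
  \<comment> \<open>Radius 0 is enough, since the derivative of a linear field does not depend on
    the state.\<close>
  obtain L where L1: "0 < L" "\<And>t Y. t \<in> {a..b} \<Longrightarrow> Y \<in> cball (0::'a) 0 \<Longrightarrow> norm (DV t (X t)) \<le> L"
    using lin.bounded_DV[of 0] by blast
  then have L: "0 < L" "\<And>t. t \<in> {a..b} \<Longrightarrow> norm (DV t (X t)) \<le> L"
    using L1(2)[of _ 0] by auto
  show ?thesis
  proof (rule picard_lipschitz[OF _ L(1) lin.cont_V, of \<eta>])
    fix t Y Z assume t: "t \<in> {a..b}"
    have "norm (DV t (X t) (Y - Z)) \<le> norm (DV t (X t)) * norm (Y - Z)"
      by (rule norm_blinfun)
    also have "\<dots> \<le> L * norm (Y - Z)" by (intro mult_right_mono L t) simp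
    finally show "norm (DV t (X t) Y - DV t (X t) Z) \<le> L * norm (Y - Z)"
      by (simp add: blinfun.diff_right)
  qed (use ab in auto)
qed

text \<open>The field is cut off outside a large ball to become globally Lipschitz, so all solutions
  exist on \<open>{a..b}\<close>; those starting near \<open>X0 a\<close> never leave the ball and
  solve the original equation. The derivative candidate is the end value of the variational
  solution, and Gronwall gives the two-point estimate that \<open>strict_derivative\<close> asks
  for.\<close>

theorem flow_C1:
  assumes X0: "solves_on V a b X0"
  obtains r C \<Phi> and \<Phi>' :: "'a \<Rightarrow> ('a \<Rightarrow>\<^sub>L 'a)" where "0 < r" "0 < C"
    "\<And>\<xi>. \<xi> \<in> ball (X0 a) r \<Longrightarrow> \<Phi> \<xi> a = \<xi>"
    "\<And>\<xi>. \<xi> \<in> ball (X0 a) r \<Longrightarrow> solves_on V a b (\<Phi> \<xi>)"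
    "\<And>\<xi> t. \<xi> \<in> ball (X0 a) r \<Longrightarrow> t \<in> {a..b} \<Longrightarrow> dist (\<Phi> \<xi> t) (X0 t) \<le> C * dist \<xi> (X0 a)"
    "\<And>\<xi>. \<xi> \<in> ball (X0 a) r \<Longrightarrow> ((\<lambda>\<xi>. \<Phi> \<xi> b) has_derivative \<Phi>' \<xi>) (at \<xi>)"
    "continuous_on (ball (X0 a) r) \<Phi>'"
    "\<And>\<xi> \<eta>. \<xi> \<in> ball (X0 a) r \<Longrightarrow>
       \<exists>w. w a = \<eta> \<and> solves_on (\<lambda>t. blinfun_apply (DV t (\<Phi> \<xi> t))) a b w \<and> w b = \<Phi>' \<xi> \<eta>"
proof -
  have "compact (X0 ` {a..b})"
    by (intro compact_continuous_image solves_on_continuous[OF X0] compact_Icc)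
  then obtain B where B: "\<And>t. t \<in> {a..b} \<Longrightarrow> norm (X0 t) \<le> B"
    using compact_imp_bounded bounded_pos by (metis image_eqI)
  \<comment> \<open>Nearby solutions stay within 1 of \<open>X0\<close>, hence have norm at most
    \<open>R - 1\<close>; the remaining unit is room for the linearisation estimate.\<close>
  define R where "R = \<bar>B\<bar> + 2"
  have R0: "0 < R" by (simp add: R_def)
  obtain L where L: "0 < L" "\<And>t X. t \<in> {a..b} \<Longrightarrow> X \<in> cball 0 R \<Longrightarrow> norm (DV t X) \<le> L"
    using bounded_DV[of R] by blast
  define \<pi> where "\<pi> = closest_point (cball (0::'a) R)"
  have \<pi>_in: "\<pi> X \<in> cball 0 R" for X
    unfolding \<pi>_def by (rule closest_point_in_set) (use R0 in auto)
  have \<pi>_id: "\<pi> X = X" if "norm X \<le> R" for X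
    unfolding \<pi>_def by (rule closest_point_self) (use that in simp)
  have \<pi>_lip: "norm (\<pi> X - \<pi> Y) \<le> norm (X - Y)" for X Y
    using closest_point_lipschitz[of "cball (0::'a) R" X Y] R0 by (simp add: \<pi>_def dist_norm)
  define U where "U t X = V t (\<pi> X)" for t X
  have U_lip: "norm (U t X - U t Y) \<le> L * norm (X - Y)" if "t \<in> {a..b}" for t X Y
  proof -
    have "norm (U t X - U t Y) \<le> L * norm (\<pi> X - \<pi> Y)"
      unfolding U_def by (intro lipschitz_if_bounded_DV[of R] L that \<pi>_in)
    also have "\<dots> \<le> L * norm (X - Y)" using \<pi>_lip L(1) by simp
    finally show ?thesis .
  qed
  have U_cont: "continuous_on ({a..b} \<times> UNIV) (\<lambda>(t, X). U t X)"
  proof -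
    have "continuous_on UNIV \<pi>"
      unfolding \<pi>_def by (rule continuous_on_closest_point) (use R0 in auto)
    then have "continuous_on ({a..b} \<times> UNIV) (\<lambda>z. (fst z, \<pi> (snd z)))"
      by (intro continuous_on_Pair continuous_on_compose2[of UNIV \<pi> _ snd] continuous_on_fst continuous_on_snd continuous_on_id) auto
    from continuous_on_compose2[OF cont_V this] show ?thesis
      by (simp add: U_def case_prod_beta image_subset_iff mem_Times_iff)
  qed
  have "\<exists>X. X a = \<xi> \<and> solves_on U a b X" for \<xi>
    using picard_lipschitz[OF _ L(1) U_cont U_lip] ab by (metis less_imp_le)
  then obtain \<Phi> where \<Phi>_a: "\<And>\<xi>. \<Phi> \<xi> a = \<xi>" and \<Phi>_U: "\<And>\<xi>. solves_on U a b (\<Phi> \<xi>)"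
    by metis
  have X0_U: "solves_on U a b X0"
  proof (rule solves_on_cong[OF _ X0])
    fix t assume "t \<in> {a..b}"
    then have "norm (X0 t) \<le> R" using B[of t] by (simp add: R_def)
    then show "V t (X0 t) = U t (X0 t)" by (simp add: U_def \<pi>_id)
  qed
  define C where "C = 2 * exp (2 * L * (b - a))"
  have C0: "0 < C" by (simp add: C_def)
  have dist_U: "norm (X t - Y t) \<le> C * norm (X a - Y a)"
    if "solves_on U a b X" "solves_on U a b Y" "t \<in> {a..b}" for X Y t
    unfolding C_def by (intro solves_on_dist_le[OF _ L(1) that(1,2) U_lip that(3)]) (use ab in auto)
  \<comment> \<open>\<open>C\<close> is the Lipschitz constant of the flow, so initial distance
    below \<open>1 / C\<close> remains below 1.\<close>
  define r where "r = 1 / C"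
  have r0: "0 < r" using C0 by (simp add: r_def)
  define S where "S = ball (X0 a) r"
  have near: "norm (\<Phi> \<xi> t - X0 t) < 1" if "\<xi> \<in> S" "t \<in> {a..b}" for \<xi> t
  proof -
    have "norm (\<Phi> \<xi> t - X0 t) \<le> C * norm (\<xi> - X0 a)"
      using dist_U[OF \<Phi>_U X0_U that(2)] by (simp add: \<Phi>_a)
    also have "\<dots> < 1" using that(1) C0
      by (simp add: S_def r_def dist_norm norm_minus_commute field_simps)
    finally show ?thesis .
  qed
  have in_R: "norm (\<Phi> \<xi> t) \<le> R - 1" if "\<xi> \<in> S" "t \<in> {a..b}" for \<xi> t
    using near[OF that] B[OF that(2)] norm_triangle_ineq2[of "\<Phi> \<xi> t" "X0 t"] by (simp add: R_def)
  have \<Phi>_V: "solves_on V a b (\<Phi> \<xi>)" if "\<xi> \<in> S" for \<xi>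
  proof (rule solves_on_cong[OF _ \<Phi>_U])
    fix t assume "t \<in> {a..b}"
    then have "norm (\<Phi> \<xi> t) \<le> R" using in_R[OF that, of t] by simp
    then show "U t (\<Phi> \<xi> t) = V t (\<Phi> \<xi> t)" by (simp add: U_def \<pi>_id)
  qed
  have \<Phi>_cont: "continuous_on {a..b} (\<Phi> \<xi>)" for \<xi>
    by (rule solves_on_continuous[OF \<Phi>_U])
  define w where "w \<xi> \<eta> = (SOME w. w a = \<eta> \<and> solves_on (\<lambda>t. blinfun_apply (DV t (\<Phi> \<xi> t))) a b w)" for \<xi> \<eta>
  have w_a: "w \<xi> \<eta> a = \<eta>" and w_sol: "solves_on (\<lambda>t. blinfun_apply (DV t (\<Phi> \<xi> t))) a b (w \<xi> \<eta>)" for \<xi> \<eta>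
    using someI_ex[OF linearised_solution[OF \<Phi>_cont, of \<eta> \<xi>]] by (simp_all add: w_def)
  have w_lin: "linear (\<lambda>\<eta>. w \<xi> \<eta> b)" for \<xi>
  proof -
    interpret lin: c1_field "\<lambda>t. blinfun_apply (DV t (\<Phi> \<xi> t))" "\<lambda>t _. DV t (\<Phi> \<xi> t)" a b
      by (rule linearised_field[OF \<Phi>_cont])
    show ?thesis
    proof (rule linearI)
      fix \<eta>1 \<eta>2
      have "solves_on (\<lambda>t. blinfun_apply (DV t (\<Phi> \<xi> t))) a b (\<lambda>t. w \<xi> \<eta>1 t + w \<xi> \<eta>2 t)"
        unfolding solves_on_def
        by (auto intro!: derivative_eq_intros solves_onD[OF w_sol] simp: blinfun.add_right)
      from lin.solves_on_unique[OF w_sol[of \<xi> "\<eta>1 + \<eta>2"] this, of b]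
      show "w \<xi> (\<eta>1 + \<eta>2) b = w \<xi> \<eta>1 b + w \<xi> \<eta>2 b"
        using ab by (simp add: w_a)
    next
      fix k \<eta>
      have "solves_on (\<lambda>t. blinfun_apply (DV t (\<Phi> \<xi> t))) a b (\<lambda>t. k *\<^sub>R w \<xi> \<eta> t)"
        unfolding solves_on_def
        by (auto intro!: derivative_eq_intros solves_onD[OF w_sol] simp: blinfun.scaleR_right)
      from lin.solves_on_unique[OF w_sol[of \<xi> "k *\<^sub>R \<eta>"] this, of b]
      show "w \<xi> (k *\<^sub>R \<eta>) b = k *\<^sub>R w \<xi> \<eta> b"
        using ab by (simp add: w_a)
    qed
  qed
  define \<Phi>' where "\<Phi>' \<xi> = Blinfun (\<lambda>\<eta>. w \<xi> \<eta> b)" for \<xi>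
  have \<Phi>': "\<Phi>' \<xi> \<eta> = w \<xi> \<eta> b" for \<xi> \<eta>
    unfolding \<Phi>'_def using w_lin by (simp add: bounded_linear_Blinfun_apply linear_conv_bounded_linear)
  have strict: "\<exists>\<delta>>0. \<forall>y\<in>ball \<xi> \<delta>. \<forall>z\<in>ball \<xi> \<delta>.
      norm (\<Phi> y b - \<Phi> z b - \<Phi>' \<xi> (y - z)) \<le> e * norm (y - z)" if \<xi>: "\<xi> \<in> S" and e: "0 < e" for \<xi> e
  proof -
    \<comment> \<open>Chosen so that the final Gronwall bound is exactly
      \<open>e * norm (y - z)\<close>.\<close>
    define e' where "e' = e / (2 * C * (b - a) * exp (2 * L * (b - a)))"
    have e': "0 < e'" using e C0 ab by (simp add: e'_def)
    have "uniformly_continuous_on ({a..b} \<times> cball 0 R) (\<lambda>(t, X). DV t X)"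
      by (intro compact_uniformly_continuous continuous_on_subset[OF cont_DV] compact_Times) auto
    then obtain \<kappa> where \<kappa>: "0 < \<kappa>" and uc: "\<And>p q. p \<in> {a..b} \<times> cball 0 R \<Longrightarrow> q \<in> {a..b} \<times> cball 0 R \<Longrightarrow>
        dist p q < \<kappa> \<Longrightarrow> dist (DV (fst p) (snd p)) (DV (fst q) (snd q)) < e'"
      unfolding uniformly_continuous_on_def case_prod_beta using e' by (meson dist_commute order.strict_trans1 order_refl)
    \<comment> \<open>The cap 1 keeps the ball around \<open>\<Phi> \<xi> t\<close> inside
      \<open>cball 0 R\<close>, where \<open>DV\<close> is uniformly continuous.\<close>
    define \<kappa>' where "\<kappa>' = min \<kappa> 1"
    obtain \<delta>0 where \<delta>0: "0 < \<delta>0" "ball \<xi> \<delta>0 \<subseteq> S"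
      using \<xi> openE[of S \<xi>] by (metis S_def open_ball)
    define \<delta> where "\<delta> = min \<delta>0 (\<kappa>' / C)"
    have \<delta>: "0 < \<delta>" using \<delta>0 \<kappa> C0 by (simp add: \<delta>_def \<kappa>'_def)
    have close: "\<Phi> y t \<in> ball (\<Phi> \<xi> t) \<kappa>'" if "y \<in> ball \<xi> \<delta>" "t \<in> {a..b}" for y t
    proof -
      have "norm (\<Phi> \<xi> t - \<Phi> y t) \<le> C * norm (\<xi> - y)"
        using dist_U[OF \<Phi>_U \<Phi>_U that(2), of \<xi> y] by (simp add: \<Phi>_a)
      also have "\<dots> < C * (\<kappa>' / C)" using that(1) C0
        by (intro mult_strict_left_mono) (auto simp: \<delta>_def dist_norm)
      finally show ?thesis using C0 by (simp add: dist_norm)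
    qed
    have lin: "norm (V t X - V t Y - DV t (\<Phi> \<xi> t) (X - Y)) \<le> e' * norm (X - Y)"
      if t: "t \<in> {a..b}" and XY: "X \<in> ball (\<Phi> \<xi> t) \<kappa>'" "Y \<in> ball (\<Phi> \<xi> t) \<kappa>'" for t X Y
    proof -
      have sub: "ball (\<Phi> \<xi> t) \<kappa>' \<subseteq> cball 0 R"
      proof
        fix Z assume "Z \<in> ball (\<Phi> \<xi> t) \<kappa>'"
        then show "Z \<in> cball 0 R" using in_R[OF \<xi> t] norm_triangle_ineq2[of Z "\<Phi> \<xi> t"]
          by (simp add: \<kappa>'_def dist_norm norm_minus_commute)
      qed
      \<comment> \<open>With the linear part removed, the derivative of \<open>g\<close> is below
        \<open>e'\<close> on the ball, and the mean value inequality bounds the linearisation error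
        for two arbitrary points.\<close>
      define g where "g X = V t X - DV t (\<Phi> \<xi> t) X" for X
      have "norm (g X - g Y) \<le> e' * norm (X - Y)"
      proof (rule differentiable_bound[of "ball (\<Phi> \<xi> t) \<kappa>'" g "\<lambda>Z. blinfun_apply (DV t Z - DV t (\<Phi> \<xi> t))"])
        fix Z assume Z: "Z \<in> ball (\<Phi> \<xi> t) \<kappa>'"
        show "(g has_derivative (DV t Z - DV t (\<Phi> \<xi> t))) (at Z within ball (\<Phi> \<xi> t) \<kappa>')"
          unfolding g_def
          by (rule has_derivative_at_withinI)
            (auto intro!: derivative_eq_intros deriv_V[OF t] blinfun.bounded_linear_right simp: blinfun.diff_left)
        have "dist (DV t Z) (DV t (\<Phi> \<xi> t)) < e'"
          using uc[of "(t, Z)" "(t, \<Phi> \<xi> t)"] t Z sub in_R[OF \<xi> t] \<kappa>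
          by (auto simp: \<kappa>'_def dist_Pair_Pair dist_commute)
        then show "onorm (blinfun_apply (DV t Z - DV t (\<Phi> \<xi> t))) \<le> e'"
          by (simp add: dist_norm norm_blinfun.rep_eq)
      qed (use XY in auto)
      then show ?thesis by (simp add: g_def blinfun.diff_right algebra_simps)
    qed
    show ?thesis
    proof (intro exI conjI ballI, rule \<delta>)
      fix y z assume y: "y \<in> ball \<xi> \<delta>" and z: "z \<in> ball \<xi> \<delta>"
      have yS: "y \<in> S" "z \<in> S" using y z \<delta>0 by (auto simp: \<delta>_def)
      let ?A = "\<lambda>t. blinfun_apply (DV t (\<Phi> \<xi> t))"
      let ?W = "w \<xi> (y - z)"
      have "norm (\<Phi> y b - \<Phi> z b - ?W b)
         \<le> 2 * (norm (\<Phi> y a - \<Phi> z a - ?W a) + e' * C * norm (y - z) * (b - a)) * exp (2 * L * (b - a))"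
      proof (rule gronwall_vector[where R' = "\<lambda>t. V t (\<Phi> y t) - V t (\<Phi> z t) - ?A t (?W t)"])
        fix t assume t: "t \<in> {a..b}"
        show "((\<lambda>t. \<Phi> y t - \<Phi> z t - ?W t) has_vector_derivative V t (\<Phi> y t) - V t (\<Phi> z t) - ?A t (?W t)) (at t within {a..b})"
          by (intro has_vector_derivative_diff solves_onD[OF \<Phi>_V[OF yS(1)] t] solves_onD[OF \<Phi>_V[OF yS(2)] t] solves_onD[OF w_sol t])
        have "norm (V t (\<Phi> y t) - V t (\<Phi> z t) - ?A t (\<Phi> y t - \<Phi> z t)) \<le> e' * norm (\<Phi> y t - \<Phi> z t)"
          by (intro lin t close y z)
        also have "\<dots> \<le> e' * (C * norm (y - z))"
          using dist_U[OF \<Phi>_U \<Phi>_U t, of y z] e' by (simp add: \<Phi>_a)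
        finally have 1: "norm (V t (\<Phi> y t) - V t (\<Phi> z t) - ?A t (\<Phi> y t - \<Phi> z t)) \<le> e' * C * norm (y - z)"
          by simp
        have "norm (?A t (\<Phi> y t - \<Phi> z t - ?W t)) \<le> norm (DV t (\<Phi> \<xi> t)) * norm (\<Phi> y t - \<Phi> z t - ?W t)"
          by (rule norm_blinfun)
        also have "\<dots> \<le> L * norm (\<Phi> y t - \<Phi> z t - ?W t)"
          using in_R[OF \<xi> t] by (intro mult_right_mono L(2) t) auto
        finally have 2: "norm (?A t (\<Phi> y t - \<Phi> z t - ?W t)) \<le> L * norm (\<Phi> y t - \<Phi> z t - ?W t)" .
        have "V t (\<Phi> y t) - V t (\<Phi> z t) - ?A t (?W t)
           = (V t (\<Phi> y t) - V t (\<Phi> z t) - ?A t (\<Phi> y t - \<Phi> z t)) + ?A t (\<Phi> y t - \<Phi> z t - ?W t)"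
          by (simp add: blinfun.diff_right)
        then show "norm (V t (\<Phi> y t) - V t (\<Phi> z t) - ?A t (?W t)) \<le> L * norm (\<Phi> y t - \<Phi> z t - ?W t) + e' * C * norm (y - z)"
          unfolding add.commute[of "L * _"] by (metis 1 2 add_mono norm_triangle_le)
      qed (use ab L e' C0 in auto)
      also have "\<dots> = e * norm (y - z)"
        using C0 ab by (simp add: \<Phi>_a w_a e'_def)
      finally show "norm (\<Phi> y b - \<Phi> z b - \<Phi>' \<xi> (y - z)) \<le> e * norm (y - z)"
        by (simp add: \<Phi>')
    qed
  qed
  have oS: "open S" by (simp add: S_def)
  show thesis
  proof (rule that[of r C \<Phi> \<Phi>'], unfold S_def[symmetric])
    show "((\<lambda>\<xi>. \<Phi> \<xi> b) has_derivative \<Phi>' \<xi>) (at \<xi>)" if "\<xi> \<in> S" for \<xi>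
      using strict_has_derivative[OF oS, of "\<lambda>\<xi>. \<Phi> \<xi> b" \<Phi>'] strict that by blast
    show "continuous_on S \<Phi>'"
      using strict_continuous_derivative[OF oS, of "\<lambda>\<xi>. \<Phi> \<xi> b" \<Phi>'] strict by blast
    show "dist (\<Phi> \<xi> t) (X0 t) \<le> C * dist \<xi> (X0 a)" if "t \<in> {a..b}" for \<xi> t
      using dist_U[OF \<Phi>_U X0_U that, of \<xi>] by (simp add: \<Phi>_a dist_norm)
    show "\<exists>wa. wa a = \<eta> \<and> solves_on (\<lambda>t. blinfun_apply (DV t (\<Phi> \<xi> t))) a b wa \<and> wa b = \<Phi>' \<xi> \<eta>" for \<xi> \<eta>
      using w_a w_sol \<Phi>' by metis
  qed (use r0 C0 \<Phi>_a \<Phi>_V in auto)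
qed

end

subsection \<open>Integrals and periodic functions\<close>

lemma primitive_has_derivative:
  assumes "continuous_on UNIV g"
  shows "(primitive g has_real_derivative g x) (at x)"
proof -
  let ?a = "min x 0 - 1" and ?b = "max x 0 + 1"
  have "((\<lambda>u. LBINT y=0..u. g y) has_vector_derivative g x) (at x within {?a..?b})"
    using interval_integral_FTC2[of ?a 0 ?b g x] continuous_on_subset[OF assms]
    by (auto simp: zero_ereal_def)
  then show ?thesis
    by (subst (asm) at_within_Icc_at)
      (auto simp: primitive_def[abs_def] zero_ereal_def has_real_derivative_iff_has_vector_derivative)
qed

lemma LBINT_antiderivative:
  fixes g G :: "real \<Rightarrow> real"
  assumes "continuous_on {a..b} g" "a \<le> b"
    and "\<And>t. t \<in> {a..b} \<Longrightarrow> (G has_real_derivative g t) (at t within {a..b})"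
  shows "(LBINT t=ereal a..ereal b. g t) = G b - G a"
  using interval_integral_FTC_finite[of a b g G] assms
  by (simp add: has_real_derivative_iff_has_vector_derivative)

lemma LBINT_primitive:
  assumes "continuous_on UNIV g" "a \<le> b"
  shows "(LBINT t=ereal a..ereal b. g t) = primitive g b - primitive g a"
  using assms
  by (intro LBINT_antiderivative DERIV_subset[OF primitive_has_derivative] continuous_on_subset[OF assms(1)]) auto

text \<open>With \<open>G\<close> the primitive, \<open>G (t + T) - G t\<close> has derivative
  \<open>g (t + T) - g t = 0\<close>. This moves the phase from \<open>x\<close> to \<gamma> in all
  integrals and lets them start at \<open>a\<close>.\<close>

lemma LBINT_periodic_shift:
  fixes g :: "real \<Rightarrow> real"
  assumes g: "continuous_on UNIV g" and per: "\<And>t. g (t + T) = g t" and "0 \<le> T"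
  shows "(LBINT t=0..T. g (t + s)) = (LBINT t=ereal a..ereal (a + T). g t)"
proof -
  let ?D = "\<lambda>t. primitive g (t + T) - primitive g t"
  have dG: "(primitive g has_real_derivative g x) (at x)" for x
    by (rule primitive_has_derivative[OF g])
  have "(?D has_real_derivative g (t + T) - g t) (at t)" for t
    by (rule DERIV_diff[OF DERIV_shift[THEN iffD1, OF dG] dG])
  then have const: "?D s = ?D a"
    using DERIV_isconst_all[of ?D s a] by (simp add: per)
  have "(LBINT t=ereal 0..ereal T. g (t + s)) = primitive g (T + s) - primitive g (0 + s)"
    using \<open>0 \<le> T\<close> g
    by (intro LBINT_antiderivative[where G = "\<lambda>t. primitive g (t + s)"])
      (auto intro!: continuous_intros continuous_on_compose2[OF g] DERIV_shift[THEN iffD1, OF dG, THEN DERIV_subset])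
  also have "\<dots> = (LBINT t=ereal a..ereal (a + T). g t)"
    using const LBINT_primitive[OF g, of a "a + T"] \<open>0 \<le> T\<close> by (simp add: add.commute)
  finally show ?thesis by (simp add: zero_ereal_def)
qed

text \<open>Glues one-sided derivatives at the joints of a periodic extension.\<close>

lemma has_vector_derivative_Un:
  assumes "(f has_vector_derivative D) (at x within S)" "(f has_vector_derivative D) (at x within T)"
  shows "(f has_vector_derivative D) (at x within S \<union> T)"
  using assms unfolding has_vector_derivative_def has_derivative_within by (auto intro: Lim_Un)

text \<open>Equal end values of \<open>X\<close> make the extension continuous, equal end values of
  \<open>Z\<close> make it differentiable at the joints. The reduced time \<open>s\<close> in the
  third conclusion allows a T-periodic differential equation, or any bound on one period, to be
  carried to the whole line.\<close>

lemma periodic_extension: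
  fixes X Z :: "real \<Rightarrow> 'a::real_normed_vector"
  assumes T: "0 < T"
    and X: "\<And>t. t \<in> {a..a + T} \<Longrightarrow> (X has_vector_derivative Z t) (at t within {a..a + T})"
    and per: "X (a + T) = X a" "Z (a + T) = Z a"
  obtains Y W where
    "\<And>t. (Y has_vector_derivative W t) (at t)"
    "\<And>t. Y (t + T) = Y t"
    "\<And>t. \<exists>s\<in>{a..a + T}. \<exists>n::int. s = t - of_int n * T \<and> Y t = X s \<and> W t = Z s"
    "\<And>t. t \<in> {a..a + T} \<Longrightarrow> Y t = X t"
proof -
  define n where "n t = \<lfloor>(t - a) / T\<rfloor>" for t
  define r where "r t = t - of_int (n t) * T" for t
  define Y where "Y = X \<circ> r"
  define W where "W = Z \<circ> r"
  have n_eq: "n t = k" if "a + of_int k * T \<le> t" "t < a + of_int k * T + T" for t k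
    unfolding n_def using that T by (intro floor_unique) (auto simp: field_simps)
  have n_bounds: "a + of_int (n t) * T \<le> t" "t < a + of_int (n t) * T + T" for t
  proof -
    have "of_int (n t) \<le> (t - a) / T" "(t - a) / T < of_int (n t) + 1"
      unfolding n_def by linarith+
    then show "a + of_int (n t) * T \<le> t" "t < a + of_int (n t) * T + T"
      using T by (simp_all add: field_simps)
  qed
  define K where "K k = {a + of_int k * T..a + of_int k * T + T}" for k :: int
  have Y_eq: "Y t = X (t - of_int k * T)" if "t \<in> K k" for t k
  proof (cases "t = a + of_int k * T + T")
    case True
    then have "n t = k + 1" using T by (intro n_eq) (auto simp: algebra_simps)
    then show ?thesis using True per by (simp add: Y_def r_def algebra_simps)
  next
    case False
    then have "n t = k" using that by (intro n_eq) (auto simp: K_def)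
    then show ?thesis by (simp add: Y_def r_def)
  qed
  have Y_der: "(Y has_vector_derivative Z (t - of_int k * T)) (at t within K k)" if "t \<in> K k" for t k
  proof -
    have im: "(\<lambda>t. t - of_int k * T) ` K k = {a..a + T}"
      unfolding K_def by (simp add: image_minus_const_atLeastAtMost' algebra_simps)
    have "((\<lambda>t. t - of_int k * T) has_vector_derivative 1) (at t within K k)"
      by (auto intro!: derivative_eq_intros)
    moreover have "(X has_vector_derivative Z (t - of_int k * T))
        (at (t - of_int k * T) within (\<lambda>t. t - of_int k * T) ` K k)"
      unfolding im using that by (intro X) (auto simp: K_def)
    ultimately have "((X \<circ> (\<lambda>t. t - of_int k * T)) has_vector_derivative (1::real) *\<^sub>R Z (t - of_int k * T)) (at t within K k)"
      by (rule vector_diff_chain_within)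
    then show ?thesis
      unfolding scaleR_one by (rule has_vector_derivative_transform[OF that, rotated]) (use Y_eq in auto)
  qed
  \<comment> \<open>Only the joints \<open>a + n T\<close> need care: there the derivatives from the
    two adjacent cells \<open>K (k - 1)\<close> and \<open>K k\<close> are both
    \<open>Z a\<close>.\<close>
  have "(Y has_vector_derivative W t) (at t)" for t
  proof (cases "t = a + of_int (n t) * T")
    case True
    define k where "k = n t"
    have t: "t = a + of_int k * T" using True k_def by simp
    have "(Y has_vector_derivative Z a) (at t within K k)"
      using Y_der[of t k] T by (simp add: t K_def)
    moreover have "(Y has_vector_derivative Z a) (at t within K (k - 1))"
      using Y_der[of t "k - 1"] T per by (simp add: t K_def algebra_simps)
    ultimately have "(Y has_vector_derivative Z a) (at t within K (k - 1) \<union> K k)"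
      by (rule has_vector_derivative_Un[rotated])
    moreover have "K (k - 1) \<union> K k = {t - T..t + T}"
      using T by (auto simp: K_def t algebra_simps)
    ultimately have "(Y has_vector_derivative Z a) (at t)"
      using T by (simp add: at_within_Icc_at)
    moreover have "W t = Z a"
      unfolding W_def r_def comp_def k_def[symmetric] by (simp add: t)
    ultimately show ?thesis by simp
  next
    case False
    then have "a + of_int (n t) * T < t" using n_bounds(1)[of t] by linarith
    then have "at t within K (n t) = at t"
      unfolding K_def using n_bounds(2)[of t] by (intro at_within_Icc_at)
    then show ?thesis
      using Y_der[of t "n t"] n_bounds[of t] by (simp add: K_def W_def r_def)
  qed
  moreover have "Y (t + T) = Y t" for t
  proof -
    have "n (t + T) = n t + 1" using n_bounds[of t] by (intro n_eq) (auto simp: algebra_simps)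
    then show ?thesis by (simp add: Y_def r_def algebra_simps)
  qed
  moreover have "\<exists>s\<in>{a..a + T}. \<exists>n::int. s = t - of_int n * T \<and> Y t = X s \<and> W t = Z s" for t
    using n_bounds[of t] by (intro bexI[of _ "r t"] exI[of _ "n t"]) (auto simp: Y_def W_def r_def)
  moreover have "Y t = X t" if "t \<in> {a..a + T}" for t
    using Y_eq[of t 0] that by (simp add: K_def)
  ultimately show thesis using that by blast
qed

text \<open>Injectivity bounds \<open>A s\<close> below by some \<open>B > 0\<close>, and
  \<open>A s (w s' - w s) = (A s - A s') (w s')\<close>; once \<open>A s - A s'\<close> is smaller
  than \<open>B / 2\<close>, half of the left-hand bound absorbs the unknown \<open>w s'\<close>. It
  serves to show that the velocity of the solution branch is continuous.\<close>

lemma continuous_on_blinfun_preimage: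
  fixes A :: "'c::topological_space \<Rightarrow> ('a::euclidean_space \<Rightarrow>\<^sub>L 'b::euclidean_space)"
  assumes A: "continuous_on S A" and inj: "\<And>s. s \<in> S \<Longrightarrow> inj (blinfun_apply (A s))"
    and w: "\<And>s. s \<in> S \<Longrightarrow> A s (w s) = v"
  shows "continuous_on S w"
  unfolding continuous_on_def
proof
  fix s assume s: "s \<in> S"
  obtain B where B: "0 < B" "\<And>u. B * norm u \<le> norm (A s u)"
    using linear_inj_bounded_below_pos[OF _ inj[OF s]] blinfun.bounded_linear_right bounded_linear.linear
    by blast
  have lim: "((\<lambda>s'. norm (A s - A s')) \<longlongrightarrow> 0) (at s within S)"
    using A s tendsto_diff[OF tendsto_const[of "A s"], of A "A s" "at s within S"]
    by (auto simp: continuous_on_def intro: tendsto_norm_zero)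
  have ev: "\<forall>\<^sub>F s' in at s within S. norm (w s' - w s) \<le> 2 / B * norm (w s) * norm (A s - A s')"
  proof -
    have "\<forall>\<^sub>F s' in at s within S. norm (A s - A s') < B / 2"
      using lim B(1) by (intro order_tendstoD) auto
    moreover have "\<forall>\<^sub>F s' in at s within S. s' \<in> S"
      by (auto simp: eventually_at_topological)
    ultimately show ?thesis
    proof eventually_elim
      case (elim s')
      let ?\<eta> = "norm (A s - A s')" and ?u = "norm (w s' - w s)"
      have "A s (w s' - w s) = (A s - A s') (w s')"
        using w[OF s] w[OF elim(2)] by (simp add: blinfun.diff_left blinfun.diff_right)
      then have "B * ?u \<le> ?\<eta> * norm (w s')"
        using B(2)[of "w s' - w s"] norm_blinfun[of "A s - A s'" "w s'"] by simp
      also have "\<dots> \<le> ?\<eta> * (?u + norm (w s))"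
        using norm_triangle_sub[of "w s'" "w s"] by (intro mult_left_mono) (auto simp: add.commute)
      also have "\<dots> \<le> B / 2 * ?u + ?\<eta> * norm (w s)"
        using mult_right_mono[OF less_imp_le[OF elim(1)], of ?u] by (simp add: distrib_left)
      finally show ?case using B(1) by (simp add: field_simps)
    qed
  qed
  have "((\<lambda>s'. 2 / B * norm (w s) * norm (A s - A s')) \<longlongrightarrow> 0) (at s within S)"
    by (rule tendsto_mult_right_zero[OF lim])
  then have "((\<lambda>s'. w s' - w s) \<longlongrightarrow> 0) (at s within S)"
    by (rule Lim_null_comparison[OF ev])
  then show "(w \<longlongrightarrow> w s) (at s within S)" by (rule LIM_zero_cancel)
qed

text \<open>The monodromy over one period has trace 2 and determinant 1, so nondegeneracy over one period
  passes to any multiple of it. Here this is phrased with the Wronskian of \<open>w\<close> and \<open>u\<close>: the difference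
  \<open>w (t + \<tau>) - w t\<close> has Wronskian zero with \<open>u\<close> and hence is a multiple of \<open>u\<close>.\<close>

lemma periodic_multiple_imp_periodic:
  fixes A u u' w w' :: "real \<Rightarrow> real"
  assumes A: "continuous_on UNIV A" and "0 < \<tau>" and "0 < q"
    and u: "\<And>t. (u has_real_derivative u' t) (at t)" "\<And>t. (u' has_real_derivative A t * u t) (at t)"
      "\<And>t. u (t + \<tau>) = u t" "\<And>t. u' (t + \<tau>) = u' t" and A_per: "\<And>t. A (t + \<tau>) = A t"
    and a: "u a \<noteq> 0"
    and w: "\<And>t. (w has_real_derivative w' t) (at t)" "\<And>t. (w' has_real_derivative A t * w t) (at t)"
    and w_per: "\<And>t. w (t + real q * \<tau>) = w t"
  shows "w (t + \<tau>) = w t"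
proof -
  define Wr where "Wr t = u t * w' t - u' t * w t" for t
  have "(Wr has_real_derivative 0) (at t)" for t
    unfolding Wr_def by (auto intro!: derivative_eq_intros u w simp: algebra_simps)
  then have Wr: "Wr s = Wr t" for s t
    using DERIV_isconst_all by blast
  define D where "D t = w (t + \<tau>) - w t" for t
  define D' where "D' t = w' (t + \<tau>) - w' t" for t
  have D: "(D has_real_derivative D' t) (at t)" "(D' has_real_derivative A t * D t) (at t)" for t
  proof -
    have "((\<lambda>t. w (t + \<tau>)) has_real_derivative w' (t + \<tau>)) (at t)"
      "((\<lambda>t. w' (t + \<tau>)) has_real_derivative A (t + \<tau>) * w (t + \<tau>)) (at t)"
      by (rule DERIV_shift[THEN iffD1, OF w(1)] DERIV_shift[THEN iffD1, OF w(2)])+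
    from DERIV_diff[OF this(1) w(1)] DERIV_diff[OF this(2) w(2)]
    show "(D has_real_derivative D' t) (at t)" "(D' has_real_derivative A t * D t) (at t)"
      by (simp_all add: D_def[abs_def] D'_def[abs_def] A_per right_diff_distrib)
  qed
  \<comment> \<open>The constant Wronskian is compared at \<open>t + \<tau>\<close> and
    \<open>t\<close>, where \<open>u\<close> and \<open>u'\<close> agree.\<close>
  have WD: "u t * D' t = u' t * D t" for t
    using Wr[of "t + \<tau>" t] u(3,4)[of t] by (simp add: Wr_def D_def D'_def algebra_simps)
  define k where "k = D a / u a"
  define E where "E t = D t - k * u t" for t
  define E' where "E' t = D' t - k * u' t" for t
  have E: "(E has_real_derivative E' t) (at t)" "(E' has_real_derivative A t * E t) (at t)" for t
    unfolding E_def E'_def by (auto intro!: derivative_eq_intros D u simp: algebra_simps)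
  have Ea: "E a = 0" "E' a = 0"
    using a WD[of a] by (simp_all add: E_def E'_def k_def field_simps)
  \<comment> \<open>\<open>E\<close> solves the linear equation with zero initial data at
    \<open>a\<close>, so Gronwall makes it vanish forwards in time.\<close>
  have E0: "E t = 0" if "a \<le> t" for t
  proof -
    have "compact (A ` {a..t})"
      by (intro compact_continuous_image continuous_on_subset[OF A]) auto
    then obtain B where B: "0 < B" "\<And>s. s \<in> {a..t} \<Longrightarrow> \<bar>A s\<bar> \<le> B"
      using compact_imp_bounded bounded_pos by (metis image_eqI real_norm_def)
    have "norm (E t, E' t) \<le> 2 * (norm (E a, E' a) + 0 * (t - a)) * exp (2 * (1 + B) * (t - a))"
    proof (rule gronwall_vector[where R' = "\<lambda>s. (E' s, A s * E s)"])
      fix s assume s: "s \<in> {a..t}"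
      show "((\<lambda>s. (E s, E' s)) has_vector_derivative (E' s, A s * E s)) (at s within {a..t})"
        using E[of s] by (intro has_vector_derivative_Pair)
          (auto simp: has_real_derivative_iff_has_vector_derivative intro: has_vector_derivative_at_within)
      have "norm (E' s, A s * E s) \<le> \<bar>E' s\<bar> + \<bar>A s * E s\<bar>"
        using norm_Pair_le[of "E' s" "A s * E s"] by simp
      also have "\<dots> \<le> 1 * norm (E s, E' s) + B * norm (E s, E' s)"
        unfolding abs_mult using B(2)[OF s] B(1) norm_fst_le[of "E s" "E' s"] norm_snd_le[of "E' s" "E s"]
        by (intro add_mono mult_mono) auto
      finally show "norm (E' s, A s * E s) \<le> (1 + B) * norm (E s, E' s) + 0" by (simp add: algebra_simps)
    qed (use B that in auto)
    then show ?thesis using Ea by (simp add: zero_prod_def)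
  qed
  have u_n: "u (a + real n * \<tau>) = u a" for n
  proof (induction n)
    case (Suc n)
    then show ?case using u(3)[of "a + real n * \<tau>"] by (simp add: algebra_simps)
  qed simp
  \<comment> \<open>A Jordan block would show as linear growth along the multiples of \<tau>;
    returning to \<open>w a\<close> at \<open>n = q\<close> forces \<open>k = 0\<close>.\<close>
  have w_n: "w (a + real n * \<tau>) = w a + real n * (k * u a)" for n
  proof (induction n)
    case (Suc n)
    have "E (a + real n * \<tau>) = 0" using \<open>0 < \<tau>\<close> by (intro E0) simp
    then have "D (a + real n * \<tau>) = k * u a" by (simp add: E_def u_n)
    then show ?case using Suc by (simp add: D_def algebra_simps)
  qed simp
  have "k = 0" using w_n[of q] w_per[of a] a \<open>0 < q\<close> by simp
  then have D0: "D s = 0" if "a \<le> s" for s using E0[OF that] by (simp add: E_def)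
  have w_per_n: "w (t + real n * (real q * \<tau>)) = w t" for n t
  proof (induction n)
    case (Suc n)
    then show ?case using w_per[of "t + real n * (real q * \<tau>)"] by (simp add: algebra_simps)
  qed simp
  \<comment> \<open>Times before \<open>a\<close> are moved past \<open>a\<close> by whole multiples
    of the known period \<open>q \<tau>\<close>.\<close>
  obtain n :: nat where n: "a - t \<le> real n * (real q * \<tau>)"
    using real_arch_simple[of "(a - t) / (real q * \<tau>)"] \<open>0 < \<tau>\<close> \<open>0 < q\<close> by (auto simp: field_simps)
  then have "D (t + real n * (real q * \<tau>)) = 0" by (intro D0) simp
  then show ?thesis
    using w_per_n[of t n] w_per_n[of "t + \<tau>" n] by (simp add: D_def algebra_simps)
qed

subsection \<open>The extended system and its linearisation\<close>

text \<open>The primitive of the square increases strictly just after \<open>a\<close> and never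
  decreases. For \<open>g = x'\<close> this makes the phase condition detect the kernel of the
  variational equation.\<close>

lemma integral_square_pos:
  fixes g :: "real \<Rightarrow> real"
  assumes g: "continuous_on UNIV g" and "a < b" and "g a \<noteq> 0"
  shows "0 < primitive (\<lambda>t. (g t)\<^sup>2) b - primitive (\<lambda>t. (g t)\<^sup>2) a"
proof -
  let ?S = "primitive (\<lambda>t. (g t)\<^sup>2)"
  have S: "(?S has_real_derivative (g t)\<^sup>2) (at t)" for t
    by (intro primitive_has_derivative continuous_intros g)
  obtain e where e: "0 < e" "\<And>s. 0 < s \<Longrightarrow> s < e \<Longrightarrow> ?S a < ?S (a + s)"
    using DERIV_pos_inc_right[OF S[of a]] \<open>g a \<noteq> 0\<close> by auto
  define s where "s = min (e / 2) (b - a)"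
  have s: "0 < s" "s < e" "a + s \<le> b" using e \<open>a < b\<close> by (auto simp: s_def min_def)
  have "?S (a + s) \<le> ?S b"
    by (rule DERIV_nonneg_imp_nondecreasing[OF s(3)]) (use S in \<open>meson zero_le_power2\<close>)
  then show ?thesis using e(2)[OF s(1,2)] by linarith
qed

type_synonym state = "real \<times> real \<times> real \<times> real \<times> real \<times> real \<times> real"

abbreviation p1 :: "'a \<times> 'b \<Rightarrow> 'a" where "p1 X \<equiv> fst X"
abbreviation p2 :: "'a \<times> 'b \<times> 'c \<Rightarrow> 'b" where "p2 X \<equiv> fst (snd X)"
abbreviation p3 :: "'a \<times> 'b \<times> 'c \<times> 'd \<Rightarrow> 'c" where "p3 X \<equiv> fst (snd (snd X))"
abbreviation p4 :: "'a \<times> 'b \<times> 'c \<times> 'd \<times> 'e \<Rightarrow> 'd" where "p4 X \<equiv> fst (snd (snd (snd X)))"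
abbreviation p5 :: "'a \<times> 'b \<times> 'c \<times> 'd \<times> 'e \<times> 'f \<Rightarrow> 'e" where "p5 X \<equiv> fst (snd (snd (snd (snd X))))"
abbreviation p6 :: "'a \<times> 'b \<times> 'c \<times> 'd \<times> 'e \<times> 'f \<times> 'g \<Rightarrow> 'f" where "p6 X \<equiv> fst (snd (snd (snd (snd (snd X)))))"
abbreviation p7 :: "'a \<times> 'b \<times> 'c \<times> 'd \<times> 'e \<times> 'f \<times> 'g \<Rightarrow> 'g" where "p7 X \<equiv> snd (snd (snd (snd (snd (snd X)))))"

lemma has_vector_derivative_fst:
  "(X has_vector_derivative D) F \<Longrightarrow> ((\<lambda>t. fst (X t)) has_vector_derivative fst D) F"
  by (rule bounded_linear.has_vector_derivative[OF bounded_linear_fst])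

lemma has_vector_derivative_snd:
  "(X has_vector_derivative D) F \<Longrightarrow> ((\<lambda>t. snd (X t)) has_vector_derivative snd D) F"
  by (rule bounded_linear.has_vector_derivative[OF bounded_linear_snd])

lemmas has_vector_derivative_projections =
  has_vector_derivative_fst
  has_vector_derivative_fst[OF has_vector_derivative_snd]
  has_vector_derivative_fst[OF has_vector_derivative_snd[OF has_vector_derivative_snd]]
  has_vector_derivative_fst[OF has_vector_derivative_snd[OF has_vector_derivative_snd[OF has_vector_derivative_snd]]]
  has_vector_derivative_fst[OF has_vector_derivative_snd[OF has_vector_derivative_snd[OF has_vector_derivative_snd[OF has_vector_derivative_snd]]]]
  has_vector_derivative_fst[OF has_vector_derivative_snd[OF has_vector_derivative_snd[OF has_vector_derivative_snd[OF has_vector_derivative_snd[OF has_vector_derivative_snd]]]]]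
  has_vector_derivative_snd[OF has_vector_derivative_snd[OF has_vector_derivative_snd[OF has_vector_derivative_snd[OF has_vector_derivative_snd[OF has_vector_derivative_snd]]]]]

lemma zero_derivative_constant:
  fixes g :: "real \<Rightarrow> real"
  assumes "\<And>t. t \<in> {a..b} \<Longrightarrow> (g has_real_derivative 0) (at t within {a..b})" "t \<in> {a..b}" "s \<in> {a..b}"
  shows "g t = g s"
  using has_field_derivative_zero_constant[of "{a..b}" g] assms by (metis convex_real_interval(5))

text \<open>\<open>T\<close> is the resonant period, and nondegeneracy is assumed over
  \<open>T\<close> itself. The Melnikov integral is written after the shift by \<alpha>, over the
  period starting at the point \<open>a\<close> with \<open>x' a \<noteq> 0\<close>;
  \<open>z0\<close> is the value of the inverse of \<open>primitive h\<close> at the shifted energy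
  of the orbit.\<close>

locale melnikov_setting =
  fixes f f' h h' \<gamma> \<gamma>' x x' :: "real \<Rightarrow> real" and T a d \<alpha>0 z0 \<kappa> :: real
  assumes f: "\<And>u. (f has_real_derivative f' u) (at u)" and f': "continuous_on UNIV f'"
    and h: "\<And>u. (h has_real_derivative h' u) (at u)" and h': "continuous_on UNIV h'"
    and \<gamma>: "\<And>u. (\<gamma> has_real_derivative \<gamma>' u) (at u)" and \<gamma>': "continuous_on UNIV \<gamma>'"
    and T: "0 < T" and \<gamma>_per: "\<And>t. \<gamma> (t + T) = \<gamma> t"
    and x: "\<And>t. (x has_real_derivative x' t) (at t)" and x': "\<And>t. (x' has_real_derivative f (x t)) (at t)"
    and x_per: "\<And>t. x (t + T) = x t" "\<And>t. x' (t + T) = x' t"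
    and x'_a: "x' a \<noteq> 0"
    and nondeg: "\<And>w w'. (\<And>t. (w has_real_derivative w' t) (at t)) \<Longrightarrow>
        (\<And>t. (w' has_real_derivative f' (x t) * w t) (at t)) \<Longrightarrow> (\<And>t. w (t + T) = w t) \<Longrightarrow>
        \<exists>k. \<forall>t. w t = k * x' t"
    and energy_x: "\<And>t. (x' t)\<^sup>2 / 2 - primitive f (x t) - d = primitive h z0" and h_z0: "h z0 \<noteq> 0"
    and mel0: "(LBINT t=a..a+T. \<gamma> (t - \<alpha>0) * x' t) = 0"
    and mel': "((\<lambda>\<alpha>. LBINT t=a..a+T. \<gamma> (t - \<alpha>) * x' t) has_real_derivative \<kappa>) (at \<alpha>0)" and \<kappa>: "\<kappa> \<noteq> 0"
begin

lemma conts: "continuous_on A f" "continuous_on A h" "continuous_on A \<gamma>" "continuous_on A x" "continuous_on A x'"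
  by (intro continuous_at_imp_continuous_on ballI; rule DERIV_isCont, rule f h \<gamma> x x')+

lemmas cont_comps = conts[THEN continuous_on_compose2, OF _ subset_UNIV]
  f'[THEN continuous_on_compose2, OF _ subset_UNIV] h'[THEN continuous_on_compose2, OF _ subset_UNIV]
  \<gamma>'[THEN continuous_on_compose2, OF _ subset_UNIV]

abbreviation "b \<equiv> a + T"

text \<open>The state is \<open>(y, v, m, c, \<alpha>, \<epsilon>, z)\<close>, where \<open>y (t) = \<psi> (t - \<alpha>)\<close> and \<open>v = y'\<close>. The variable
  \<open>z\<close> is the initial value of \<open>H\<^sup>-\<^sup>1 (v\<^sup>2 / 2 - F y - d)\<close>, whose value at time \<open>t\<close> is \<open>z + \<epsilon> m\<close>, and \<open>c\<close>
  accumulates the phase condition.\<close>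

definition field :: "real \<Rightarrow> state \<Rightarrow> state" where
  "field t X = (p2 X, f (p1 X) + p6 X * (\<gamma> (t - p5 X) * h (p7 X + p6 X * p3 X)),
     \<gamma> (t - p5 X) * p2 X, (p1 X - x t) * x' t, 0, 0, 0)"

definition dfield :: "real \<Rightarrow> state \<Rightarrow> state \<Rightarrow> state" where
  "dfield t X \<eta> = (p2 \<eta>,
     f' (p1 X) * p1 \<eta> + (p6 \<eta> * (\<gamma> (t - p5 X) * h (p7 X + p6 X * p3 X)) +
       p6 X * (- \<gamma>' (t - p5 X) * p5 \<eta> * h (p7 X + p6 X * p3 X) +
         \<gamma> (t - p5 X) * (h' (p7 X + p6 X * p3 X) * (p7 \<eta> + p6 \<eta> * p3 X + p6 X * p3 \<eta>)))),
     - \<gamma>' (t - p5 X) * p5 \<eta> * p2 X + \<gamma> (t - p5 X) * p2 \<eta>, p1 \<eta> * x' t, 0, 0, 0)"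

lemma field_has_derivative: "(field t has_derivative dfield t X) (at X)"
  unfolding field_def[abs_def] dfield_def[abs_def]
  apply (rule has_derivative_eq_rhs)
   apply (rule derivative_intros DERIV_compose_FDERIV[OF f] DERIV_compose_FDERIV[OF h] DERIV_compose_FDERIV[OF \<gamma>])+
  apply (simp add: fun_eq_iff zero_prod_def algebra_simps)
  done

lemma continuous_field: "continuous_on A (\<lambda>(t, X). field t X)"
  unfolding field_def case_prod_beta by (intro continuous_intros cont_comps)

definition Dfield :: "real \<Rightarrow> state \<Rightarrow> (state \<Rightarrow>\<^sub>L state)" where "Dfield t X = Blinfun (dfield t X)"

lemma Dfield: "blinfun_apply (Dfield t X) = dfield t X"
  unfolding Dfield_def using has_derivative_bounded_linear[OF field_has_derivative]
  by (rule bounded_linear_Blinfun_apply)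

lemma continuous_Dfield: "continuous_on A (\<lambda>(t, X). Dfield t X)"
proof (rule continuous_on_blinfun_componentwise)
  fix i :: state
  show "continuous_on A (\<lambda>p. blinfun_apply (case p of (t, X) \<Rightarrow> Dfield t X) i)"
    unfolding case_prod_beta Dfield dfield_def by (intro continuous_intros cont_comps)
qed

sublocale c1_field field Dfield a b
  using T field_has_derivative by unfold_locales (auto simp: Dfield continuous_field continuous_Dfield)

lemma solves_fieldD:
  assumes X: "solves_on field a b X" and t: "t \<in> {a..b}"
  shows "((\<lambda>t. p1 (X t)) has_real_derivative p2 (X t)) (at t within {a..b})"
    "((\<lambda>t. p2 (X t)) has_real_derivative
       f (p1 (X t)) + p6 (X a) * (\<gamma> (t - p5 (X a)) * h (p7 (X a) + p6 (X a) * p3 (X t)))) (at t within {a..b})"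
    "((\<lambda>t. p3 (X t)) has_real_derivative \<gamma> (t - p5 (X a)) * p2 (X t)) (at t within {a..b})"
    "((\<lambda>t. p4 (X t)) has_real_derivative (p1 (X t) - x t) * x' t) (at t within {a..b})"
    "p5 (X t) = p5 (X a)" "p6 (X t) = p6 (X a)" "p7 (X t) = p7 (X a)"
proof -
  note D = has_vector_derivative_projections[OF solves_onD[OF X], unfolded field_def fst_conv snd_conv,
      folded has_real_derivative_iff_has_vector_derivative]
  show c: "p5 (X t) = p5 (X a)" "p6 (X t) = p6 (X a)" "p7 (X t) = p7 (X a)"
    using D(5-7) T t by (auto intro: zero_derivative_constant[where a = a and b = b])
  show "((\<lambda>t. p1 (X t)) has_real_derivative p2 (X t)) (at t within {a..b})"
    "((\<lambda>t. p2 (X t)) has_real_derivative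
       f (p1 (X t)) + p6 (X a) * (\<gamma> (t - p5 (X a)) * h (p7 (X a) + p6 (X a) * p3 (X t)))) (at t within {a..b})"
    "((\<lambda>t. p3 (X t)) has_real_derivative \<gamma> (t - p5 (X a)) * p2 (X t)) (at t within {a..b})"
    "((\<lambda>t. p4 (X t)) has_real_derivative (p1 (X t) - x t) * x' t) (at t within {a..b})"
    using D(1-4)[OF t] unfolding c .
qed

lemma solves_fieldI:
  assumes "\<And>t. t \<in> {a..b} \<Longrightarrow> (y has_real_derivative v t) (at t within {a..b})"
    "\<And>t. t \<in> {a..b} \<Longrightarrow> (v has_real_derivative f (y t) + \<epsilon> * (\<gamma> (t - \<alpha>) * h (z + \<epsilon> * m t))) (at t within {a..b})"
    "\<And>t. t \<in> {a..b} \<Longrightarrow> (m has_real_derivative \<gamma> (t - \<alpha>) * v t) (at t within {a..b})"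
    "\<And>t. t \<in> {a..b} \<Longrightarrow> (c has_real_derivative (y t - x t) * x' t) (at t within {a..b})"
  shows "solves_on field a b (\<lambda>t. (y t, v t, m t, c t, \<alpha>, \<epsilon>, z))"
  unfolding solves_on_def field_def using assms
  by (auto intro!: has_vector_derivative_Pair simp: has_real_derivative_iff_has_vector_derivative)

text \<open>At \<epsilon> = 0 the extended system is solved explicitly for every phase:
  \<open>y = x\<close>, no phase defect accumulates, \<open>z\<close> is frozen, and
  \<open>m\<close> is the running Melnikov integral, whose value at \<open>b\<close> is the Melnikov
  function of \<alpha>.\<close>

definition orbit :: "real \<Rightarrow> real \<Rightarrow> state" where
  "orbit \<alpha> t = (x t, x' t, primitive (\<lambda>s. \<gamma> (s - \<alpha>) * x' s) t - primitive (\<lambda>s. \<gamma> (s - \<alpha>) * x' s) a, 0, \<alpha>, 0, z0)"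

lemma orbit_a: "orbit \<alpha> a = (x a, x' a, 0, 0, \<alpha>, 0, z0)"
  by (simp add: orbit_def)

lemma solves_orbit: "solves_on field a b (orbit \<alpha>)"
  unfolding orbit_def
proof (rule solves_fieldI)
  fix t
  have "(primitive (\<lambda>s. \<gamma> (s - \<alpha>) * x' s) has_real_derivative \<gamma> (t - \<alpha>) * x' t) (at t within {a..b})"
    by (intro DERIV_subset[OF primitive_has_derivative] continuous_intros cont_comps) auto
  then show "((\<lambda>t. primitive (\<lambda>s. \<gamma> (s - \<alpha>) * x' s) t - primitive (\<lambda>s. \<gamma> (s - \<alpha>) * x' s) a)
      has_real_derivative \<gamma> (t - \<alpha>) * x' t) (at t within {a..b})"
    by (auto intro!: derivative_eq_intros)
qed (auto intro: DERIV_subset[OF x] DERIV_subset[OF x'])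

lemma orbit_b: "orbit \<alpha> b = (x a, x' a, LBINT t=a..b. \<gamma> (t - \<alpha>) * x' t, 0, \<alpha>, 0, z0)"
proof -
  have "(LBINT t=ereal a..ereal b. \<gamma> (t - \<alpha>) * x' t)
     = primitive (\<lambda>s. \<gamma> (s - \<alpha>) * x' s) b - primitive (\<lambda>s. \<gamma> (s - \<alpha>) * x' s) a"
    using T by (intro LBINT_primitive continuous_intros cont_comps) auto
  then show ?thesis by (simp add: orbit_def x_per)
qed

end

subsection \<open>The bifurcation equations\<close>

type_synonym data = "real \<times> real \<times> real \<times> real \<times> real"

lemma periodic_minus_int:
  fixes g :: "real \<Rightarrow> 'a"
  assumes "\<And>t. g (t + T) = g t"
  shows "g (t - of_int n * T) = g t"
proof -
  interpret periodic_fun_simple g T by unfold_locales (rule assms)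
  show ?thesis by (rule minus_of_int)
qed

text \<open>The added assumptions are the conclusions of \<open>flow_C1\<close> around
  \<open>orbit \<alpha>0\<close>; fixing the flow as a parameter keeps one choice of it throughout
  the bifurcation argument.\<close>

locale melnikov_flow = melnikov_setting +
  fixes r C :: real and \<Phi> :: "state \<Rightarrow> real \<Rightarrow> state" and \<Phi>' :: "state \<Rightarrow> (state \<Rightarrow>\<^sub>L state)"
  assumes r: "0 < r" and C: "0 < C"
    and \<Phi>_a: "\<And>\<xi>. \<xi> \<in> ball (orbit \<alpha>0 a) r \<Longrightarrow> \<Phi> \<xi> a = \<xi>"
    and \<Phi>_solves: "\<And>\<xi>. \<xi> \<in> ball (orbit \<alpha>0 a) r \<Longrightarrow> solves_on field a b (\<Phi> \<xi>)"
    and \<Phi>_close: "\<And>\<xi> t. \<xi> \<in> ball (orbit \<alpha>0 a) r \<Longrightarrow> t \<in> {a..b} \<Longrightarrow>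
      dist (\<Phi> \<xi> t) (orbit \<alpha>0 t) \<le> C * dist \<xi> (orbit \<alpha>0 a)"
    and \<Phi>_deriv: "\<And>\<xi>. \<xi> \<in> ball (orbit \<alpha>0 a) r \<Longrightarrow> ((\<lambda>\<xi>. \<Phi> \<xi> b) has_derivative \<Phi>' \<xi>) (at \<xi>)"
    and \<Phi>'_cont: "continuous_on (ball (orbit \<alpha>0 a) r) \<Phi>'"
    and \<Phi>'_linearised: "\<And>\<xi> \<eta>. \<xi> \<in> ball (orbit \<alpha>0 a) r \<Longrightarrow>
       \<exists>w. w a = \<eta> \<and> solves_on (\<lambda>t. blinfun_apply (Dfield t (\<Phi> \<xi> t))) a b w \<and> w b = \<Phi>' \<xi> \<eta>"
begin

text \<open>Data are tuples \<open>(y, v, \<alpha>, z, \<epsilon>)\<close> at time \<open>a\<close>. The residual does not contain \<open>v b - v a\<close>: by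
  conservation of \<open>v\<^sup>2 / 2 - F y - H z\<close>, the other components give \<open>(v b)\<^sup>2 = (v a)\<^sup>2\<close>, and \<open>x' a \<noteq> 0\<close>
  fixes the sign. Nor is the period condition for \<open>z\<close> divided by \<open>\<epsilon>\<close>: it reads \<open>m b = 0\<close>.\<close>

definition init :: "data \<Rightarrow> state" where
  "init \<xi> = (p1 \<xi>, p2 \<xi>, 0, 0, p3 \<xi>, snd (snd (snd (snd \<xi>))), p4 \<xi>)"

abbreviation eps :: "data \<Rightarrow> real" where "eps \<xi> \<equiv> snd (snd (snd (snd \<xi>)))"

definition \<xi>0 :: data where "\<xi>0 = (x a, x' a, \<alpha>0, z0, 0)"

definition dom :: "data set" where "dom = {\<xi>. init \<xi> \<in> ball (orbit \<alpha>0 a) r}"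

definition residual :: "data \<Rightarrow> data" where
  "residual \<xi> = (p1 (\<Phi> (init \<xi>) b) - p1 \<xi>, p4 (\<Phi> (init \<xi>) b), p3 (\<Phi> (init \<xi>) b),
     (p2 \<xi>)\<^sup>2 / 2 - primitive f (p1 \<xi>) - d - primitive h (p4 \<xi>), eps \<xi>)"

definition dresidual :: "data \<Rightarrow> data \<Rightarrow> data" where
  "dresidual \<xi> \<eta> = (p1 (\<Phi>' (init \<xi>) (init \<eta>)) - p1 \<eta>, p4 (\<Phi>' (init \<xi>) (init \<eta>)), p3 (\<Phi>' (init \<xi>) (init \<eta>)),
     p2 \<xi> * p2 \<eta> - f (p1 \<xi>) * p1 \<eta> - h (p4 \<xi>) * p4 \<eta>, eps \<eta>)"

definition Dresidual :: "data \<Rightarrow> (data \<Rightarrow>\<^sub>L data)" where "Dresidual \<xi> = Blinfun (dresidual \<xi>)"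

lemma init_\<xi>0: "init \<xi>0 = orbit \<alpha>0 a"
  by (simp add: init_def \<xi>0_def orbit_a)

lemma init_has_derivative: "(init has_derivative init) (at \<xi> within A)"
  unfolding init_def[abs_def]
  by (rule has_derivative_eq_rhs, (rule derivative_intros)+) (simp add: fun_eq_iff zero_prod_def)

lemma continuous_init: "continuous_on A init"
  unfolding init_def[abs_def] by (intro continuous_intros)

lemma open_dom: "open dom"
proof -
  have "dom = init -` ball (orbit \<alpha>0 a) r" by (auto simp: dom_def)
  then show ?thesis using open_vimage[OF _ continuous_init] by simp
qed

lemma \<xi>0_dom: "\<xi>0 \<in> dom"
  using r by (simp add: dom_def init_\<xi>0)

lemma init_in_ball: "\<xi> \<in> dom \<Longrightarrow> init \<xi> \<in> ball (orbit \<alpha>0 a) r"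
  by (simp add: dom_def)

lemma residual_has_derivative:
  assumes "\<xi> \<in> dom"
  shows "(residual has_derivative dresidual \<xi>) (at \<xi>)"
proof -
  have F: "(primitive f has_real_derivative f u) (at u)" and H: "(primitive h has_real_derivative h u) (at u)" for u
    by (intro primitive_has_derivative conts)+
  have \<Phi>b: "((\<lambda>\<xi>. \<Phi> (init \<xi>) b) has_derivative (\<lambda>\<eta>. \<Phi>' (init \<xi>) (init \<eta>))) (at \<xi>)"
    by (rule has_derivative_compose[OF init_has_derivative \<Phi>_deriv[OF init_in_ball[OF assms]]])
  have Fc: "((\<lambda>\<xi>. primitive f (p1 \<xi>)) has_derivative (\<lambda>\<eta>. p1 \<eta> * f (p1 \<xi>))) (at \<xi>)"
    and Hc: "((\<lambda>\<xi>. primitive h (p4 \<xi>)) has_derivative (\<lambda>\<eta>. p4 \<eta> * h (p4 \<xi>))) (at \<xi>)" for \<xi> :: data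
    by (rule DERIV_compose_FDERIV[OF F] DERIV_compose_FDERIV[OF H], intro derivative_intros)+
  show ?thesis
    unfolding residual_def[abs_def] dresidual_def[abs_def]
    apply (rule has_derivative_eq_rhs)
     apply (rule derivative_intros \<Phi>b Fc Hc | simp)+
    apply (simp add: fun_eq_iff algebra_simps)
    done
qed

lemma Dresidual: "\<xi> \<in> dom \<Longrightarrow> blinfun_apply (Dresidual \<xi>) = dresidual \<xi>"
  unfolding Dresidual_def using has_derivative_bounded_linear[OF residual_has_derivative]
  by (rule bounded_linear_Blinfun_apply)

lemma continuous_Dresidual: "continuous_on dom Dresidual"
proof (rule continuous_on_blinfun_componentwise)
  fix i :: data
  have "continuous_on dom (\<lambda>\<xi>. \<Phi>' (init \<xi>))"
    by (rule continuous_on_compose2[OF \<Phi>'_cont continuous_init]) (auto simp: dom_def)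
  then have "continuous_on dom (\<lambda>\<xi>. dresidual \<xi> i)"
    unfolding dresidual_def by (intro continuous_intros cont_comps)
  then show "continuous_on dom (\<lambda>\<xi>. blinfun_apply (Dresidual \<xi>) i)"
    using Dresidual by (metis (mono_tags, lifting) continuous_on_cong)
qed

lemma \<Phi>_unique:
  assumes "\<xi> \<in> dom" "solves_on field a b X" "X a = init \<xi>" "t \<in> {a..b}"
  shows "\<Phi> (init \<xi>) t = X t"
  using solves_on_unique[OF \<Phi>_solves assms(2) _ assms(4)] \<Phi>_a init_in_ball[OF assms(1)] assms(3) by simp

lemma residual_\<xi>0: "residual \<xi>0 = 0"
proof -
  have "\<Phi> (init \<xi>0) b = orbit \<alpha>0 b"
    using T by (intro \<Phi>_unique \<xi>0_dom solves_orbit) (auto simp: init_\<xi>0)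
  then show ?thesis
    using mel0 energy_x[of a] by (simp add: residual_def orbit_b \<xi>0_def zero_prod_def)
qed

text \<open>The derivative in direction \<open>\<alpha>\<close> is the derivative of the Melnikov function, since for \<open>\<epsilon> = 0\<close>
  the orbit is known explicitly for every \<open>\<alpha>\<close>.\<close>

lemma dresidual_alpha: "p3 (\<Phi>' (init \<xi>0) (init (0, 0, 1, 0, 0))) = \<kappa>"
proof -
  define q :: "real \<Rightarrow> data" where "q \<alpha> = (x a, x' a, \<alpha>, z0, 0)" for \<alpha>
  have q0: "q \<alpha>0 = \<xi>0" by (simp add: q_def \<xi>0_def)
  have "continuous_on UNIV q" unfolding q_def[abs_def] by (intro continuous_intros)
  then have "open (q -` dom)" using open_dom by (simp add: open_vimage)
  moreover have "\<alpha>0 \<in> q -` dom" using q0 \<xi>0_dom by simp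
  moreover have "(LBINT t=a..b. \<gamma> (t - \<alpha>) * x' t) = p3 (\<Phi> (init (q \<alpha>)) b)" if "\<alpha> \<in> q -` dom" for \<alpha>
  proof -
    have "\<Phi> (init (q \<alpha>)) b = orbit \<alpha> b"
      using T that by (intro \<Phi>_unique solves_orbit) (auto simp: orbit_a init_def q_def)
    then show ?thesis by (simp add: orbit_b)
  qed
  ultimately have "((\<lambda>\<alpha>. p3 (\<Phi> (init (q \<alpha>)) b)) has_real_derivative \<kappa>) (at \<alpha>0)"
    by (rule has_field_derivative_transform_within_open[OF mel'])
  then have 1: "((\<lambda>\<alpha>. p3 (\<Phi> (init (q \<alpha>)) b)) has_derivative (\<lambda>s. \<kappa> * s)) (at \<alpha>0)"
    by (simp add: has_field_derivative_def)
  have q: "(q has_derivative (\<lambda>s. (0, 0, s, 0, 0))) (at \<alpha>0)"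
    unfolding q_def[abs_def]
    by (rule has_derivative_eq_rhs, (rule derivative_intros)+) (simp add: fun_eq_iff zero_prod_def)
  have "((\<lambda>\<alpha>. \<Phi> (init (q \<alpha>)) b) has_derivative (\<lambda>s. \<Phi>' (init (q \<alpha>0)) (init (0, 0, s, 0, 0)))) (at \<alpha>0)"
    by (rule has_derivative_compose[OF has_derivative_compose[OF q init_has_derivative] \<Phi>_deriv])
      (use init_in_ball[OF \<xi>0_dom] q0 in simp)
  then have "((\<lambda>\<alpha>. p3 (\<Phi> (init (q \<alpha>)) b)) has_derivative (\<lambda>s. p3 (\<Phi>' (init \<xi>0) (init (0, 0, s, 0, 0))))) (at \<alpha>0)"
    unfolding q0 by (intro derivative_intros)
  from has_derivative_unique[OF 1 this] show ?thesis
    by (metis mult.right_neutral)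
qed

text \<open>The component \<epsilon> of a kernel vector is zero, so the forcing leaves the
  linearised equation for \<open>(y, v)\<close> and the variational equation along \<open>x\<close>
  remains. Its solution turns out periodic, hence equal to \<open>k x'\<close>; the phase component
  gives \<open>k = 0\<close>, the energy component with \<open>h z0 \<noteq> 0\<close> removes the
  variation of \<open>z\<close>, and what is left is a multiple of the \<alpha> direction, excluded
  by \<kappa> \<noteq> 0.\<close>

lemma dresidual_injective:
  assumes zero: "dresidual \<xi>0 \<eta> = 0"
  shows "\<eta> = 0"
proof -
  obtain w where w_a: "w a = init \<eta>" and w_b: "w b = \<Phi>' (init \<xi>0) (init \<eta>)"
    and w_sol: "solves_on (\<lambda>t. blinfun_apply (Dfield t (\<Phi> (init \<xi>0) t))) a b w"
    using \<Phi>'_linearised[OF init_in_ball[OF \<xi>0_dom]] by blast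
  have orb: "\<Phi> (init \<xi>0) t = orbit \<alpha>0 t" if "t \<in> {a..b}" for t
    using that by (intro \<Phi>_unique \<xi>0_dom solves_orbit) (auto simp: init_\<xi>0)
  have eps0: "eps \<eta> = 0" using zero by (simp add: dresidual_def zero_prod_def)
  have w_a': "p1 (w a) = p1 \<eta>" "p2 (w a) = p2 \<eta>" "p3 (w a) = 0" "p4 (w a) = 0" "p5 (w a) = p3 \<eta>" "p6 (w a) = 0" "p7 (w a) = p4 \<eta>"
    using eps0 by (simp_all add: w_a init_def)
  have w_b': "p1 (w b) = p1 \<eta>" "p3 (w b) = 0" "p4 (w b) = 0"
    using zero by (simp_all add: w_b dresidual_def zero_prod_def)
  have D: "(w has_vector_derivative dfield t (orbit \<alpha>0 t) (w t)) (at t within {a..b})" if "t \<in> {a..b}" for t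
    using solves_onD[OF w_sol that] by (simp add: Dfield orb[OF that])
  note D' = has_vector_derivative_projections[OF D, unfolded dfield_def orbit_def fst_conv snd_conv,
      folded has_real_derivative_iff_has_vector_derivative]
  have w6: "p6 (w t) = 0" if "t \<in> {a..b}" for t
    using zero_derivative_constant[OF D'(6) that, of a] T w_a' by simp
  define Y where "Y t = p1 (w t)" for t
  define U where "U t = p2 (w t)" for t
  have Y: "(Y has_real_derivative U t) (at t within {a..b})" if "t \<in> {a..b}" for t
    using D'(1)[OF that] by (simp add: Y_def[abs_def] U_def[abs_def])
  have U: "(U has_real_derivative f' (x t) * Y t) (at t within {a..b})" if "t \<in> {a..b}" for t
    using D'(2)[OF that] by (simp add: Y_def[abs_def] U_def[abs_def] w6[OF that])
  have xw: "(x has_real_derivative x' t) (at t within A)" "(x' has_real_derivative f (x t)) (at t within A)"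
    "((\<lambda>t. f (x t)) has_real_derivative f' (x t) * x' t) (at t within A)" for t A
    using x x' DERIV_chain2[OF f x] by (auto intro: DERIV_subset)
  \<comment> \<open>The Wronskian of the variation with \<open>x'\<close> replaces the absent
    equation for \<open>v\<close>: since \<open>Y b = Y a\<close> and
    \<open>x' a \<noteq> 0\<close>, it yields \<open>U b = U a\<close>.\<close>
  have "x' b * U b - f (x b) * Y b = x' a * U a - f (x a) * Y a"
  proof (rule zero_derivative_constant[of a b "\<lambda>t. x' t * U t - f (x t) * Y t"])
    fix t assume t: "t \<in> {a..b}"
    show "((\<lambda>t. x' t * U t - f (x t) * Y t) has_real_derivative 0) (at t within {a..b})"
      by (rule derivative_eq_intros xw Y[OF t] U[OF t] refl)+ (simp add: algebra_simps)
  qed (use T in auto)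
  moreover have Yb: "Y b = Y a" using w_b' w_a' by (simp add: Y_def)
  ultimately have Ub: "U b = U a" using x'_a by (simp add: x_per)
  obtain Z W where ZW: "\<And>t. (Z has_vector_derivative W t) (at t)" "\<And>t. Z (t + T) = Z t"
    and ZW': "\<And>t. \<exists>s\<in>{a..b}. \<exists>n::int. s = t - of_int n * T \<and> Z t = (Y s, U s) \<and> W t = (U s, f' (x s) * Y s)"
    and Z: "\<And>t. t \<in> {a..b} \<Longrightarrow> Z t = (Y t, U t)"
  proof (rule periodic_extension[OF T, of a "\<lambda>t. (Y t, U t)" "\<lambda>t. (U t, f' (x t) * Y t)"])
    show "((\<lambda>t. (Y t, U t)) has_vector_derivative (U t, f' (x t) * Y t)) (at t within {a..b})" if "t \<in> {a..b}" for t
      using Y[OF that] U[OF that]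
      by (simp add: has_vector_derivative_Pair has_real_derivative_iff_has_vector_derivative)
  qed (use Yb Ub in \<open>auto simp: x_per\<close>)
  have x_int: "x (t - of_int n * T) = x t" for t and n :: int
    by (rule periodic_minus_int) (rule x_per)
  have W: "W t = (snd (Z t), f' (x t) * fst (Z t))" for t
    using ZW'[of t] x_int by auto
  have Z1: "((\<lambda>t. fst (Z t)) has_real_derivative snd (Z t)) (at t)" for t
    using has_vector_derivative_fst[OF ZW(1), of t] by (simp add: has_real_derivative_iff_has_vector_derivative W)
  have Z2: "((\<lambda>t. snd (Z t)) has_real_derivative f' (x t) * fst (Z t)) (at t)" for t
    using has_vector_derivative_snd[OF ZW(1), of t] by (simp add: has_real_derivative_iff_has_vector_derivative W)
  obtain k where k: "\<And>t. fst (Z t) = k * x' t"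
    using nondeg[OF Z1 Z2] ZW(2) by auto
  let ?S = "primitive (\<lambda>t. (x' t)\<^sup>2)"
  \<comment> \<open>The linearised phase variable accumulates \<open>k\<close> times the integral of
    the square of \<open>x'\<close>, and it returns to 0.\<close>
  have "p4 (w b) - k * ?S b = p4 (w a) - k * ?S a"
  proof (rule zero_derivative_constant[of a b "\<lambda>t. p4 (w t) - k * ?S t"])
    fix t assume t: "t \<in> {a..b}"
    have S: "(?S has_real_derivative (x' t)\<^sup>2) (at t within {a..b})"
      by (intro DERIV_subset[OF primitive_has_derivative] continuous_intros cont_comps) auto
    have Yk: "p1 (w t) = k * x' t" using k[of t] Z[OF t] by (simp add: Y_def)
    show "((\<lambda>t. p4 (w t) - k * ?S t) has_real_derivative 0) (at t within {a..b})"
      by (rule derivative_eq_intros S D'(4)[OF t] refl)+ (simp add: Yk power2_eq_square)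
  qed (use T in auto)
  then have "k * (?S b - ?S a) = 0" using w_a' w_b' by (simp add: right_diff_distrib)
  then have k0: "k = 0"
    using integral_square_pos[of x' a b] conts T x'_a by auto
  have Z10: "fst (Z t) = 0" for t using k k0 by simp
  then have Z20: "snd (Z t) = 0" for t
    using DERIV_unique[OF Z1[of t]] by (auto intro: DERIV_const)
  then have "p1 \<eta> = 0" "p2 \<eta> = 0"
    using Z10[of a] Z20[of a] Z[of a] T w_a' by (auto simp: Y_def U_def)
  moreover from this have "p4 \<eta> = 0"
    using zero h_z0 by (simp add: dresidual_def zero_prod_def \<xi>0_def)
  ultimately have \<eta>: "\<eta> = p3 \<eta> *\<^sub>R (0, 0, 1, 0, 0)"
    using eps0 by (simp add: prod_eq_iff)
  have "init \<eta> = p3 \<eta> *\<^sub>R init (0, 0, 1, 0, 0)"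
    by (subst \<eta>) (simp add: init_def)
  then have "p3 (w b) = p3 \<eta> * \<kappa>"
    using dresidual_alpha by (simp add: w_b blinfun.scaleR_right)
  then have "p3 \<eta> = 0" using w_b' \<kappa> by simp
  then show ?thesis using \<eta> by (simp add: zero_prod_def)
qed

end

section \<open>The solution branch and its correspondence with periodic solutions\<close>

context melnikov_flow
begin

text \<open>As \<epsilon> is carried along both as a datum and as a residual component, the inverse
  function theorem does the work of the implicit one: the branch is the image of the line
  \<open>(0, 0, 0, 0, \<epsilon>)\<close> under the local inverse.\<close>

lemma solution_branch:
  obtains U e q D where "open U" "\<xi>0 \<in> U" "U \<subseteq> dom" "0 < e"
    "\<And>\<epsilon>. \<bar>\<epsilon>\<bar> < e \<Longrightarrow> q \<epsilon> \<in> U"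
    "\<And>\<epsilon>. \<bar>\<epsilon>\<bar> < e \<Longrightarrow> residual (q \<epsilon>) = (0, 0, 0, 0, \<epsilon>)"
    "\<And>\<epsilon>. \<bar>\<epsilon>\<bar> < e \<Longrightarrow> (q has_vector_derivative D \<epsilon>) (at \<epsilon>)"
    "continuous_on {-e<..<e} D" "q 0 = \<xi>0"
    "\<And>\<xi> \<epsilon>. \<xi> \<in> U \<Longrightarrow> \<bar>\<epsilon>\<bar> < e \<Longrightarrow> residual \<xi> = (0, 0, 0, 0, \<epsilon>) \<Longrightarrow> \<xi> = q \<epsilon>"
proof -
  have "inj (dresidual \<xi>0)"
    using dresidual_injective linear_injective_0 has_derivative_linear[OF residual_has_derivative[OF \<xi>0_dom]]
    by blast
  then obtain A where A: "linear A" "A \<circ> dresidual \<xi>0 = id"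
    using linear_injective_left_inverse has_derivative_linear[OF residual_has_derivative[OF \<xi>0_dom]] by blast
  have inv: "Blinfun A o\<^sub>L Dresidual \<xi>0 = id_blinfun"
    using A by (intro blinfun_eqI)
      (simp add: Dresidual[OF \<xi>0_dom] bounded_linear_Blinfun_apply linear_conv_bounded_linear pointfree_idE)
  have der: "(residual has_derivative blinfun_apply (Dresidual \<xi>)) (at \<xi>)" if "\<xi> \<in> dom" for \<xi>
    using residual_has_derivative[OF that] Dresidual[OF that] by simp
  obtain U V g and g' :: "data \<Rightarrow> data \<Rightarrow> data"
    where U: "open U" "U \<subseteq> dom" "\<xi>0 \<in> U" and V: "open V" "residual \<xi>0 \<in> V"
      and hom: "homeomorphism U V residual g"
      and g: "\<And>y. y \<in> V \<Longrightarrow> (g has_derivative (g' y)) (at y)"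
      and g': "\<And>y. y \<in> V \<Longrightarrow> g' y = inv (blinfun_apply (Dresidual (g y)))"
      and bij: "\<And>y. y \<in> V \<Longrightarrow> bij (blinfun_apply (Dresidual (g y)))"
    using inverse_function_theorem[OF open_dom der continuous_Dresidual \<xi>0_dom inv] by blast
  obtain e where e: "0 < e" "ball 0 e \<subseteq> V"
    using V residual_\<xi>0 openE by metis
  define E :: "real \<Rightarrow> data" where "E \<epsilon> = (0, 0, 0, 0, \<epsilon>)" for \<epsilon>
  have E_V: "E \<epsilon> \<in> V" if "\<bar>\<epsilon>\<bar> < e" for \<epsilon>
    using that e by (auto simp: E_def norm_Pair subset_iff)
  have E_deriv: "(E has_vector_derivative E 1) (at \<epsilon>)" for \<epsilon>
    unfolding E_def[abs_def] by (intro has_vector_derivative_Pair has_vector_derivative_const has_vector_derivative_id)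
  define q where "q \<epsilon> = g (E \<epsilon>)" for \<epsilon>
  define D where "D \<epsilon> = g' (E \<epsilon>) (E 1)" for \<epsilon>
  have q_U: "q \<epsilon> \<in> U" and q_res: "residual (q \<epsilon>) = E \<epsilon>" if "\<bar>\<epsilon>\<bar> < e" for \<epsilon>
    using E_V[OF that] hom by (auto simp: q_def homeomorphism_def)
  have q_deriv: "(q has_vector_derivative D \<epsilon>) (at \<epsilon>)" if "\<bar>\<epsilon>\<bar> < e" for \<epsilon>
  proof -
    have "((\<lambda>\<epsilon>. g (E \<epsilon>)) has_derivative (\<lambda>s. g' (E \<epsilon>) (s *\<^sub>R E 1))) (at \<epsilon>)"
      using E_deriv unfolding has_vector_derivative_def
      by (rule has_derivative_compose) (rule g[OF E_V[OF that]])
    then show ?thesis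
      using linear_scale[OF has_derivative_linear[OF g[OF E_V[OF that]]]]
      by (simp add: has_vector_derivative_def q_def[abs_def] D_def)
  qed
  \<comment> \<open>\<open>D \<epsilon>\<close> is the solution of the linear equation
    \<open>Dresidual (q \<epsilon>) (D \<epsilon>) = E 1\<close>, whose operator is invertible and
    continuous in \<epsilon>.\<close>
  have "continuous_on {-e<..<e} D"
  proof (rule continuous_on_blinfun_preimage)
    have "continuous_on {-e<..<e} q"
      by (intro continuous_at_imp_continuous_on ballI has_vector_derivative_continuous[OF q_deriv]) auto
    then show "continuous_on {-e<..<e} (\<lambda>\<epsilon>. Dresidual (q \<epsilon>))"
      by (rule continuous_on_compose2[OF continuous_Dresidual]) (use q_U U(2) in \<open>force simp: image_subset_iff abs_less_iff\<close>)
    show "inj (blinfun_apply (Dresidual (q \<epsilon>)))" if "\<epsilon> \<in> {-e<..<e}" for \<epsilon>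
      using that bij[OF E_V] by (auto simp: q_def bij_def)
    show "Dresidual (q \<epsilon>) (D \<epsilon>) = E 1" if "\<epsilon> \<in> {-e<..<e}" for \<epsilon>
    proof -
      have "E \<epsilon> \<in> V" using that by (intro E_V) auto
      then show ?thesis using bij by (simp add: q_def D_def g' bij_is_surj surj_f_inv_f)
    qed
  qed
  moreover have "\<xi> = q \<epsilon>" if "\<xi> \<in> U" "residual \<xi> = E \<epsilon>" for \<xi> \<epsilon>
    using that hom by (metis homeomorphism_apply1 q_def)
  moreover have "q 0 = \<xi>0"
    using calculation(2)[OF U(3), of 0] residual_\<xi>0 by (simp add: E_def zero_prod_def)
  ultimately show thesis
    using that[OF U(1,3,2) e(1) q_U q_res[unfolded E_def] q_deriv] by (auto simp: E_def)
qed

text \<open>A zero of the residual closes up \<open>y\<close> and \<open>m\<close> over one period;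
  a first integral and the hypothesis \<open>near\<close> close up \<open>v\<close>. The reduced
  times in the conclusion let later estimates for the flow on \<open>{a..b}\<close> hold on the
  whole line.\<close>

lemma periodic_solution_of_residual:
  assumes dom: "\<xi> \<in> dom" and res: "residual \<xi> = (0, 0, 0, 0, \<epsilon>)"
    and near: "C * dist (init \<xi>) (orbit \<alpha>0 a) < \<bar>x' a\<bar>"
  obtains y v m where
    "\<And>t. (y has_real_derivative v t) (at t)"
    "\<And>t. (v has_real_derivative f (y t) + \<epsilon> * (\<gamma> (t - p3 \<xi>) * h (p4 \<xi> + \<epsilon> * m t))) (at t)"
    "\<And>t. y (t + T) = y t"
    "\<And>t. (v t)\<^sup>2 / 2 - primitive f (y t) - d = primitive h (p4 \<xi> + \<epsilon> * m t)"
    "(LBINT t=a..b. (y t - x t) * x' t) = 0"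
    "\<And>t. \<exists>s\<in>{a..b}. \<exists>n::int. s = t - of_int n * T \<and>
       y t = p1 (\<Phi> (init \<xi>) s) \<and> v t = p2 (\<Phi> (init \<xi>) s) \<and> m t = p3 (\<Phi> (init \<xi>) s)"
    "\<And>t. t \<in> {a..b} \<Longrightarrow> y t = p1 (\<Phi> (init \<xi>) t)"
proof -
  let ?X = "\<Phi> (init \<xi>)"
  have eps: "eps \<xi> = \<epsilon>" using res by (simp add: residual_def)
  have Xa: "?X a = (p1 \<xi>, p2 \<xi>, 0, 0, p3 \<xi>, \<epsilon>, p4 \<xi>)"
    using \<Phi>_a[OF init_in_ball[OF dom]] by (simp add: init_def eps)
  have Xb: "p1 (?X b) = p1 \<xi>" "p3 (?X b) = 0" "p4 (?X b) = 0"
    and H_a: "(p2 \<xi>)\<^sup>2 / 2 - primitive f (p1 \<xi>) - d = primitive h (p4 \<xi>)"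
    using res by (simp_all add: residual_def)
  define y where "y t = p1 (?X t)" for t
  define v where "v t = p2 (?X t)" for t
  define m where "m t = p3 (?X t)" for t
  note D = solves_fieldD[OF \<Phi>_solves[OF init_in_ball[OF dom]], unfolded Xa fst_conv snd_conv]
  have y: "(y has_real_derivative v t) (at t within {a..b})"
    and v: "(v has_real_derivative f (y t) + \<epsilon> * (\<gamma> (t - p3 \<xi>) * h (p4 \<xi> + \<epsilon> * m t))) (at t within {a..b})"
    and m: "(m has_real_derivative \<gamma> (t - p3 \<xi>) * v t) (at t within {a..b})"
    and c: "((\<lambda>t. p4 (?X t)) has_real_derivative (y t - x t) * x' t) (at t within {a..b})"
    if "t \<in> {a..b}" for t
    using D(1-4)[OF that] by (simp_all add: y_def[abs_def] v_def[abs_def] m_def[abs_def])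
  have F: "(primitive f has_real_derivative f u) (at u)" and H: "(primitive h has_real_derivative h u) (at u)" for u
    by (intro primitive_has_derivative conts)+
  \<comment> \<open>A first integral for every \<epsilon>: the work done by the forcing changes the
    energy and \<open>primitive h\<close> of \<open>z\<close> by the same amount.\<close>
  define Q where "Q t = (v t)\<^sup>2 / 2 - primitive f (y t) - primitive h (p4 \<xi> + \<epsilon> * m t)" for t
  have Q: "Q t = Q a" if "t \<in> {a..b}" for t
  proof (rule zero_derivative_constant[OF _ that])
    fix t assume t: "t \<in> {a..b}"
    show "(Q has_real_derivative 0) (at t within {a..b})"
      unfolding Q_def
      by (rule derivative_eq_intros y[OF t] v[OF t] m[OF t] DERIV_chain2[OF F] DERIV_chain2[OF H] refl | simp)+
        (simp add: algebra_simps power2_eq_square)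
  qed (use T in auto)
  have Qd: "Q a = d"
    using H_a by (simp add: Q_def y_def v_def m_def Xa)
  have ya: "y b = y a" and ma: "m b = m a" "m a = 0"
    using Xb by (simp_all add: y_def m_def Xa)
  have "(v b)\<^sup>2 = (v a)\<^sup>2"
    using Q[of b] T by (simp add: Q_def ya ma)
  \<comment> \<open>Both end velocities then have the sign of \<open>x' a\<close>, which rules out
    \<open>v b = - v a\<close>.\<close>
  moreover have "\<bar>v a - x' a\<bar> < \<bar>x' a\<bar>" "\<bar>v b - x' a\<bar> < \<bar>x' a\<bar>"
  proof -
    have close: "\<bar>v t - x' t\<bar> < \<bar>x' a\<bar>" if "t \<in> {a..b}" for t
    proof -
      have "\<bar>v t - x' t\<bar> = dist (p2 (?X t)) (p2 (orbit \<alpha>0 t))"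
        by (simp add: v_def orbit_def dist_real_def)
      also have "\<dots> \<le> dist (?X t) (orbit \<alpha>0 t)"
        by (meson dist_fst_le dist_snd_le order_trans)
      also have "\<dots> \<le> C * dist (init \<xi>) (orbit \<alpha>0 a)" by (rule \<Phi>_close[OF init_in_ball[OF dom] that])
      also have "\<dots> < \<bar>x' a\<bar>" by (rule near)
      finally show ?thesis .
    qed
    show "\<bar>v a - x' a\<bar> < \<bar>x' a\<bar>" "\<bar>v b - x' a\<bar> < \<bar>x' a\<bar>"
      using close[of a] close[of b] T by (simp_all add: x_per)
  qed
  ultimately have va: "v b = v a"
    by (auto simp: power2_eq_iff abs_if split: if_splits)
  let ?Z = "\<lambda>t. (y t, v t, m t)"
  let ?W = "\<lambda>t. (v t, f (y t) + \<epsilon> * (\<gamma> (t - p3 \<xi>) * h (p4 \<xi> + \<epsilon> * m t)), \<gamma> (t - p3 \<xi>) * v t)"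
  have \<gamma>b: "\<gamma> (b - p3 \<xi>) = \<gamma> (a - p3 \<xi>)"
    using \<gamma>_per[of "a - p3 \<xi>"] by (simp add: algebra_simps)
  obtain Z W where ZW: "\<And>t. (Z has_vector_derivative W t) (at t)" "\<And>t. Z (t + T) = Z t"
    and ZW': "\<And>t. \<exists>s\<in>{a..b}. \<exists>n::int. s = t - of_int n * T \<and> Z t = ?Z s \<and> W t = ?W s"
    and Z: "\<And>t. t \<in> {a..b} \<Longrightarrow> Z t = ?Z t"
  proof (rule periodic_extension[OF T, of a ?Z ?W])
    show "(?Z has_vector_derivative ?W t) (at t within {a..b})" if "t \<in> {a..b}" for t
      using y[OF that] v[OF that] m[OF that]
      by (simp add: has_vector_derivative_Pair has_real_derivative_iff_has_vector_derivative)
  qed (use ya va ma \<gamma>b in auto)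
  have \<gamma>_int: "\<gamma> (t - of_int n * T - s) = \<gamma> (t - s)" for t s and n :: int
  proof -
    have "\<gamma> ((t - s) - of_int n * T) = \<gamma> (t - s)" by (rule periodic_minus_int) (rule \<gamma>_per)
    then show ?thesis by (simp add: algebra_simps)
  qed
  have W: "W t = (p2 (Z t), f (p1 (Z t)) + \<epsilon> * (\<gamma> (t - p3 \<xi>) * h (p4 \<xi> + \<epsilon> * snd (snd (Z t)))), \<gamma> (t - p3 \<xi>) * p2 (Z t))" for t
    using ZW'[of t] \<gamma>_int by auto
  show thesis
  proof (rule that[of "\<lambda>t. p1 (Z t)" "\<lambda>t. p2 (Z t)" "\<lambda>t. snd (snd (Z t))"])
    show "((\<lambda>t. p1 (Z t)) has_real_derivative p2 (Z t)) (at t)" for t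
      using has_vector_derivative_fst[OF ZW(1), of t] by (simp add: has_real_derivative_iff_has_vector_derivative W)
    show "((\<lambda>t. p2 (Z t)) has_real_derivative f (p1 (Z t)) + \<epsilon> * (\<gamma> (t - p3 \<xi>) * h (p4 \<xi> + \<epsilon> * snd (snd (Z t))))) (at t)" for t
      using has_vector_derivative_fst[OF has_vector_derivative_snd[OF ZW(1)], of t]
      by (simp add: has_real_derivative_iff_has_vector_derivative W)
    show "(p2 (Z t))\<^sup>2 / 2 - primitive f (p1 (Z t)) - d = primitive h (p4 \<xi> + \<epsilon> * snd (snd (Z t)))" for t
    proof -
      obtain s where s: "s \<in> {a..b}" "Z t = ?Z s" using ZW'[of t] by blast
      show ?thesis using Q[OF s(1)] Qd by (simp add: s(2) Q_def)
    qed
    have "continuous_on {a..b} y" using y by (meson DERIV_continuous_on)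
    then have "(LBINT t=ereal a..ereal b. (y t - x t) * x' t) = p4 (?X b) - p4 (?X a)"
      using T c by (intro LBINT_antiderivative continuous_intros conts) auto
    moreover have "(LBINT t=ereal a..ereal b. (p1 (Z t) - x t) * x' t) = (LBINT t=ereal a..ereal b. (y t - x t) * x' t)"
      using T Z by (intro interval_integral_cong) (auto simp: einterval_def)
    ultimately show "(LBINT t=ereal a..ereal b. (p1 (Z t) - x t) * x' t) = 0"
      by (simp add: Xb Xa)
    show "\<exists>s\<in>{a..b}. \<exists>n::int. s = t - of_int n * T \<and>
       p1 (Z t) = p1 (?X s) \<and> p2 (Z t) = p2 (?X s) \<and> snd (snd (Z t)) = p3 (?X s)" for t
      using ZW'[of t] by (auto simp: y_def v_def m_def)
    show "p1 (Z t) = p1 (?X t)" if "t \<in> {a..b}" for t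
      using Z[OF that] by (simp add: y_def)
  qed (use ZW in auto)
qed

text \<open>The variable \<open>m\<close> is recovered as \<open>(z t - z a) / \<epsilon>\<close>,
  so \<epsilon> \<noteq> 0 is essential; periodicity of \<open>z\<close> becomes
  \<open>m b = 0\<close>. The second conclusion identifies the solution with the flow, so that equal
  data give equal solutions.\<close>

lemma residual_of_periodic_solution:
  assumes \<epsilon>: "\<epsilon> \<noteq> 0"
    and y: "\<And>t. (y has_real_derivative v t) (at t)"
    and v: "\<And>t. (v has_real_derivative f (y t) + \<epsilon> * (\<gamma> (t - \<beta>) * h (z t))) (at t)"
    and z: "\<And>t. (z has_real_derivative \<epsilon> * (\<gamma> (t - \<beta>) * v t)) (at t)"
    and per: "y b = y a" "z b = z a"
    and energy: "(v a)\<^sup>2 / 2 - primitive f (y a) - d = primitive h (z a)"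
    and phase: "(LBINT t=a..b. (y t - x t) * x' t) = 0"
    and \<xi>: "\<xi> = (y a, v a, \<beta>, z a, \<epsilon>)" "\<xi> \<in> dom"
  shows "residual \<xi> = (0, 0, 0, 0, \<epsilon>)"
    and "\<And>t. t \<in> {a..b} \<Longrightarrow> p1 (\<Phi> (init \<xi>) t) = y t"
proof -
  let ?P = "primitive (\<lambda>t. (y t - x t) * x' t)"
  have cont: "continuous_on UNIV (\<lambda>t. (y t - x t) * x' t)"
    using y by (intro continuous_intros conts) (auto intro: DERIV_continuous_on)
  define X where "X t = (y t, v t, (z t - z a) / \<epsilon>, ?P t - ?P a, \<beta>, \<epsilon>, z a)" for t
  have sol: "solves_on field a b X"
    unfolding X_def
  proof (rule solves_fieldI)
    fix t
    show "(y has_real_derivative v t) (at t within {a..b})" using y by (rule DERIV_subset) simp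
    have "z a + \<epsilon> * ((z t - z a) / \<epsilon>) = z t" using \<epsilon> by simp
    then show "(v has_real_derivative f (y t) + \<epsilon> * (\<gamma> (t - \<beta>) * h (z a + \<epsilon> * ((z t - z a) / \<epsilon>)))) (at t within {a..b})"
      using v by (auto intro: DERIV_subset)
    show "((\<lambda>t. (z t - z a) / \<epsilon>) has_real_derivative \<gamma> (t - \<beta>) * v t) (at t within {a..b})"
      using \<epsilon> by (auto intro!: derivative_eq_intros DERIV_subset[OF z])
    show "((\<lambda>t. ?P t - ?P a) has_real_derivative (y t - x t) * x' t) (at t within {a..b})"
      by (auto intro!: derivative_eq_intros DERIV_subset[OF primitive_has_derivative[OF cont]])
  qed
  have "X a = init \<xi>" by (simp add: X_def init_def \<xi>)
  then have \<Phi>X: "\<Phi> (init \<xi>) t = X t" if "t \<in> {a..b}" for t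
    using \<Phi>_unique[OF \<xi>(2) sol] that by simp
  then show "p1 (\<Phi> (init \<xi>) t) = y t" if "t \<in> {a..b}" for t
    using that by (simp add: X_def)
  have "?P b - ?P a = 0"
    using phase LBINT_primitive[OF cont, of a b] T by simp
  then show "residual \<xi> = (0, 0, 0, 0, \<epsilon>)"
    using T energy by (simp add: residual_def \<Phi>X X_def per) (simp add: \<xi>)
qed

end

lemma norm_data_le: "norm (\<xi> :: data) \<le> \<bar>p1 \<xi>\<bar> + \<bar>p2 \<xi>\<bar> + \<bar>p3 \<xi>\<bar> + \<bar>p4 \<xi>\<bar> + \<bar>snd (snd (snd (snd \<xi>)))\<bar>"
proof -
  have P: "norm p \<le> norm (fst p) + norm (snd p)" for p :: "'x::real_normed_vector \<times> 'y::real_normed_vector"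
    using norm_Pair_le[of "fst p" "snd p"] by simp
  show ?thesis
    using P[of \<xi>] P[of "snd \<xi>"] P[of "snd (snd \<xi>)"] P[of "snd (snd (snd \<xi>))"] by simp
qed

lemma periodic_bounded:
  fixes g :: "real \<Rightarrow> real"
  assumes "continuous_on UNIV g" "0 < T" and per: "\<And>t. g (t + T) = g t"
  obtains B where "0 < B" "\<And>t. \<bar>g t\<bar> \<le> B"
proof -
  have "compact (g ` {0..T})"
    using assms by (intro compact_continuous_image continuous_on_subset[OF assms(1)]) auto
  then obtain B where B: "0 < B" "\<And>t. t \<in> {0..T} \<Longrightarrow> \<bar>g t\<bar> \<le> B"
    using compact_imp_bounded bounded_pos by (metis image_eqI real_norm_def)
  have "\<bar>g t\<bar> \<le> B" for t
  proof -
    define n where "n = \<lfloor>t / T\<rfloor>"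
    have "of_int n \<le> t / T" "t / T < of_int n + 1" unfolding n_def by linarith+
    then have "t - of_int n * T \<in> {0..T}" using \<open>0 < T\<close> by (auto simp: field_simps)
    moreover have "g (t - of_int n * T) = g t" by (rule periodic_minus_int) (rule per)
    ultimately show ?thesis using B(2) by metis
  qed
  with B(1) show thesis by (rule that)
qed

text \<open>The continued solutions \<open>y \<epsilon>\<close> of the system for \<open>y (t) = \<psi> (t - \<alpha>)\<close> and
  \<open>z = H\<^sup>-\<^sup>1 (v\<^sup>2 / 2 - F y - d)\<close>, with their phases \<open>\<alpha> \<epsilon>\<close>.\<close>

locale melnikov_branch = melnikov_setting +
  fixes e \<rho> :: real and \<alpha> D :: "real \<Rightarrow> real" and y v z :: "real \<Rightarrow> real \<Rightarrow> real"
  assumes e: "0 < e" and \<rho>: "0 < \<rho>" and \<alpha>_0: "\<alpha> 0 = \<alpha>0" and D: "continuous_on {-e<..<e} D"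
    and \<alpha>: "\<And>\<epsilon>. \<bar>\<epsilon>\<bar> < e \<Longrightarrow> (\<alpha> has_real_derivative D \<epsilon>) (at \<epsilon>)"
    and y: "\<And>\<epsilon> t. \<bar>\<epsilon>\<bar> < e \<Longrightarrow> (y \<epsilon> has_real_derivative v \<epsilon> t) (at t)"
    and v: "\<And>\<epsilon> t. \<bar>\<epsilon>\<bar> < e \<Longrightarrow> (v \<epsilon> has_real_derivative f (y \<epsilon> t) + \<epsilon> * (\<gamma> (t - \<alpha> \<epsilon>) * h (z \<epsilon> t))) (at t)"
    and y_per: "\<And>\<epsilon> t. \<bar>\<epsilon>\<bar> < e \<Longrightarrow> y \<epsilon> (t + T) = y \<epsilon> t"
    and y_energy: "\<And>\<epsilon> t. \<bar>\<epsilon>\<bar> < e \<Longrightarrow> (v \<epsilon> t)\<^sup>2 / 2 - primitive f (y \<epsilon> t) - d = primitive h (z \<epsilon> t)"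
    and y_phase: "\<And>\<epsilon>. \<bar>\<epsilon>\<bar> < e \<Longrightarrow> (LBINT t=a..b. (y \<epsilon> t - x t) * x' t) = 0"
    and close: "\<And>c. 0 < c \<Longrightarrow> \<exists>\<delta>>0. \<forall>\<epsilon> t. \<bar>\<epsilon>\<bar> < \<delta> \<longrightarrow> \<bar>\<epsilon>\<bar> < e \<longrightarrow>
       \<bar>y \<epsilon> t - x t\<bar> \<le> c \<and> \<bar>v \<epsilon> t - x' t\<bar> \<le> c \<and> \<bar>z \<epsilon> t - z0\<bar> \<le> c \<and>
       \<bar>f (y \<epsilon> t) + \<epsilon> * (\<gamma> (t - \<alpha> \<epsilon>) * h (z \<epsilon> t)) - f (x t)\<bar> \<le> c"
    and unique: "\<And>\<epsilon> \<beta> y1 v1 z1. \<lbrakk>\<epsilon> \<noteq> 0; \<bar>\<epsilon>\<bar> < e;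
       \<And>t. (y1 has_real_derivative v1 t) (at t);
       \<And>t. (v1 has_real_derivative f (y1 t) + \<epsilon> * (\<gamma> (t - \<beta>) * h (z1 t))) (at t);
       \<And>t. (z1 has_real_derivative \<epsilon> * (\<gamma> (t - \<beta>) * v1 t)) (at t);
       \<And>t. y1 (t + T) = y1 t; z1 (a + T) = z1 a;
       (v1 a)\<^sup>2 / 2 - primitive f (y1 a) - d = primitive h (z1 a);
       (LBINT t=a..b. (y1 t - x t) * x' t) = 0;
       \<bar>y1 a - x a\<bar> < \<rho>; \<bar>v1 a - x' a\<bar> < \<rho>; \<bar>\<beta> - \<alpha>0\<bar> < \<rho>; \<bar>z1 a - z0\<bar> < \<rho>\<rbrakk>
       \<Longrightarrow> \<beta> = \<alpha> \<epsilon> \<and> y1 = y \<epsilon>"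

context melnikov_flow
begin

text \<open>The flow estimate on one period and periodicity of \<open>x\<close>, \<open>x'\<close>
  and \<gamma> give bounds uniform in \<open>t\<close>. The last bound is for the second derivative,
  read off from the equation rather than differentiated.\<close>

lemma closeness:
  assumes "0 < e"
  obtains \<delta> where "0 < \<delta>"
    "\<And>\<xi> \<epsilon> y v m t. \<lbrakk>\<xi> \<in> dom; dist \<xi> \<xi>0 < \<delta>; \<bar>\<epsilon>\<bar> < \<delta>;
       \<And>t. \<exists>s\<in>{a..b}. \<exists>n::int. s = t - of_int n * T \<and>
       y t = p1 (\<Phi> (init \<xi>) s) \<and> v t = p2 (\<Phi> (init \<xi>) s) \<and> m t = p3 (\<Phi> (init \<xi>) s)\<rbrakk> \<Longrightarrow>
     \<bar>y t - x t\<bar> \<le> e \<and> \<bar>v t - x' t\<bar> \<le> e \<and> \<bar>p4 \<xi> + \<epsilon> * m t - z0\<bar> \<le> e \<and>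
     \<bar>f (y t) + \<epsilon> * (\<gamma> (t - p3 \<xi>) * h (p4 \<xi> + \<epsilon> * m t)) - f (x t)\<bar> \<le> e"
proof -
  obtain Bx where Bx: "0 < Bx" "\<And>t. \<bar>x t\<bar> \<le> Bx"
    using periodic_bounded[OF conts(4) T x_per(1)] by blast
  obtain B\<gamma> where B\<gamma>: "0 < B\<gamma>" "\<And>t. \<bar>\<gamma> t\<bar> \<le> B\<gamma>"
    using periodic_bounded[OF conts(3) T \<gamma>_per] by blast
  have "compact (h ` {z0 - 1..z0 + 1})"
    by (intro compact_continuous_image conts) auto
  then obtain Bh where Bh: "0 < Bh" "\<And>u. u \<in> {z0 - 1..z0 + 1} \<Longrightarrow> \<bar>h u\<bar> \<le> Bh"
    using compact_imp_bounded bounded_pos by (metis image_eqI real_norm_def)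
  have "compact ((\<lambda>t. p3 (orbit \<alpha>0 t)) ` {a..b})"
    by (intro compact_continuous_image continuous_on_fst continuous_on_snd
        solves_on_continuous[OF solves_orbit] compact_Icc)
  then have "bounded ((\<lambda>t. p3 (orbit \<alpha>0 t)) ` {a..b})" by (rule compact_imp_bounded)
  then obtain Bm where Bm: "0 < Bm" "\<And>t. t \<in> {a..b} \<Longrightarrow> \<bar>p3 (orbit \<alpha>0 t)\<bar> \<le> Bm"
    unfolding bounded_pos by auto
  have "uniformly_continuous_on {- Bx - 1..Bx + 1} f"
    by (intro compact_uniformly_continuous conts) auto
  then obtain \<kappa> where \<kappa>: "0 < \<kappa>"
    "\<And>u u'. u \<in> {- Bx - 1..Bx + 1} \<Longrightarrow> u' \<in> {- Bx - 1..Bx + 1} \<Longrightarrow> \<bar>u' - u\<bar> < \<kappa> \<Longrightarrow> \<bar>f u' - f u\<bar> < e / 2"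
    using half_gt_zero[OF \<open>0 < e\<close>] unfolding uniformly_continuous_on_def dist_real_def
    by blast
  \<comment> \<open>The cap 1 keeps \<open>z\<close> and \<open>y\<close> in the compact sets on
    which \<open>h\<close> is bounded and \<open>f\<close> is uniformly continuous.\<close>
  define \<delta>1 where "\<delta>1 = min 1 (min e (\<kappa> / 2))"
  have \<delta>1: "0 < \<delta>1" "\<delta>1 \<le> 1" "\<delta>1 \<le> e" "\<delta>1 < \<kappa>"
    using \<kappa>(1) \<open>0 < e\<close> by (auto simp: \<delta>1_def)
  obtain \<delta>2 where \<delta>2: "0 < \<delta>2" "\<And>\<xi>. dist \<xi> \<xi>0 < \<delta>2 \<Longrightarrow> dist (init \<xi>) (orbit \<alpha>0 a) < \<delta>1 / C"
    using continuous_init[of UNIV] divide_pos_pos[OF \<delta>1(1) C] unfolding continuous_on_iff init_\<xi>0[symmetric]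
    by blast
  \<comment> \<open>In turn, the four terms control the flow, the product
    \<open>\<epsilon> * m\<close>, the initial value of \<open>z\<close>, and the size of the
    forcing.\<close>
  define \<delta> where "\<delta> = min \<delta>2 (min (\<delta>1 / (2 * (Bm + 1))) (min (\<delta>1 / 2) (e / (2 * (B\<gamma> * Bh)))))"
  have \<delta>: "0 < \<delta>" "\<delta> \<le> \<delta>2" "\<delta> * (Bm + 1) \<le> \<delta>1 / 2" "\<delta> \<le> \<delta>1 / 2" "\<delta> * (B\<gamma> * Bh) \<le> e / 2"
  proof -
    show "0 < \<delta>" using \<delta>1 \<delta>2 Bm B\<gamma> Bh \<open>0 < e\<close> by (auto simp: \<delta>_def)
    show "\<delta> \<le> \<delta>2" "\<delta> \<le> \<delta>1 / 2"
      unfolding \<delta>_def by (meson min.coboundedI1 min.coboundedI2 order_refl)+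
    have "\<delta> \<le> \<delta>1 / (2 * (Bm + 1))" "\<delta> \<le> e / (2 * (B\<gamma> * Bh))"
      unfolding \<delta>_def by (meson min.coboundedI1 min.coboundedI2 order_refl)+
    then show "\<delta> * (Bm + 1) \<le> \<delta>1 / 2" "\<delta> * (B\<gamma> * Bh) \<le> e / 2"
      using Bm B\<gamma> Bh by (simp_all add: field_simps)
  qed
  show thesis
  proof (rule that[OF \<delta>(1)])
    fix \<xi> \<epsilon> y v m t
    assume \<xi>: "\<xi> \<in> dom" "dist \<xi> \<xi>0 < \<delta>" and \<epsilon>: "\<bar>\<epsilon>\<bar> < \<delta>"
      and ex: "\<And>t. \<exists>s\<in>{a..b}. \<exists>n::int. s = t - of_int n * T \<and>
       y t = p1 (\<Phi> (init \<xi>) s) \<and> v t = p2 (\<Phi> (init \<xi>) s) \<and> m t = p3 (\<Phi> (init \<xi>) s)"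
    obtain s and n :: int where s: "s \<in> {a..b}" "s = t - of_int n * T"
      and yvm: "y t = p1 (\<Phi> (init \<xi>) s)" "v t = p2 (\<Phi> (init \<xi>) s)" "m t = p3 (\<Phi> (init \<xi>) s)"
      using ex[of t] by blast
    have xs: "x s = x t" "x' s = x' t"
      unfolding s(2) by (rule periodic_minus_int, rule x_per)+
    have "dist (\<Phi> (init \<xi>) s) (orbit \<alpha>0 s) \<le> C * dist (init \<xi>) (orbit \<alpha>0 a)"
      by (rule \<Phi>_close[OF init_in_ball[OF \<xi>(1)] s(1)])
    also have "\<dots> \<le> C * (\<delta>1 / C)"
      using C \<delta>2(2)[of \<xi>] \<xi>(2) \<delta>(2) by (intro mult_left_mono) auto
    finally have d: "dist (\<Phi> (init \<xi>) s) (orbit \<alpha>0 s) \<le> \<delta>1" using C by simp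
    have 1: "dist (p1 (\<Phi> (init \<xi>) s)) (p1 (orbit \<alpha>0 s)) \<le> \<delta>1"
      "dist (p2 (\<Phi> (init \<xi>) s)) (p2 (orbit \<alpha>0 s)) \<le> \<delta>1"
      "dist (p3 (\<Phi> (init \<xi>) s)) (p3 (orbit \<alpha>0 s)) \<le> \<delta>1"
      using d by (meson dist_fst_le dist_snd_le order_trans)+
    have y: "\<bar>y t - x t\<bar> \<le> \<delta>1" and v: "\<bar>v t - x' t\<bar> \<le> \<delta>1"
      using 1(1,2) by (simp_all add: yvm orbit_def dist_real_def xs)
    have "\<bar>m t\<bar> \<le> Bm + 1"
      using 1(3) Bm(2)[OF s(1)] \<delta>1(2) unfolding yvm(3) dist_real_def by linarith
    then have "\<bar>\<epsilon>\<bar> * \<bar>m t\<bar> \<le> \<delta> * (Bm + 1)" using \<epsilon> Bm(1) by (intro mult_mono) auto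
    then have \<epsilon>m: "\<bar>\<epsilon> * m t\<bar> \<le> \<delta>1 / 2" using \<delta>(3) by (simp add: abs_mult)
    have "\<bar>p4 \<xi> - z0\<bar> \<le> dist \<xi> \<xi>0"
    proof -
      have "\<bar>p4 \<xi> - z0\<bar> = dist (p4 \<xi>) (p4 \<xi>0)" by (simp add: \<xi>0_def dist_real_def)
      also have "\<dots> \<le> dist \<xi> \<xi>0" by (meson dist_fst_le dist_snd_le order_trans)
      finally show ?thesis .
    qed
    then have z: "\<bar>p4 \<xi> + \<epsilon> * m t - z0\<bar> \<le> \<delta>1"
      using \<epsilon>m \<xi>(2) \<delta>(4) by linarith
    then have "\<bar>h (p4 \<xi> + \<epsilon> * m t)\<bar> \<le> Bh" using \<delta>1(2) by (intro Bh) auto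
    then have "\<bar>\<gamma> (t - p3 \<xi>)\<bar> * \<bar>h (p4 \<xi> + \<epsilon> * m t)\<bar> \<le> B\<gamma> * Bh"
      using B\<gamma> by (intro mult_mono) auto
    then have "\<bar>\<epsilon>\<bar> * (\<bar>\<gamma> (t - p3 \<xi>)\<bar> * \<bar>h (p4 \<xi> + \<epsilon> * m t)\<bar>) \<le> \<delta> * (B\<gamma> * Bh)"
      by (rule mult_mono[OF less_imp_le[OF \<epsilon>]]) (use \<delta>(1) in auto)
    then have "\<bar>\<epsilon> * (\<gamma> (t - p3 \<xi>) * h (p4 \<xi> + \<epsilon> * m t))\<bar> \<le> e / 2"
      using \<delta>(5) by (simp add: abs_mult)
    moreover have "\<bar>f (y t) - f (x t)\<bar> < e / 2"
      using y \<delta>1 Bx(2)[of t] by (intro \<kappa>(2)) auto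
    ultimately show "\<bar>y t - x t\<bar> \<le> e \<and> \<bar>v t - x' t\<bar> \<le> e \<and> \<bar>p4 \<xi> + \<epsilon> * m t - z0\<bar> \<le> e \<and>
      \<bar>f (y t) + \<epsilon> * (\<gamma> (t - p3 \<xi>) * h (p4 \<xi> + \<epsilon> * m t)) - f (x t)\<bar> \<le> e"
      using y v z \<delta>1(3) by linarith
  qed
qed

lemma branch_exists_flow:
  "\<exists>e \<rho> \<alpha> D y v z. melnikov_branch f f' h h' \<gamma> \<gamma>' x x' T a d \<alpha>0 z0 \<kappa> e \<rho> \<alpha> D y v z"
proof -
  obtain U e1 q D where U: "open U" "\<xi>0 \<in> U" "U \<subseteq> dom" and e1: "0 < e1"
    and q: "\<And>\<epsilon>. \<bar>\<epsilon>\<bar> < e1 \<Longrightarrow> q \<epsilon> \<in> U"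
      "\<And>\<epsilon>. \<bar>\<epsilon>\<bar> < e1 \<Longrightarrow> residual (q \<epsilon>) = (0, 0, 0, 0, \<epsilon>)"
      "\<And>\<epsilon>. \<bar>\<epsilon>\<bar> < e1 \<Longrightarrow> (q has_vector_derivative D \<epsilon>) (at \<epsilon>)"
    and D: "continuous_on {-e1<..<e1} D" and q0: "q 0 = \<xi>0"
    and q_unique: "\<And>\<xi> \<epsilon>. \<xi> \<in> U \<Longrightarrow> \<bar>\<epsilon>\<bar> < e1 \<Longrightarrow> residual \<xi> = (0, 0, 0, 0, \<epsilon>) \<Longrightarrow> \<xi> = q \<epsilon>"
    using solution_branch by blast
  have "isCont q 0" using q(3)[of 0] e1 by (auto intro: has_vector_derivative_continuous)
  then have q_lim: "\<exists>\<delta>>0. \<forall>\<epsilon>. \<bar>\<epsilon>\<bar> < \<delta> \<longrightarrow> dist (q \<epsilon>) \<xi>0 < c" if "0 < c" for c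
    using that unfolding continuous_at_eps_delta q0 by (simp add: dist_commute)
  have "isCont init \<xi>0" using continuous_init[of UNIV] continuous_on_eq_continuous_at[OF open_UNIV, of init] by blast
  then have "isCont (\<lambda>\<epsilon>. init (q \<epsilon>)) 0"
    using \<open>isCont q 0\<close> q0 by (intro isCont_o2[of _ q init]) auto
  moreover have "0 < \<bar>x' a\<bar> / C" using x'_a C by simp
  ultimately obtain e2 where e2: "0 < e2" "\<And>\<epsilon>. \<bar>\<epsilon>\<bar> < e2 \<Longrightarrow> dist (init (q \<epsilon>)) (orbit \<alpha>0 a) < \<bar>x' a\<bar> / C"
    unfolding continuous_at_eps_delta q0 init_\<xi>0 by (auto simp: dist_commute)
  obtain s where s: "0 < s" "ball \<xi>0 s \<subseteq> U" using U openE by blast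
  \<comment> \<open>Five coordinates, each off by less than \<open>s / 5\<close>, keep a datum in
    the ball of radius \<open>s\<close> where the branch is unique.\<close>
  define e where "e = min e1 (min e2 (s / 5))"
  have e: "0 < e" using e1 e2 s by (simp add: e_def)
  have e_le: "\<bar>\<epsilon>\<bar> < e1" "\<bar>\<epsilon>\<bar> < e2" "\<bar>\<epsilon>\<bar> < s / 5" if "\<bar>\<epsilon>\<bar> < e" for \<epsilon>
    using that by (auto simp: e_def)
  \<comment> \<open>The properties are bundled so that a triple \<open>(y, v, m)\<close> can be
    chosen for each \<epsilon> at once.\<close>
  define sol where "sol \<epsilon> = (\<lambda>(y, v, m).
    (\<forall>t. (y has_real_derivative v t) (at t)) \<and>
    (\<forall>t. (v has_real_derivative f (y t) + \<epsilon> * (\<gamma> (t - p3 (q \<epsilon>)) * h (p4 (q \<epsilon>) + \<epsilon> * m t))) (at t)) \<and>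
    (\<forall>t. y (t + T) = y t) \<and>
    (\<forall>t. (v t)\<^sup>2 / 2 - primitive f (y t) - d = primitive h (p4 (q \<epsilon>) + \<epsilon> * m t)) \<and>
    (LBINT t=a..b. (y t - x t) * x' t) = 0 \<and>
    (\<forall>t. \<exists>s\<in>{a..b}. \<exists>n::int. s = t - of_int n * T \<and>
       y t = p1 (\<Phi> (init (q \<epsilon>)) s) \<and> v t = p2 (\<Phi> (init (q \<epsilon>)) s) \<and> m t = p3 (\<Phi> (init (q \<epsilon>)) s)) \<and>
    (\<forall>t\<in>{a..b}. y t = p1 (\<Phi> (init (q \<epsilon>)) t)))" for \<epsilon> :: real
  have ex_sol: "\<exists>S. sol \<epsilon> S" if "\<bar>\<epsilon>\<bar> < e" for \<epsilon>
  proof -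
    have near: "C * dist (init (q \<epsilon>)) (orbit \<alpha>0 a) < \<bar>x' a\<bar>"
      using e2(2)[OF e_le(2)[OF that]] C by (simp add: field_simps)
    have dom: "q \<epsilon> \<in> dom" using q(1)[OF e_le(1)[OF that]] U by blast
    show ?thesis
      apply (rule periodic_solution_of_residual[OF dom q(2)[OF e_le(1)[OF that]] near])
      subgoal for y v m
        by (rule exI[of _ "(y, v, m)"]) (simp add: sol_def)
      done
  qed
  define S where "S \<epsilon> = (SOME S. sol \<epsilon> S)" for \<epsilon>
  have S: "sol \<epsilon> (S \<epsilon>)" if "\<bar>\<epsilon>\<bar> < e" for \<epsilon>
    unfolding S_def by (rule someI_ex) (rule ex_sol[OF that])
  define y where "y \<epsilon> = fst (S \<epsilon>)" for \<epsilon>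
  define v where "v \<epsilon> = fst (snd (S \<epsilon>))" for \<epsilon>
  define m where "m \<epsilon> = snd (snd (S \<epsilon>))" for \<epsilon>
  define \<alpha> where "\<alpha> \<epsilon> = p3 (q \<epsilon>)" for \<epsilon>
  define z where "z \<epsilon> t = p4 (q \<epsilon>) + \<epsilon> * m \<epsilon> t" for \<epsilon> t
  note S' = S[unfolded sol_def case_prod_beta, folded y_def v_def m_def \<alpha>_def z_def]
  have sys: "(y \<epsilon> has_real_derivative v \<epsilon> t) (at t)"
      "(v \<epsilon> has_real_derivative f (y \<epsilon> t) + \<epsilon> * (\<gamma> (t - \<alpha> \<epsilon>) * h (z \<epsilon> t))) (at t)"
    and y_per: "y \<epsilon> (t + T) = y \<epsilon> t"
    and y_energy: "(v \<epsilon> t)\<^sup>2 / 2 - primitive f (y \<epsilon> t) - d = primitive h (z \<epsilon> t)"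
    and y_phase: "(LBINT t=a..b. (y \<epsilon> t - x t) * x' t) = 0"
    and y_ex: "\<exists>s\<in>{a..b}. \<exists>n::int. s = t - of_int n * T \<and>
       y \<epsilon> t = p1 (\<Phi> (init (q \<epsilon>)) s) \<and> v \<epsilon> t = p2 (\<Phi> (init (q \<epsilon>)) s) \<and> m \<epsilon> t = p3 (\<Phi> (init (q \<epsilon>)) s)"
    and y_\<Phi>: "t \<in> {a..b} \<Longrightarrow> y \<epsilon> t = p1 (\<Phi> (init (q \<epsilon>)) t)"
    if "\<bar>\<epsilon>\<bar> < e" for \<epsilon> t
  proof -
    note 1 = S'[OF that]
    note 2 = 1[THEN conjunct2] note 3 = 2[THEN conjunct2] note 4 = 3[THEN conjunct2]
    note 5 = 4[THEN conjunct2] note 6 = 5[THEN conjunct2]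
    show "(y \<epsilon> has_real_derivative v \<epsilon> t) (at t)"
      "(v \<epsilon> has_real_derivative f (y \<epsilon> t) + \<epsilon> * (\<gamma> (t - \<alpha> \<epsilon>) * h (z \<epsilon> t))) (at t)"
      "y \<epsilon> (t + T) = y \<epsilon> t"
      "(v \<epsilon> t)\<^sup>2 / 2 - primitive f (y \<epsilon> t) - d = primitive h (z \<epsilon> t)"
      unfolding z_def
      by (rule 1[THEN conjunct1, THEN spec] 2[THEN conjunct1, THEN spec]
          3[THEN conjunct1, THEN spec] 4[THEN conjunct1, THEN spec])+
    show "(LBINT t=a..b. (y \<epsilon> t - x t) * x' t) = 0" by (rule 5[THEN conjunct1])
    show "\<exists>s\<in>{a..b}. \<exists>n::int. s = t - of_int n * T \<and>
       y \<epsilon> t = p1 (\<Phi> (init (q \<epsilon>)) s) \<and> v \<epsilon> t = p2 (\<Phi> (init (q \<epsilon>)) s) \<and> m \<epsilon> t = p3 (\<Phi> (init (q \<epsilon>)) s)"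
      by (rule 6[THEN conjunct1, THEN spec])
    show "t \<in> {a..b} \<Longrightarrow> y \<epsilon> t = p1 (\<Phi> (init (q \<epsilon>)) t)"
      by (rule 6[THEN conjunct2, THEN bspec])
  qed
  have "melnikov_branch f f' h h' \<gamma> \<gamma>' x x' T a d \<alpha>0 z0 \<kappa> e (s / 5) \<alpha> (\<lambda>\<epsilon>. p3 (D \<epsilon>)) y v z"
  proof unfold_locales
    show "0 < e" "0 < s / 5" using e s by auto
    show "\<alpha> 0 = \<alpha>0" by (simp add: \<alpha>_def q0 \<xi>0_def)
    show "continuous_on {-e<..<e} (\<lambda>\<epsilon>. p3 (D \<epsilon>))"
      by (intro continuous_intros continuous_on_subset[OF D]) (auto simp: e_def)
    show "(\<alpha> has_real_derivative p3 (D \<epsilon>)) (at \<epsilon>)" if "\<bar>\<epsilon>\<bar> < e" for \<epsilon>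
      using has_vector_derivative_projections(3)[OF q(3)[OF e_le(1)[OF that]]]
      by (simp add: \<alpha>_def[abs_def] has_real_derivative_iff_has_vector_derivative)
    fix c :: real assume "0 < c"
    obtain \<delta> where \<delta>: "0 < \<delta>" and close: "\<And>\<xi> \<epsilon> y v m t. \<lbrakk>\<xi> \<in> dom; dist \<xi> \<xi>0 < \<delta>; \<bar>\<epsilon>\<bar> < \<delta>;
       \<And>t. \<exists>s\<in>{a..b}. \<exists>n::int. s = t - of_int n * T \<and>
       y t = p1 (\<Phi> (init \<xi>) s) \<and> v t = p2 (\<Phi> (init \<xi>) s) \<and> m t = p3 (\<Phi> (init \<xi>) s)\<rbrakk> \<Longrightarrow>
     \<bar>y t - x t\<bar> \<le> c \<and> \<bar>v t - x' t\<bar> \<le> c \<and> \<bar>p4 \<xi> + \<epsilon> * m t - z0\<bar> \<le> c \<and>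
     \<bar>f (y t) + \<epsilon> * (\<gamma> (t - p3 \<xi>) * h (p4 \<xi> + \<epsilon> * m t)) - f (x t)\<bar> \<le> c"
      using closeness[OF \<open>0 < c\<close>] by blast
    obtain \<delta>' where \<delta>': "0 < \<delta>'" "\<And>\<epsilon>. \<bar>\<epsilon>\<bar> < \<delta>' \<Longrightarrow> dist (q \<epsilon>) \<xi>0 < \<delta>" using q_lim[OF \<delta>] by blast
    show "\<exists>\<delta>>0. \<forall>\<epsilon> t. \<bar>\<epsilon>\<bar> < \<delta> \<longrightarrow> \<bar>\<epsilon>\<bar> < e \<longrightarrow>
       \<bar>y \<epsilon> t - x t\<bar> \<le> c \<and> \<bar>v \<epsilon> t - x' t\<bar> \<le> c \<and> \<bar>z \<epsilon> t - z0\<bar> \<le> c \<and>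
       \<bar>f (y \<epsilon> t) + \<epsilon> * (\<gamma> (t - \<alpha> \<epsilon>) * h (z \<epsilon> t)) - f (x t)\<bar> \<le> c"
    proof (intro exI[of _ "min \<delta> \<delta>'"] conjI allI impI)
      fix \<epsilon> t assume 1: "\<bar>\<epsilon>\<bar> < min \<delta> \<delta>'" and 2: "\<bar>\<epsilon>\<bar> < e"
      have "q \<epsilon> \<in> dom" using q(1)[OF e_le(1)[OF 2]] U by blast
      moreover have "dist (q \<epsilon>) \<xi>0 < \<delta>" "\<bar>\<epsilon>\<bar> < \<delta>" using 1 \<delta>'(2)[of \<epsilon>] by auto
      ultimately have "\<bar>y \<epsilon> t - x t\<bar> \<le> c \<and> \<bar>v \<epsilon> t - x' t\<bar> \<le> c \<and> \<bar>z \<epsilon> t - z0\<bar> \<le> c \<and>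
       \<bar>f (y \<epsilon> t) + \<epsilon> * (\<gamma> (t - \<alpha> \<epsilon>) * h (z \<epsilon> t)) - f (x t)\<bar> \<le> c"
        unfolding z_def \<alpha>_def by (rule close[OF _ _ _ y_ex[OF 2]])
      then show "\<bar>y \<epsilon> t - x t\<bar> \<le> c" "\<bar>v \<epsilon> t - x' t\<bar> \<le> c" "\<bar>z \<epsilon> t - z0\<bar> \<le> c"
       "\<bar>f (y \<epsilon> t) + \<epsilon> * (\<gamma> (t - \<alpha> \<epsilon>) * h (z \<epsilon> t)) - f (x t)\<bar> \<le> c" by auto
    qed (use \<delta> \<delta>' in auto)
  next
    fix \<epsilon> \<beta> y1 v1 z1
    assume \<epsilon>: "\<epsilon> \<noteq> 0" "\<bar>\<epsilon>\<bar> < e"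
      and y1: "\<And>t. (y1 has_real_derivative v1 t) (at t)"
      and v1: "\<And>t. (v1 has_real_derivative f (y1 t) + \<epsilon> * (\<gamma> (t - \<beta>) * h (z1 t))) (at t)"
      and z1: "\<And>t. (z1 has_real_derivative \<epsilon> * (\<gamma> (t - \<beta>) * v1 t)) (at t)"
      and per: "\<And>t. y1 (t + T) = y1 t" "z1 (a + T) = z1 a"
      and en: "(v1 a)\<^sup>2 / 2 - primitive f (y1 a) - d = primitive h (z1 a)"
      and ph: "(LBINT t=a..b. (y1 t - x t) * x' t) = 0"
      and near: "\<bar>y1 a - x a\<bar> < s / 5" "\<bar>v1 a - x' a\<bar> < s / 5" "\<bar>\<beta> - \<alpha>0\<bar> < s / 5" "\<bar>z1 a - z0\<bar> < s / 5"
    define \<xi> :: data where "\<xi> = (y1 a, v1 a, \<beta>, z1 a, \<epsilon>)"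
    have "norm (\<xi> - \<xi>0) < s"
      using norm_data_le[of "\<xi> - \<xi>0"] near e_le(3)[OF \<epsilon>(2)] by (simp add: \<xi>_def \<xi>0_def)
    then have \<xi>: "\<xi> \<in> U" using s(2) by (auto simp: dist_norm norm_minus_commute)
    then have \<xi>_dom: "\<xi> \<in> dom" using U by blast
    note R = residual_of_periodic_solution[OF \<epsilon>(1) y1 v1 z1 per(1) per(2) en ph \<xi>_def \<xi>_dom]
    have \<xi>_q: "\<xi> = q \<epsilon>" by (rule q_unique[OF \<xi> e_le(1)[OF \<epsilon>(2)] R(1)])
    have "\<beta> = \<alpha> \<epsilon>" unfolding \<alpha>_def \<xi>_q[symmetric] by (simp add: \<xi>_def)
    moreover have "y1 t = y \<epsilon> t" for t
    proof -
      define n where "n = \<lfloor>(t - a) / T\<rfloor>"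
      have "of_int n \<le> (t - a) / T" "(t - a) / T < of_int n + 1" unfolding n_def by linarith+
      then have r: "t - of_int n * T \<in> {a..b}" using T by (auto simp: field_simps)
      have "y1 (t - of_int n * T) = y1 t" by (rule periodic_minus_int) (rule per)
      moreover have "y \<epsilon> (t - of_int n * T) = y \<epsilon> t" by (rule periodic_minus_int) (rule y_per[OF \<epsilon>(2)])
      moreover have "y1 (t - of_int n * T) = y \<epsilon> (t - of_int n * T)"
        using R(2)[OF r] y_\<Phi>[OF \<epsilon>(2) r] by (simp add: \<xi>_q)
      ultimately show ?thesis by simp
    qed
    ultimately show "\<beta> = \<alpha> \<epsilon> \<and> y1 = y \<epsilon>" by auto
  qed (fact sys y_per y_energy y_phase)+
  then show ?thesis by blast
qed

end

context melnikov_setting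
begin

theorem branch_exists:
  "\<exists>e \<rho> \<alpha> D y v z. melnikov_branch f f' h h' \<gamma> \<gamma>' x x' T a d \<alpha>0 z0 \<kappa> e \<rho> \<alpha> D y v z"
proof (rule flow_C1[OF solves_orbit[of \<alpha>0]])
  fix r C and \<Phi> :: "state \<Rightarrow> real \<Rightarrow> state" and \<Phi>'
  assume "0 < r" "0 < C"
    "\<And>\<xi>. \<xi> \<in> ball (orbit \<alpha>0 a) r \<Longrightarrow> \<Phi> \<xi> a = \<xi>"
    "\<And>\<xi>. \<xi> \<in> ball (orbit \<alpha>0 a) r \<Longrightarrow> solves_on field a b (\<Phi> \<xi>)"
    "\<And>\<xi> t. \<xi> \<in> ball (orbit \<alpha>0 a) r \<Longrightarrow> t \<in> {a..b} \<Longrightarrow> dist (\<Phi> \<xi> t) (orbit \<alpha>0 t) \<le> C * dist \<xi> (orbit \<alpha>0 a)"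
    "\<And>\<xi>. \<xi> \<in> ball (orbit \<alpha>0 a) r \<Longrightarrow> ((\<lambda>\<xi>. \<Phi> \<xi> b) has_derivative blinfun_apply (\<Phi>' \<xi>)) (at \<xi>)"
    "continuous_on (ball (orbit \<alpha>0 a) r) \<Phi>'"
    "\<And>\<xi> \<eta>. \<xi> \<in> ball (orbit \<alpha>0 a) r \<Longrightarrow>
       \<exists>w. w a = \<eta> \<and> solves_on (\<lambda>t. blinfun_apply (Dfield t (\<Phi> \<xi> t))) a b w \<and> w b = blinfun_apply (\<Phi>' \<xi>) \<eta>"
  then interpret melnikov_flow f f' h h' \<gamma> \<gamma>' x x' T a d \<alpha>0 z0 \<kappa> r C \<Phi> \<Phi>'
    by unfold_locales
  show ?thesis by (rule branch_exists_flow)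
qed

end

section \<open>C2 functions, the C2 norm and the choice of the phase\<close>

lemma C1_onD:
  assumes "g C1_differentiable_on S" "t \<in> S"
  shows "(g has_real_derivative deriv g t) (at t)"
  using assms unfolding C1_differentiable_on_def has_real_derivative_iff_has_vector_derivative[symmetric]
  by (metis DERIV_imp_deriv)

lemma C2_derivs:
  assumes "C2 g"
  shows "(g has_real_derivative deriv g t) (at t)" "continuous_on UNIV (deriv g)"
  using assms C1_onD[of g UNIV t] C1_differentiable_imp_continuous_on by (auto simp: C2_def)

lemma DERIV_shifted: "(g has_real_derivative D) (at (t + s)) \<Longrightarrow> ((\<lambda>t. g (t + s)) has_real_derivative D) (at t)"
  by (simp add: DERIV_shift)

lemma derivative_periodic:
  fixes g g' :: "real \<Rightarrow> real"
  assumes g: "\<And>t. (g has_real_derivative g' t) (at t)" and per: "\<And>t. g (t + T) = g t"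
  shows "g' (t + T) = g' t"
  using DERIV_shifted[OF g, where t = t and s = T] g[of t] unfolding per by (rule DERIV_unique)

lemma periodic_nat:
  fixes g :: "real \<Rightarrow> 'a"
  assumes "\<And>t. g (t + T) = g t"
  shows "g (t + real n * T) = g t"
proof (induction n)
  case (Suc n)
  then show ?case using assms[of "t + real n * T"] by (simp add: algebra_simps)
qed simp

lemma LBINT_eq_integral:
  fixes g :: "real \<Rightarrow> real"
  assumes "continuous_on {a..b} g" "a \<le> b"
  shows "(LBINT t=ereal a..ereal b. g t) = integral {a..b} g"
  using assms by (intro interval_integral_eq_integral borel_integrable_atLeastAtMost') auto

lemma C2_norm_le:
  assumes u: "\<And>t. (u has_real_derivative u' t) (at t)" "\<And>t. (u' has_real_derivative u'' t) (at t)"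
    and "\<And>t. \<bar>u t\<bar> \<le> c" "\<And>t. \<bar>u' t\<bar> \<le> c" "\<And>t. \<bar>u'' t\<bar> \<le> c"
  shows "C2_norm u \<le> c"
proof -
  have "deriv u = u'" "deriv u' = u''" using u by (auto intro: DERIV_imp_deriv)
  then show ?thesis using assms by (auto simp: C2_norm_def max_norm_def intro!: cSUP_least)
qed

text \<open>The bound \<open>B\<close> guarantees that the suprema are genuine; over an unbounded
  set the value of \<open>SUP\<close> carries no information.\<close>

lemma le_C2_norm:
  assumes u: "\<And>t. (u has_real_derivative u' t) (at t)"
    and "\<And>t. \<bar>u t\<bar> \<le> B" "\<And>t. \<bar>u' t\<bar> \<le> B"
  shows "\<bar>u t\<bar> \<le> C2_norm u" "\<bar>u' t\<bar> \<le> C2_norm u"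
proof -
  have *: "\<bar>g t\<bar> \<le> max_norm g" if "\<And>t. \<bar>g t\<bar> \<le> B" for g
    unfolding max_norm_def using that by (intro cSUP_upper) (auto intro: bdd_aboveI2[where M = B])
  have "deriv u = u'" using u by (auto intro: DERIV_imp_deriv)
  then show "\<bar>u t\<bar> \<le> C2_norm u" "\<bar>u' t\<bar> \<le> C2_norm u"
    using *[of u] *[of u'] assms by (auto simp: C2_norm_def le_max_iff_disj)
qed

text \<open>The phase condition reads \<open>\<integral> \<phi> x' (\<sqdot> + \<beta>) = 0\<close>. For \<open>\<phi> = x (\<sqdot> + \<alpha>)\<close> the left-hand side vanishes at
  \<open>\<beta> = \<alpha>\<close> with derivative \<open>- \<integral> x'\<^sup>2 < 0\<close>, so it still changes sign near \<open>\<alpha>\<close> for \<open>\<phi>\<close> close to it.\<close>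

lemma phase_normalisation_exists:
  fixes x x' x'' :: "real \<Rightarrow> real"
  assumes x: "\<And>t. (x has_real_derivative x' t) (at t)" and x': "\<And>t. (x' has_real_derivative x'' t) (at t)"
    and x'': "continuous_on UNIV x''" and per: "\<And>t. x (t + T) = x t"
    and T: "0 < T" and a: "x' a \<noteq> 0" and \<sigma>: "0 < \<sigma>"
  obtains \<eta> where "0 < \<eta>" "\<And>\<phi> \<alpha>. continuous_on UNIV \<phi> \<Longrightarrow> (\<And>t. \<bar>\<phi> t - x (t + \<alpha>)\<bar> \<le> \<eta>) \<Longrightarrow>
    \<exists>\<beta>. \<bar>\<beta> - \<alpha>\<bar> < \<sigma> \<and> (LBINT t=0..T. (\<phi> t - x (t + \<beta>)) * x' (t + \<beta>)) = 0"
proof -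
  have per': "x' (t + T) = x' t" for t by (rule derivative_periodic[OF x per])
  have cx: "continuous_on S x" and cx': "continuous_on S x'" for S
    using x x' by (auto intro!: continuous_at_imp_continuous_on intro: DERIV_isCont)
  note cc = cx[THEN continuous_on_compose2, OF _ subset_UNIV] cx'[THEN continuous_on_compose2, OF _ subset_UNIV]
    x''[THEN continuous_on_compose2, OF _ subset_UNIV]
  define K where "K = primitive (\<lambda>t. (x' t)\<^sup>2) T - primitive (\<lambda>t. (x' t)\<^sup>2) 0"
  have K: "0 < K"
  proof -
    have "K = primitive (\<lambda>t. (x' t)\<^sup>2) (a + T) - primitive (\<lambda>t. (x' t)\<^sup>2) a"
    proof -
      have c: "continuous_on UNIV (\<lambda>t. (x' t)\<^sup>2)" by (intro continuous_intros cx')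
      have "(LBINT t=0..T. (x' (t + 0))\<^sup>2) = (LBINT t=ereal a..ereal (a + T). (x' t)\<^sup>2)"
        by (rule LBINT_periodic_shift[OF c]) (use T per' in auto)
      then show ?thesis
        using LBINT_primitive[OF c, of 0 T] LBINT_primitive[OF c, of a "a + T"] T by (simp add: K_def zero_ereal_def)
    qed
    then show ?thesis using integral_square_pos[OF cx' _ a, of "a + T"] T by simp
  qed
  define A where "A s = integral {0..T} (\<lambda>t. x t * x' (t + s))" for s
  \<comment> \<open>The comparison function does not depend on \<alpha>, so a single \<eta> will
    serve all phases.\<close>
  have A_shift: "integral {0..T} (\<lambda>t. x (t + \<alpha>) * x' (t + \<alpha> + s)) = A s" for \<alpha> s
  proof -
    have "(LBINT t=0..T. x (t + \<alpha>) * x' (t + \<alpha> + s)) = (LBINT t=ereal 0..ereal (0 + T). x t * x' (t + s))"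
    proof (rule LBINT_periodic_shift[of "\<lambda>t. x t * x' (t + s)" T \<alpha> 0])
      show "x (t + T) * x' (t + T + s) = x t * x' (t + s)" for t
        using per[of t] per'[of "t + s"] by (simp add: algebra_simps)
    qed (use T in \<open>auto intro!: continuous_intros cc\<close>)
    then show ?thesis
      unfolding A_def using T
      by (subst (asm) zero_ereal_def, subst (asm) LBINT_eq_integral, (auto intro!: continuous_intros cc)[2],
          subst (asm) LBINT_eq_integral) (auto intro!: continuous_intros cc)
  qed
  \<comment> \<open>As \<open>x * x'\<close> is the derivative of a periodic function, the phase
    condition reduces to \<open>P \<beta> = 0\<close> below.\<close>
  have xx'_0: "integral {0..T} (\<lambda>t. x (t + \<beta>) * x' (t + \<beta>)) = 0" for \<beta>
  proof -
    have "((\<lambda>t. x (t + \<beta>) * x' (t + \<beta>)) has_integral (x (T + \<beta>))\<^sup>2 / 2 - (x (0 + \<beta>))\<^sup>2 / 2) {0..T}"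
      using T by (intro fundamental_theorem_of_calculus)
        (auto intro!: derivative_eq_intros DERIV_subset[OF DERIV_shifted[OF x]]
          simp: has_real_derivative_iff_has_vector_derivative[symmetric])
    then show ?thesis using per[of \<beta>] by (simp add: integral_unique add.commute)
  qed
  have A0: "A 0 = 0" using xx'_0[of 0] by (simp add: A_def)
  have A': "(A has_real_derivative integral {0..T} (\<lambda>t. x t * x'' (t + 0))) (at 0)"
  proof -
    have "((\<lambda>s. integral (cbox 0 T) (\<lambda>t. x t * x' (t + s))) has_field_derivative
        integral (cbox 0 T) (\<lambda>t. x t * x'' (t + 0))) (at 0 within UNIV)"
    proof (rule leibniz_rule_field_derivative)
      show "((\<lambda>s. x t * x' (t + s)) has_real_derivative x t * x'' (t + s)) (at s within UNIV)" for s t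
        using DERIV_cmult[OF DERIV_shifted[OF x', where t = s and s = t], of "x t"] by (simp add: add.commute)
      show "(\<lambda>t. x t * x' (t + s)) integrable_on cbox 0 T" for s
        by (intro integrable_continuous continuous_intros cc)
      show "continuous_on (UNIV \<times> cbox 0 T) (\<lambda>(s, t). x t * x'' (t + s))"
        unfolding case_prod_beta by (intro continuous_intros cc)
    qed auto
    then show ?thesis by (simp add: A_def[abs_def])
  qed
  have "integral {0..T} (\<lambda>t. x t * x'' (t + 0)) = - K"
  proof -
    have "((\<lambda>t. x t * x'' (t + 0)) has_integral
       (x T * x' T - primitive (\<lambda>t. (x' t)\<^sup>2) T) - (x 0 * x' 0 - primitive (\<lambda>t. (x' t)\<^sup>2) 0)) {0..T}"
    proof (rule fundamental_theorem_of_calculus)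
      fix t
      have "(primitive (\<lambda>t. (x' t)\<^sup>2) has_real_derivative (x' t)\<^sup>2) (at t within {0..T})"
        by (intro DERIV_subset[OF primitive_has_derivative] continuous_intros cx') auto
      then show "((\<lambda>t. x t * x' t - primitive (\<lambda>t. (x' t)\<^sup>2) t) has_vector_derivative x t * x'' (t + 0)) (at t within {0..T})"
        unfolding has_real_derivative_iff_has_vector_derivative[symmetric]
        by (auto intro!: derivative_eq_intros DERIV_subset[OF x] DERIV_subset[OF x'] simp: power2_eq_square)
    qed (use T in auto)
    then show ?thesis using per[of 0] per'[of 0] by (simp add: integral_unique K_def)
  qed
  then have A'K: "(A has_real_derivative - K) (at 0)" using A' by simp
  obtain d1 where d1: "0 < d1" "\<And>s. 0 < s \<Longrightarrow> s < d1 \<Longrightarrow> A s < 0"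
    using DERIV_neg_dec_right[OF A'K] K A0 by auto
  obtain d2 where d2: "0 < d2" "\<And>s. 0 < s \<Longrightarrow> s < d2 \<Longrightarrow> 0 < A (- s)"
    using DERIV_neg_dec_left[OF A'K] K A0 by auto
  define s where "s = min (\<sigma> / 2) (min (d1 / 2) (d2 / 2))"
  have s: "0 < s" "s < \<sigma>" "A s < 0" "0 < A (- s)"
    using d1(1) d2(1) \<sigma> by (auto simp: s_def min_def intro!: d1(2) d2(2))
  define \<mu> where "\<mu> = min (- A s) (A (- s))"
  have \<mu>: "0 < \<mu>" using s by (simp add: \<mu>_def)
  obtain B where B: "0 < B" "\<And>t. \<bar>x' t\<bar> \<le> B" using periodic_bounded[OF cx' T per'] by blast
  \<comment> \<open>\<open>P\<close> then differs from the shifted \<open>A\<close> by at most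
    \<open>\<mu> / 2\<close>, too little to destroy its signs at distance \<open>s\<close> on either
    side.\<close>
  define \<eta> where "\<eta> = \<mu> / (2 * B * T)"
  have \<eta>: "0 < \<eta>" using \<mu> B T by (simp add: \<eta>_def)
  show thesis
  proof (rule that[OF \<eta>])
    fix \<phi> \<alpha> assume \<phi>: "continuous_on UNIV \<phi>" and near: "\<And>t. \<bar>\<phi> t - x (t + \<alpha>)\<bar> \<le> \<eta>"
    note c\<phi> = \<phi>[THEN continuous_on_compose2, OF _ subset_UNIV]
    define P where "P \<beta> = integral {0..T} (\<lambda>t. \<phi> t * x' (t + \<beta>))" for \<beta>
    have P: "\<bar>P (\<alpha> + r) - A r\<bar> < \<mu>" for r
    proof -
      have "P (\<alpha> + r) - A r = integral {0..T} (\<lambda>t. (\<phi> t - x (t + \<alpha>)) * x' (t + \<alpha> + r))"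
        unfolding A_shift[of \<alpha>, symmetric] P_def left_diff_distrib
        by (subst integral_diff)
          (auto intro!: integrable_continuous_interval continuous_intros cc c\<phi> simp: add.assoc)
      moreover have "norm (integral {0..T} (\<lambda>t. (\<phi> t - x (t + \<alpha>)) * x' (t + \<alpha> + r))) \<le> \<eta> * B * (T - 0)"
      proof (rule integral_bound)
        fix t
        show "norm ((\<phi> t - x (t + \<alpha>)) * x' (t + \<alpha> + r)) \<le> \<eta> * B"
          unfolding real_norm_def abs_mult using near[of t] B \<eta> by (intro mult_mono) auto
      qed (use T in \<open>auto intro!: continuous_intros cc c\<phi>\<close>)
      moreover have "\<eta> * B * (T - 0) < \<mu>" using \<mu> B T by (simp add: \<eta>_def)
      ultimately show ?thesis by simp
    qed
    have "continuous_on UNIV P"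
    proof -
      have "continuous_on UNIV (\<lambda>\<beta>. integral (cbox 0 T) (\<lambda>t. \<phi> t * x' (t + \<beta>)))"
        by (rule integral_continuous_on_param) (auto simp: case_prod_beta intro!: continuous_intros cc c\<phi>)
      then show ?thesis by (simp add: P_def[abs_def])
    qed
    then have Pc: "continuous_on {\<alpha> - s..\<alpha> + s} P" by (rule continuous_on_subset) simp
    have "P (\<alpha> + s) \<le> 0" "0 \<le> P (\<alpha> - s)" using P[of s] P[of "- s"] by (auto simp: \<mu>_def)
    then obtain \<beta> where \<beta>: "\<alpha> - s \<le> \<beta>" "\<beta> \<le> \<alpha> + s" "P \<beta> = 0"
      using IVT2'[of P "\<alpha> + s" 0 "\<alpha> - s"] Pc s(1) by auto
    have "(LBINT t=ereal 0..ereal T. (\<phi> t - x (t + \<beta>)) * x' (t + \<beta>)) = integral {0..T} (\<lambda>t. (\<phi> t - x (t + \<beta>)) * x' (t + \<beta>))"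
      using T by (intro LBINT_eq_integral) (auto intro!: continuous_intros cc c\<phi>)
    also have "\<dots> = P \<beta> - integral {0..T} (\<lambda>t. x (t + \<beta>) * x' (t + \<beta>))"
      unfolding left_diff_distrib P_def
      by (rule integral_diff) (auto intro!: integrable_continuous_interval continuous_intros cc c\<phi>)
    also have "\<dots> = 0" using \<beta> xx'_0 by simp
    finally show "\<exists>\<beta>. \<bar>\<beta> - \<alpha>\<bar> < \<sigma> \<and> (LBINT t=0..T. (\<phi> t - x (t + \<beta>)) * x' (t + \<beta>)) = 0"
      using \<beta> s by (intro exI[of _ \<beta>]) (auto simp: zero_ereal_def)
  qed
qed

text \<open>With \<open>z = H\<^sup>-\<^sup>1 (v\<^sup>2 / 2 - F y - d)\<close> the perturbed equation becomes \<open>y'' = f y + \<epsilon> \<gamma> h z\<close>,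
  \<open>z' = \<epsilon> \<gamma> y'\<close>.\<close>

lemma system_of_perturbed_solution:
  assumes C1: "cond_C1 h I J" and f: "continuous_on UNIV f" and h: "continuous_on UNIV h"
    and sol: "perturbed_solution f h \<gamma> I J d \<epsilon> \<phi>"
  defines "z \<equiv> \<lambda>t. inv_into I (primitive h) (energy f \<phi> t - d)"
  shows "(\<phi> has_real_derivative deriv \<phi> t) (at t)"
    and "(deriv \<phi> has_real_derivative f (\<phi> t) + \<epsilon> * (\<gamma> t * h (z t))) (at t)"
    and "(z has_real_derivative \<epsilon> * (\<gamma> t * deriv \<phi> t)) (at t)"
    and "(deriv \<phi> t)\<^sup>2 / 2 - primitive f (\<phi> t) - d = primitive h (z t)"
proof -
  let ?H = "primitive h" and ?K = "inv_into I (primitive h)"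
  have bij: "bij_betw ?H I J" and K: "?K C1_differentiable_on J" and "open J" and h0: "\<And>u. u \<in> I \<Longrightarrow> h u \<noteq> 0"
    using C1 by (auto simp: cond_C1_def diffeo_def)
  have HK: "?H (?K s) = s" and KI: "?K s \<in> I" if "s \<in> J" for s
    using that bij by (auto simp: bij_betw_def intro: f_inv_into_f inv_into_into)
  show \<phi>: "(\<phi> has_real_derivative deriv \<phi> t) (at t)" for t
    using sol by (auto simp: perturbed_solution_def solves2_def)
  show \<phi>': "(deriv \<phi> has_real_derivative f (\<phi> t) + \<epsilon> * (\<gamma> t * h (z t))) (at t)" for t
    using sol by (auto simp: perturbed_solution_def solves2_def z_def energy_def mult.assoc)
  have J: "energy f \<phi> t - d \<in> J" for t using sol by (simp add: perturbed_solution_def)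
  show "(deriv \<phi> t)\<^sup>2 / 2 - primitive f (\<phi> t) - d = ?H (z t)"
    using HK[OF J[of t]] by (simp add: z_def energy_def)
  \<comment> \<open>The derivative of the inverse is found by differentiating
    \<open>?H (?K s) = s\<close>; its factor \<open>1 / h\<close> cancels the factor
    \<open>h\<close> in the derivative of the energy.\<close>
  have K': "(?K has_real_derivative 1 / h (?K s)) (at s)" if s: "s \<in> J" for s
  proof -
    have k: "(?K has_real_derivative deriv ?K s) (at s)" by (rule C1_onD[OF K s])
    have "((\<lambda>s. ?H (?K s)) has_real_derivative h (?K s) * deriv ?K s) (at s)"
      by (rule DERIV_chain2[OF primitive_has_derivative[OF h] k])
    moreover have "((\<lambda>s. ?H (?K s)) has_real_derivative 1) (at s)"
      by (rule has_field_derivative_transform_within_open[OF DERIV_ident \<open>open J\<close> s]) (simp add: HK)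
    ultimately have "h (?K s) * deriv ?K s = 1" by (rule DERIV_unique)
    then have "deriv ?K s = 1 / h (?K s)" using h0[OF KI[OF s]] by (simp add: field_simps)
    then show ?thesis using k by simp
  qed
  have "((\<lambda>t. energy f \<phi> t - d) has_real_derivative deriv \<phi> t * (\<epsilon> * (\<gamma> t * h (z t)))) (at t)"
    unfolding energy_def
    by (rule derivative_eq_intros \<phi> \<phi>' DERIV_chain2[OF primitive_has_derivative[OF f]] refl | simp)+
      (simp add: algebra_simps)
  from DERIV_chain2[OF K'[OF J[of t]] this]
  show "(z has_real_derivative \<epsilon> * (\<gamma> t * deriv \<phi> t)) (at t)"
    using h0[OF KI[OF J[of t]]] by (simp add: z_def mult_ac)
qed

text \<open>Since \<open>z\<close> takes values in \<open>I\<close>, where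
  \<open>primitive h\<close> is injective, the energy relation identifies it with the inverse
  occurring in the equation and puts the energy into \<open>J\<close>.\<close>

lemma perturbed_solution_of_system:
  assumes C1: "cond_C1 h I J"
    and \<phi>: "\<And>t. (\<phi> has_real_derivative v t) (at t)"
    and v: "\<And>t. (v has_real_derivative f (\<phi> t) + \<epsilon> * (\<gamma> t * h (z t))) (at t)"
    and energy: "\<And>t. (v t)\<^sup>2 / 2 - primitive f (\<phi> t) - d = primitive h (z t)" and z: "\<And>t. z t \<in> I"
  shows "perturbed_solution f h \<gamma> I J d \<epsilon> \<phi>"
proof -
  have bij: "bij_betw (primitive h) I J" using C1 by (auto simp: cond_C1_def diffeo_def)
  have \<phi>': "deriv \<phi> = v" using \<phi> by (auto intro: DERIV_imp_deriv)
  have "inv_into I (primitive h) (primitive h (z t)) = z t" for t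
    using bij z by (auto simp: bij_betw_def)
  moreover have "primitive h (z t) \<in> J" for t using bij z by (auto simp: bij_betw_def)
  ultimately show ?thesis
    using \<phi> v by (simp add: perturbed_solution_def solves2_def energy_def \<phi>' energy mult.assoc)
qed

subsection \<open>Solutions of the perturbed equation\<close>

locale melnikov_perturbation = melnikov_branch +
  fixes I J :: "real set"
  assumes C1: "cond_C1 h I J" and z0_I: "z0 \<in> I"
begin

lemma deriv_x: "deriv x = x'"
  using x by (auto intro: DERIV_imp_deriv)

definition \<Psi> :: "real \<Rightarrow> real \<Rightarrow> real" where "\<Psi> \<epsilon> t = y \<epsilon> (t + \<alpha> \<epsilon>)"

lemma DERIV_\<Psi>:
  assumes "\<bar>\<epsilon>\<bar> < e"
  shows "(\<Psi> \<epsilon> has_real_derivative v \<epsilon> (t + \<alpha> \<epsilon>)) (at t)"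
    and "((\<lambda>t. v \<epsilon> (t + \<alpha> \<epsilon>)) has_real_derivative
      f (\<Psi> \<epsilon> t) + \<epsilon> * (\<gamma> t * h (z \<epsilon> (t + \<alpha> \<epsilon>)))) (at t)"
  using DERIV_shifted[OF y[OF assms], where t = t and s = "\<alpha> \<epsilon>"] DERIV_shifted[OF v[OF assms], where t = t and s = "\<alpha> \<epsilon>"]
  by (simp_all add: \<Psi>_def[abs_def])

lemma phase_normalised_\<Psi>:
  assumes "\<bar>\<epsilon>\<bar> < e"
  shows "phase_normalised x T (\<alpha> \<epsilon>) (\<Psi> \<epsilon>)"
proof -
  have "continuous_on UNIV (y \<epsilon>)"
    using y[OF assms] by (auto intro!: continuous_at_imp_continuous_on intro: DERIV_isCont)
  then have c: "continuous_on UNIV (\<lambda>t. (y \<epsilon> t - x t) * x' t)" by (intro continuous_intros conts)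
  have "(LBINT t=0..T. (y \<epsilon> (t + \<alpha> \<epsilon>) - x (t + \<alpha> \<epsilon>)) * x' (t + \<alpha> \<epsilon>)) = 0"
    unfolding y_phase[OF assms, symmetric]
    by (rule LBINT_periodic_shift[OF c]) (use T in \<open>auto simp: y_per[OF assms] x_per\<close>)
  then show ?thesis by (simp add: phase_normalised_def shift_diff_def \<Psi>_def deriv_x)
qed

lemma solution_near:
  assumes "0 < c"
  shows "\<exists>\<delta>>0. \<delta> \<le> e \<and> (\<forall>\<epsilon>. \<bar>\<epsilon>\<bar> < \<delta> \<longrightarrow> \<bar>\<alpha> \<epsilon> - \<alpha>0\<bar> < c \<and> perturbed_solution f h \<gamma> I J d \<epsilon> (\<Psi> \<epsilon>) \<and>
    periodic (\<Psi> \<epsilon>) T \<and> \<bar>C2_norm (shift_diff (\<Psi> \<epsilon>) x (\<alpha> \<epsilon>))\<bar> \<le> c)"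
proof -
  have "isCont \<alpha> 0" using \<alpha>[of 0] e by (auto intro: DERIV_isCont)
  then obtain \<delta>1 where \<delta>1: "0 < \<delta>1" "\<And>\<epsilon>. \<bar>\<epsilon>\<bar> < \<delta>1 \<Longrightarrow> \<bar>\<alpha> \<epsilon> - \<alpha>0\<bar> < c"
    using \<open>0 < c\<close> unfolding continuous_at_eps_delta \<alpha>_0 by (auto simp: dist_real_def)
  have "open I" using C1 by (simp add: cond_C1_def)
  then obtain s where s: "0 < s" "ball z0 s \<subseteq> I" using z0_I openE by blast
  \<comment> \<open>The second bound keeps \<open>z\<close> inside \<open>I\<close>, as the return
    to the original equation demands.\<close>
  define c' where "c' = min c (s / 2)"
  have c': "0 < c'" "c' \<le> c" "c' < s" using s \<open>0 < c\<close> by (auto simp: c'_def)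
  obtain \<delta>2 where \<delta>2: "0 < \<delta>2" and near: "\<And>\<epsilon> t. \<bar>\<epsilon>\<bar> < \<delta>2 \<Longrightarrow> \<bar>\<epsilon>\<bar> < e \<Longrightarrow>
       \<bar>y \<epsilon> t - x t\<bar> \<le> c' \<and> \<bar>v \<epsilon> t - x' t\<bar> \<le> c' \<and> \<bar>z \<epsilon> t - z0\<bar> \<le> c' \<and>
       \<bar>f (y \<epsilon> t) + \<epsilon> * (\<gamma> (t - \<alpha> \<epsilon>) * h (z \<epsilon> t)) - f (x t)\<bar> \<le> c'"
    using close[OF c'(1)] by blast
  show ?thesis
  proof (intro exI[of _ "min e (min \<delta>1 \<delta>2)"] conjI allI impI)
    show "0 < min e (min \<delta>1 \<delta>2)" "min e (min \<delta>1 \<delta>2) \<le> e" using e \<delta>1 \<delta>2 by auto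
    fix \<epsilon> assume "\<bar>\<epsilon>\<bar> < min e (min \<delta>1 \<delta>2)"
    then have \<epsilon>: "\<bar>\<epsilon>\<bar> < e" "\<bar>\<epsilon>\<bar> < \<delta>1" "\<bar>\<epsilon>\<bar> < \<delta>2" by auto
    show "\<bar>\<alpha> \<epsilon> - \<alpha>0\<bar> < c" by (rule \<delta>1(2)[OF \<epsilon>(2)])
    have "z \<epsilon> t \<in> I" for t
      using near[OF \<epsilon>(3,1), of t] c'(3) s(2) by (auto simp: dist_real_def subset_iff)
    then show "perturbed_solution f h \<gamma> I J d \<epsilon> (\<Psi> \<epsilon>)"
      by (intro perturbed_solution_of_system[OF C1 DERIV_\<Psi>[OF \<epsilon>(1)]])
        (auto simp: y_energy[OF \<epsilon>(1)] \<Psi>_def)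
    show "periodic (\<Psi> \<epsilon>) T"
      unfolding periodic_def \<Psi>_def
    proof
      show "y \<epsilon> (t + T + \<alpha> \<epsilon>) = y \<epsilon> (t + \<alpha> \<epsilon>)" for t
        using y_per[OF \<epsilon>(1), of "t + \<alpha> \<epsilon>"] by (simp add: add_ac)
    qed
    let ?u = "shift_diff (\<Psi> \<epsilon>) x (\<alpha> \<epsilon>)"
    let ?u' = "\<lambda>t. v \<epsilon> (t + \<alpha> \<epsilon>) - x' (t + \<alpha> \<epsilon>)"
    let ?u'' = "\<lambda>t. f (\<Psi> \<epsilon> t) + \<epsilon> * (\<gamma> t * h (z \<epsilon> (t + \<alpha> \<epsilon>))) - f (x (t + \<alpha> \<epsilon>))"
    have u: "(?u has_real_derivative ?u' t) (at t)" "(?u' has_real_derivative ?u'' t) (at t)" for t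
      unfolding shift_diff_def[abs_def]
      by (intro DERIV_diff DERIV_\<Psi>[OF \<epsilon>(1)] DERIV_shifted[OF x] DERIV_shifted[OF x'])+
    have b: "\<bar>?u t\<bar> \<le> c'" "\<bar>?u' t\<bar> \<le> c'" "\<bar>?u'' t\<bar> \<le> c'" for t
      using near[OF \<epsilon>(3,1), of "t + \<alpha> \<epsilon>"] by (simp_all add: shift_diff_def \<Psi>_def)
    have "C2_norm ?u \<le> c'" by (rule C2_norm_le[OF u b])
    moreover have "\<bar>?u 0\<bar> \<le> C2_norm ?u" by (rule le_C2_norm(1)[OF u(1) b(1,2)])
    ultimately show "\<bar>C2_norm ?u\<bar> \<le> c" using c'(2) by linarith
  qed
qed

text \<open>Translates the branch uniqueness to the original equation. Closeness of \<open>z\<close>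
  at the base time is not assumed: it follows from closeness of \<open>y\<close> and
  \<open>v\<close>, because \<open>z\<close> is a continuous function of them near
  \<open>(x a, x' a)\<close>.\<close>

lemma unique_normalised:
  obtains \<sigma> where "0 < \<sigma>"
    "\<And>\<epsilon> \<beta> \<phi>. \<lbrakk>\<epsilon> \<noteq> 0; \<bar>\<epsilon>\<bar> < e; perturbed_solution f h \<gamma> I J d \<epsilon> \<phi>; periodic \<phi> T;
      phase_normalised x T \<beta> \<phi>; \<bar>\<beta> - \<alpha>0\<bar> < \<sigma>;
      \<bar>\<phi> (a - \<beta>) - x a\<bar> < \<sigma>; \<bar>deriv \<phi> (a - \<beta>) - x' a\<bar> < \<sigma>\<rbrakk> \<Longrightarrow> \<beta> = \<alpha> \<epsilon> \<and> \<phi> = \<Psi> \<epsilon>"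
proof -
  let ?K = "inv_into I (primitive h)"
  have K: "?K C1_differentiable_on J" and bij: "bij_betw (primitive h) I J"
    using C1 by (auto simp: cond_C1_def diffeo_def)
  have Kz0: "?K (primitive h z0) = z0" and "primitive h z0 \<in> J"
    using bij z0_I by (auto simp: bij_betw_def)
  then have contK: "isCont ?K ((x' a)\<^sup>2 / 2 - primitive f (x a) - d)"
    using C1_onD[OF K] by (auto simp: energy_x intro: DERIV_isCont)
  have "isCont (primitive f) u" for u
    by (rule DERIV_isCont[OF primitive_has_derivative[OF conts(1)]])
  then have "isCont (\<lambda>p :: real \<times> real. (snd p)\<^sup>2 / 2 - primitive f (fst p) - d) (x a, x' a)"
    by (intro continuous_intros isCont_o2[of _ fst "primitive f"]) auto
  then have "isCont (\<lambda>p :: real \<times> real. ?K ((snd p)\<^sup>2 / 2 - primitive f (fst p) - d)) (x a, x' a)"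
    by (rule isCont_o2) (use contK in simp)
  then obtain s where s: "0 < s" "\<And>p. dist p (x a, x' a) < s \<Longrightarrow> \<bar>?K ((snd p)\<^sup>2 / 2 - primitive f (fst p) - d) - z0\<bar> < \<rho>"
    using \<rho> unfolding continuous_at_eps_delta by (auto simp: dist_real_def energy_x Kz0)
  define \<sigma> where "\<sigma> = min \<rho> (s / 2)"
  have \<sigma>: "0 < \<sigma>" "\<sigma> \<le> \<rho>" "\<sigma> \<le> s / 2" using \<rho> s by (auto simp: \<sigma>_def)
  show thesis
  proof (rule that[OF \<sigma>(1)])
    fix \<epsilon> \<beta> \<phi>
    assume \<epsilon>: "\<epsilon> \<noteq> 0" "\<bar>\<epsilon>\<bar> < e" and sol: "perturbed_solution f h \<gamma> I J d \<epsilon> \<phi>" and per: "periodic \<phi> T"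
      and phase: "phase_normalised x T \<beta> \<phi>" and \<beta>: "\<bar>\<beta> - \<alpha>0\<bar> < \<sigma>"
      and near: "\<bar>\<phi> (a - \<beta>) - x a\<bar> < \<sigma>" "\<bar>deriv \<phi> (a - \<beta>) - x' a\<bar> < \<sigma>"
    let ?z = "\<lambda>t. ?K (energy f \<phi> t - d)"
    note S = system_of_perturbed_solution[OF C1 conts(1,2) sol]
    have sh: "t - \<beta> = t + (- \<beta>)" for t by simp
    have \<phi>_per: "\<phi> (t + T) = \<phi> t" for t using per by (simp add: periodic_def)
    have \<phi>'_per: "deriv \<phi> (t + T) = deriv \<phi> t" for t by (rule derivative_periodic[OF S(1) \<phi>_per])
    have c: "continuous_on UNIV \<phi>"
      using S(1) by (auto intro!: continuous_at_imp_continuous_on intro: DERIV_isCont)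
    have "(LBINT t=0..T. (\<phi> (t + \<beta> - \<beta>) - x (t + \<beta>)) * x' (t + \<beta>)) = (LBINT t=a..b. (\<phi> (t - \<beta>) - x t) * x' t)"
    proof (rule LBINT_periodic_shift)
      show "(\<phi> (t + T - \<beta>) - x (t + T)) * x' (t + T) = (\<phi> (t - \<beta>) - x t) * x' t" for t
        using \<phi>_per[of "t - \<beta>"] by (simp add: x_per add_diff_eq diff_add_eq)
      show "continuous_on UNIV (\<lambda>t. (\<phi> (t - \<beta>) - x t) * x' t)"
        by (intro continuous_intros conts continuous_on_compose2[OF c]) auto
    qed (use T in simp)
    then have ph: "(LBINT t=a..b. (\<phi> (t - \<beta>) - x t) * x' t) = 0"
      using phase by (simp add: phase_normalised_def shift_diff_def deriv_x)
    have "\<beta> = \<alpha> \<epsilon> \<and> (\<lambda>t. \<phi> (t - \<beta>)) = y \<epsilon>"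
    proof (rule unique[OF \<epsilon>, where ?v1.0 = "\<lambda>t. deriv \<phi> (t - \<beta>)" and ?z1.0 = "\<lambda>t. ?z (t - \<beta>)"])
      fix t
      show "((\<lambda>t. \<phi> (t - \<beta>)) has_real_derivative deriv \<phi> (t - \<beta>)) (at t)"
        "((\<lambda>t. deriv \<phi> (t - \<beta>)) has_real_derivative f (\<phi> (t - \<beta>)) + \<epsilon> * (\<gamma> (t - \<beta>) * h (?z (t - \<beta>)))) (at t)"
        "((\<lambda>t. ?z (t - \<beta>)) has_real_derivative \<epsilon> * (\<gamma> (t - \<beta>) * deriv \<phi> (t - \<beta>))) (at t)"
        unfolding sh by (rule S(1-3)[THEN DERIV_shifted])+
      show "\<phi> (t + T - \<beta>) = \<phi> (t - \<beta>)" using \<phi>_per[of "t - \<beta>"] by (simp add: algebra_simps)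
      have "energy f \<phi> (t + T) = energy f \<phi> t" for t by (simp add: energy_def \<phi>_per \<phi>'_per)
      from this[of "a - \<beta>"] show "?z (a + T - \<beta>) = ?z (a - \<beta>)" by (simp add: algebra_simps)
      show "(deriv \<phi> (a - \<beta>))\<^sup>2 / 2 - primitive f (\<phi> (a - \<beta>)) - d = primitive h (?z (a - \<beta>))"
        by (rule S(4))
      have "dist (\<phi> (a - \<beta>), deriv \<phi> (a - \<beta>)) (x a, x' a) \<le> \<bar>\<phi> (a - \<beta>) - x a\<bar> + \<bar>deriv \<phi> (a - \<beta>) - x' a\<bar>"
        using norm_Pair_le[of "\<phi> (a - \<beta>) - x a" "deriv \<phi> (a - \<beta>) - x' a"] by (simp add: dist_norm)
      then show "\<bar>?z (a - \<beta>) - z0\<bar> < \<rho>"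
        using s(2)[of "(\<phi> (a - \<beta>), deriv \<phi> (a - \<beta>))"] near \<sigma>(3) by (simp add: energy_def)
    qed (use ph near \<beta> \<sigma>(2) in auto)
    then show "\<beta> = \<alpha> \<epsilon> \<and> \<phi> = \<Psi> \<epsilon>"
      by (auto simp: fun_eq_iff \<Psi>_def dest: spec[of _ "_ + \<alpha> \<epsilon>"])
  qed
qed

text \<open>The deviation and its derivative are continuous and periodic, hence bounded, and only
  then does the C2 norm dominate them pointwise.\<close>

lemma near_phase:
  assumes near: "periodic_solution_near f h \<gamma> I J d x T r \<epsilon> \<beta> \<phi>"
  shows "\<bar>\<phi> t - x (t + \<beta>)\<bar> \<le> r" "\<bar>deriv \<phi> t - x' (t + \<beta>)\<bar> \<le> r"
proof -
  let ?u = "shift_diff \<phi> x \<beta>" and ?u' = "\<lambda>t. deriv \<phi> t - x' (t + \<beta>)"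
  have sol: "perturbed_solution f h \<gamma> I J d \<epsilon> \<phi>" and per: "\<And>t. \<phi> (t + T) = \<phi> t"
    and r: "C2_norm ?u \<le> r"
    using near by (auto simp: periodic_solution_near_def periodic_def)
  note S = system_of_perturbed_solution[OF C1 conts(1,2) sol]
  have c: "continuous_on UNIV \<phi>" "continuous_on UNIV (deriv \<phi>)"
    using S(1,2) by (auto intro!: continuous_at_imp_continuous_on intro: DERIV_isCont)
  have u: "(?u has_real_derivative ?u' t) (at t)" for t
    unfolding shift_diff_def[abs_def] by (intro DERIV_diff S(1) DERIV_shifted[OF x])
  have u_per: "?u (t + T) = ?u t" for t
    using per[of t] x_per(1)[of "t + \<beta>"] by (simp add: shift_diff_def algebra_simps)
  have cu: "continuous_on UNIV ?u" and cu': "continuous_on UNIV ?u'"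
    unfolding shift_diff_def[abs_def] by (intro continuous_intros c cont_comps; simp)+
  obtain B where B: "0 < B" "\<And>t. \<bar>?u t\<bar> \<le> B" using periodic_bounded[OF cu T u_per] by blast
  obtain B' where B': "0 < B'" "\<And>t. \<bar>?u' t\<bar> \<le> B'"
    using periodic_bounded[OF cu' T derivative_periodic[OF u u_per]] by blast
  have "\<bar>?u t\<bar> \<le> max B B'" "\<bar>?u' t\<bar> \<le> max B B'" for t using B B' by (simp_all add: le_max_iff_disj)
  from le_C2_norm[OF u this] r show "\<bar>\<phi> t - x (t + \<beta>)\<bar> \<le> r" "\<bar>deriv \<phi> t - x' (t + \<beta>)\<bar> \<le> r"
    unfolding shift_diff_def by (auto intro: order_trans)
qed

text \<open>In the first uniqueness claim \<phi> is close to
  \<open>x (t + \<alpha> \<epsilon>)\<close> but not assumed normalised. A nearby phase \<beta>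
  normalises it, and uniqueness of normalised solutions returns both
  \<open>\<beta> = \<alpha> \<epsilon>\<close> and \<open>\<phi> = \<Psi> \<epsilon>\<close>. In the
  second claim normalisation is given.\<close>

theorem bifurcation:
  "\<exists>\<rho>>0. \<exists>\<delta>>0. \<exists>\<epsilon>0>0. \<exists>(\<alpha> :: real \<Rightarrow> real) (\<Psi> :: real \<Rightarrow> real \<Rightarrow> real).
    \<alpha> C1_differentiable_on {-\<epsilon>0<..<\<epsilon>0} \<and>
    ((\<lambda>\<epsilon>. \<bar>\<alpha> \<epsilon> - \<alpha>0\<bar>) \<longlongrightarrow> 0) (at 0) \<and>
    (\<forall>\<epsilon>. \<bar>\<epsilon>\<bar> < \<epsilon>0 \<longrightarrow>
       \<bar>\<alpha> \<epsilon> - \<alpha>0\<bar> \<le> \<delta> \<and>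
       periodic_solution_near f h \<gamma> I J d x T \<rho> \<epsilon> (\<alpha> \<epsilon>) (\<Psi> \<epsilon>) \<and>
       phase_normalised x T (\<alpha> \<epsilon>) (\<Psi> \<epsilon>)) \<and>
    (\<forall>\<epsilon>. 0 < \<bar>\<epsilon>\<bar> \<and> \<bar>\<epsilon>\<bar> < \<epsilon>0 \<longrightarrow>
       (\<forall>\<phi>. periodic_solution_near f h \<gamma> I J d x T \<rho> \<epsilon> (\<alpha> \<epsilon>) \<phi> \<longrightarrow> \<phi> = \<Psi> \<epsilon>) \<and>
       (\<forall>a \<phi>. \<bar>a - \<alpha>0\<bar> \<le> \<delta> \<and>
          periodic_solution_near f h \<gamma> I J d x T \<rho> \<epsilon> a \<phi> \<and>
          phase_normalised x T a \<phi> \<longrightarrow> a = \<alpha> \<epsilon>)) \<and>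
    ((\<lambda>\<epsilon>. C2_norm (shift_diff (\<Psi> \<epsilon>) x (\<alpha> \<epsilon>))) \<longlongrightarrow> 0) (at 0)"
proof -
  obtain \<sigma> where \<sigma>: "0 < \<sigma>" and uniq: "\<And>\<epsilon> \<beta> \<phi>. \<lbrakk>\<epsilon> \<noteq> 0; \<bar>\<epsilon>\<bar> < e; perturbed_solution f h \<gamma> I J d \<epsilon> \<phi>;
      periodic \<phi> T; phase_normalised x T \<beta> \<phi>; \<bar>\<beta> - \<alpha>0\<bar> < \<sigma>;
      \<bar>\<phi> (a - \<beta>) - x a\<bar> < \<sigma>; \<bar>deriv \<phi> (a - \<beta>) - x' a\<bar> < \<sigma>\<rbrakk> \<Longrightarrow> \<beta> = \<alpha> \<epsilon> \<and> \<phi> = \<Psi> \<epsilon>"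
    using unique_normalised by blast
  have "isCont x a" "isCont x' a" using x x' by (auto intro: DERIV_isCont)
  moreover have \<sigma>2: "0 < \<sigma> / 2" using \<sigma> by simp
  ultimately obtain s1 s2 where s1: "0 < s1" "\<And>t. \<bar>t - a\<bar> < s1 \<Longrightarrow> \<bar>x t - x a\<bar> < \<sigma> / 2"
    and s2: "0 < s2" "\<And>t. \<bar>t - a\<bar> < s2 \<Longrightarrow> \<bar>x' t - x' a\<bar> < \<sigma> / 2"
    unfolding continuous_at_eps_delta dist_real_def by blast
  \<comment> \<open>The uniqueness radius \<sigma> is split in halves: a phase change below
    \<open>s\<close> costs one half, the deviation \<open>r\<close> defined below the other.\<close>
  define s where "s = min (\<sigma> / 2) (min s1 s2)"
  have s: "0 < s" "s \<le> \<sigma> / 2" "s \<le> s1" "s \<le> s2" using \<sigma> s1 s2 by (auto simp: s_def)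
  have c: "continuous_on UNIV (\<lambda>t. f (x t))" by (intro cont_comps conts)
  obtain \<eta> where \<eta>: "0 < \<eta>" and phase: "\<And>\<phi> \<alpha>. continuous_on UNIV \<phi> \<Longrightarrow> (\<And>t. \<bar>\<phi> t - x (t + \<alpha>)\<bar> \<le> \<eta>) \<Longrightarrow>
    \<exists>\<beta>. \<bar>\<beta> - \<alpha>\<bar> < s \<and> (LBINT t=0..T. (\<phi> t - x (t + \<beta>)) * x' (t + \<beta>)) = 0"
    using phase_normalisation_exists[OF x x' c x_per(1) T x'_a s(1)] by blast
  define r where "r = min \<eta> (\<sigma> / 2)"
  have r: "0 < r" "r \<le> \<eta>" "r \<le> \<sigma> / 2" using \<eta> \<sigma> by (auto simp: r_def)
  obtain \<epsilon>0 where \<epsilon>0: "0 < \<epsilon>0" "\<epsilon>0 \<le> e" and ex: "\<And>\<epsilon>. \<bar>\<epsilon>\<bar> < \<epsilon>0 \<Longrightarrow> \<bar>\<alpha> \<epsilon> - \<alpha>0\<bar> < r \<and>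
    perturbed_solution f h \<gamma> I J d \<epsilon> (\<Psi> \<epsilon>) \<and> periodic (\<Psi> \<epsilon>) T \<and> \<bar>C2_norm (shift_diff (\<Psi> \<epsilon>) x (\<alpha> \<epsilon>))\<bar> \<le> r"
    using solution_near[OF r(1)] by blast
  have lim: "(g \<longlongrightarrow> 0) (at 0)"
    if g: "\<And>c. 0 < c \<Longrightarrow> \<exists>\<delta>>0. \<forall>\<epsilon>. \<bar>\<epsilon>\<bar> < \<delta> \<longrightarrow> \<bar>g \<epsilon>\<bar> \<le> c" for g :: "real \<Rightarrow> real"
  proof (rule LIM_I)
    fix c :: real assume "0 < c"
    then obtain \<delta> where "0 < \<delta>" "\<And>\<epsilon>. \<bar>\<epsilon>\<bar> < \<delta> \<Longrightarrow> \<bar>g \<epsilon>\<bar> \<le> c / 2" using g[of "c / 2"] by auto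
    then show "\<exists>s>0. \<forall>\<epsilon>. \<epsilon> \<noteq> 0 \<and> norm (\<epsilon> - 0) < s \<longrightarrow> norm (g \<epsilon> - 0) < c"
      using \<open>0 < c\<close> by (intro exI[of _ \<delta>]) (force intro: le_less_trans)
  qed
  show ?thesis
  proof (rule exI[of _ r], rule conjI[OF r(1)], rule exI[of _ "\<sigma> / 2"], rule conjI[OF \<sigma>2],
      rule exI[of _ \<epsilon>0], rule conjI[OF \<epsilon>0(1)], rule exI[of _ \<alpha>], rule exI[of _ \<Psi>],
      intro conjI allI impI; (elim conjE)?)
    show "\<alpha> C1_differentiable_on {-\<epsilon>0<..<\<epsilon>0}"
      unfolding C1_differentiable_on_def has_real_derivative_iff_has_vector_derivative[symmetric]
      using \<epsilon>0 by (intro exI[of _ D] conjI ballI \<alpha> continuous_on_subset[OF D]) auto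
    show "((\<lambda>\<epsilon>. \<bar>\<alpha> \<epsilon> - \<alpha>0\<bar>) \<longlongrightarrow> 0) (at 0)"
      using solution_near by (intro lim) (metis abs_abs less_imp_le)
    show "((\<lambda>\<epsilon>. C2_norm (shift_diff (\<Psi> \<epsilon>) x (\<alpha> \<epsilon>))) \<longlongrightarrow> 0) (at 0)"
      using solution_near by (intro lim) metis
  next
    fix \<epsilon> assume \<epsilon>: "\<bar>\<epsilon>\<bar> < \<epsilon>0"
    show "\<bar>\<alpha> \<epsilon> - \<alpha>0\<bar> \<le> \<sigma> / 2" "periodic_solution_near f h \<gamma> I J d x T r \<epsilon> (\<alpha> \<epsilon>) (\<Psi> \<epsilon>)"
      using ex[OF \<epsilon>] r by (auto simp: periodic_solution_near_def)
    show "phase_normalised x T (\<alpha> \<epsilon>) (\<Psi> \<epsilon>)" using \<epsilon> \<epsilon>0 by (intro phase_normalised_\<Psi>) auto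
  next
    fix \<epsilon> \<phi> assume "0 < \<bar>\<epsilon>\<bar>" "\<bar>\<epsilon>\<bar> < \<epsilon>0" and near: "periodic_solution_near f h \<gamma> I J d x T r \<epsilon> (\<alpha> \<epsilon>) \<phi>"
    then have \<epsilon>: "\<epsilon> \<noteq> 0" "\<bar>\<epsilon>\<bar> < \<epsilon>0" "\<bar>\<epsilon>\<bar> < e" using \<epsilon>0 by auto
    have sol: "perturbed_solution f h \<gamma> I J d \<epsilon> \<phi>" and per: "periodic \<phi> T"
      using near by (auto simp: periodic_solution_near_def)
    have c: "continuous_on UNIV \<phi>"
      using system_of_perturbed_solution(1)[OF C1 conts(1,2) sol]
      by (auto intro!: continuous_at_imp_continuous_on intro: DERIV_isCont)
    note near' = near_phase[OF near]
    have "\<bar>\<phi> t - x (t + \<alpha> \<epsilon>)\<bar> \<le> \<eta>" for t using near'(1)[of t] r(2) by linarith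
    from phase[OF c this] obtain \<beta> where \<beta>: "\<bar>\<beta> - \<alpha> \<epsilon>\<bar> < s"
      and ph: "(LBINT t=0..T. (\<phi> t - x (t + \<beta>)) * x' (t + \<beta>)) = 0" by blast
    have "\<beta> = \<alpha> \<epsilon> \<and> \<phi> = \<Psi> \<epsilon>"
    proof (rule uniq[OF \<epsilon>(1,3) sol per])
      show "phase_normalised x T \<beta> \<phi>" using ph by (simp add: phase_normalised_def shift_diff_def deriv_x)
      show "\<bar>\<beta> - \<alpha>0\<bar> < \<sigma>" using \<beta> ex[OF \<epsilon>(2)] s(2) r(3) by linarith
      show "\<bar>\<phi> (a - \<beta>) - x a\<bar> < \<sigma>"
        using near'(1)[of "a - \<beta>"] s1(2)[of "a - \<beta> + \<alpha> \<epsilon>"] \<beta> s(3) r(3) by linarith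
      show "\<bar>deriv \<phi> (a - \<beta>) - x' a\<bar> < \<sigma>"
        using near'(2)[of "a - \<beta>"] s2(2)[of "a - \<beta> + \<alpha> \<epsilon>"] \<beta> s(4) r(3) by linarith
    qed
    then show "\<phi> = \<Psi> \<epsilon>" by simp
  next
    fix \<epsilon> \<beta> \<phi> assume "0 < \<bar>\<epsilon>\<bar>" "\<bar>\<epsilon>\<bar> < \<epsilon>0" and \<beta>: "\<bar>\<beta> - \<alpha>0\<bar> \<le> \<sigma> / 2"
      and near: "periodic_solution_near f h \<gamma> I J d x T r \<epsilon> \<beta> \<phi>" and ph: "phase_normalised x T \<beta> \<phi>"
    then have \<epsilon>: "\<epsilon> \<noteq> 0" "\<bar>\<epsilon>\<bar> < e" using \<epsilon>0 by auto
    have sol: "perturbed_solution f h \<gamma> I J d \<epsilon> \<phi>" and per: "periodic \<phi> T"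
      using near by (auto simp: periodic_solution_near_def)
    have "\<beta> = \<alpha> \<epsilon> \<and> \<phi> = \<Psi> \<epsilon>"
      using near_phase[OF near, of "a - \<beta>"] \<beta> \<sigma> r(3) by (intro uniq[OF \<epsilon> sol per ph]) auto
    then show "\<beta> = \<alpha> \<epsilon>" by simp
  qed
qed

end

text \<open>The hypotheses are brought to \<open>melnikov_setting\<close>: a base point with nonzero
  velocity, nondegeneracy over \<open>q\<close> periods, and the Melnikov function with the phase
  moved into \<gamma>.\<close>

theorem theorem1:
  fixes f h \<gamma> :: "real \<Rightarrow> real"
    and I J \<Lambda> :: "real set"
    and \<psi> :: "real \<Rightarrow> real \<Rightarrow> real"
    and Tper :: "real \<Rightarrow> real"
    and l c d \<alpha>0 :: real
    and p q :: nat
  assumes "C2 f" and "C2 h" and "C2 \<gamma>" and "periodic \<gamma> 1"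
    and C1: "cond_C1 h I J"
    and H1: "cond_H1 f \<Lambda> \<psi> Tper" and l: "l \<in> \<Lambda>"
    and R: "p > 0" "q > 0" "Tper l = real p / real q"
    and H2: "\<And>t. energy f (\<psi> l) t = c" "c - d \<in> J"
    and zero: "simple_zero (melnikov (\<psi> l) \<gamma> (real p)) \<alpha>0"
  shows "\<exists>\<rho>>0. \<exists>\<delta>>0. \<exists>\<epsilon>0>0. \<exists>(\<alpha> :: real \<Rightarrow> real) (\<Psi> :: real \<Rightarrow> real \<Rightarrow> real).
    \<alpha> C1_differentiable_on {-\<epsilon>0<..<\<epsilon>0} \<and>
    ((\<lambda>\<epsilon>. \<bar>\<alpha> \<epsilon> - \<alpha>0\<bar>) \<longlongrightarrow> 0) (at 0) \<and>
    (\<forall>\<epsilon>. \<bar>\<epsilon>\<bar> < \<epsilon>0 \<longrightarrow>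
       \<bar>\<alpha> \<epsilon> - \<alpha>0\<bar> \<le> \<delta> \<and>
       periodic_solution_near f h \<gamma> I J d (\<psi> l) (real p) \<rho> \<epsilon> (\<alpha> \<epsilon>) (\<Psi> \<epsilon>) \<and>
       phase_normalised (\<psi> l) (real p) (\<alpha> \<epsilon>) (\<Psi> \<epsilon>)) \<and>
    (\<forall>\<epsilon>. 0 < \<bar>\<epsilon>\<bar> \<and> \<bar>\<epsilon>\<bar> < \<epsilon>0 \<longrightarrow>
       (\<forall>\<phi>. periodic_solution_near f h \<gamma> I J d (\<psi> l) (real p) \<rho> \<epsilon> (\<alpha> \<epsilon>) \<phi> \<longrightarrow> \<phi> = \<Psi> \<epsilon>) \<and>
       (\<forall>a \<phi>. \<bar>a - \<alpha>0\<bar> \<le> \<delta> \<and>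
          periodic_solution_near f h \<gamma> I J d (\<psi> l) (real p) \<rho> \<epsilon> a \<phi> \<and>
          phase_normalised (\<psi> l) (real p) a \<phi> \<longrightarrow> a = \<alpha> \<epsilon>)) \<and>
    ((\<lambda>\<epsilon>. C2_norm (shift_diff (\<Psi> \<epsilon>) (\<psi> l) (\<alpha> \<epsilon>))) \<longlongrightarrow> 0) (at 0)"
proof -
  define x where "x = \<psi> l"
  define x' where "x' = deriv x"
  define T where "T = real p"
  define \<tau> where "\<tau> = Tper l"
  note f = C2_derivs[OF \<open>C2 f\<close>] and h = C2_derivs[OF \<open>C2 h\<close>] and \<gamma> = C2_derivs[OF \<open>C2 \<gamma>\<close>]
  have cf: "continuous_on UNIV f" and ch: "continuous_on UNIV h" and c\<gamma>: "continuous_on UNIV \<gamma>"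
    using f h \<gamma> by (auto intro!: continuous_at_imp_continuous_on intro: DERIV_isCont)
  have nd: "nondegenerate_periodic f x \<tau>" using H1 l by (auto simp: cond_H1_def x_def \<tau>_def)
  have T: "0 < T" using R by (simp add: T_def)
  have \<tau>: "0 < \<tau>" "T = real q * \<tau>" using R by (simp_all add: T_def \<tau>_def)
  have x: "(x has_real_derivative x' t) (at t)" and x': "(x' has_real_derivative f (x t)) (at t)" for t
    using nd by (auto simp: nondegenerate_periodic_def solves2_def x'_def)
  have x_\<tau>: "x (t + \<tau>) = x t" for t using nd by (simp add: nondegenerate_periodic_def periodic_def)
  have x'_\<tau>: "x' (t + \<tau>) = x' t" for t by (rule derivative_periodic[OF x x_\<tau>])
  have x_T: "x (t + T) = x t" for t unfolding \<tau>(2) by (rule periodic_nat) (rule x_\<tau>)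
  have x'_T: "x' (t + T) = x' t" for t unfolding \<tau>(2) by (rule periodic_nat) (rule x'_\<tau>)
  have \<gamma>_T: "\<gamma> (t + T) = \<gamma> t" for t
    using periodic_nat[of \<gamma> 1 t p] \<open>periodic \<gamma> 1\<close> by (simp add: periodic_def T_def)
  have cx: "continuous_on UNIV x" and cx': "continuous_on UNIV x'"
    using x x' by (auto intro!: continuous_at_imp_continuous_on intro: DERIV_isCont)
  note cc = cx[THEN continuous_on_compose2, OF _ subset_UNIV] cx'[THEN continuous_on_compose2, OF _ subset_UNIV]
    c\<gamma>[THEN continuous_on_compose2, OF _ subset_UNIV] cf[THEN continuous_on_compose2, OF _ subset_UNIV]
    f(2)[THEN continuous_on_compose2, OF _ subset_UNIV]
  define M where "M = melnikov x \<gamma> T"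
  have M: "M \<alpha>0 = 0" "(M has_real_derivative deriv M \<alpha>0) (at \<alpha>0)" "deriv M \<alpha>0 \<noteq> 0"
    using zero DERIV_deriv_iff_real_differentiable[of M \<alpha>0] by (auto simp: simple_zero_def M_def x_def T_def)
  have M_def': "M = (\<lambda>\<alpha>. LBINT t=0..T. x' (t + \<alpha>) * \<gamma> t)"
    by (simp add: M_def melnikov_def[abs_def] x'_def)
  \<comment> \<open>A constant orbit would make the Melnikov function vanish identically, contrary
    to the simple zero.\<close>
  obtain a where a: "x' a \<noteq> 0"
  proof (rule ccontr)
    assume "\<not> thesis"
    then have "x' t = 0" for t using that by blast
    then have "M = (\<lambda>_. 0)" by (simp add: M_def')
    then show False using M(3) by simp
  qed
  have M_eq: "M = (\<lambda>\<alpha>. LBINT t=ereal a..ereal (a + T). \<gamma> (t - \<alpha>) * x' t)"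
  proof
    fix \<alpha>
    have "(LBINT t=0..T. (\<lambda>t. \<gamma> (t - \<alpha>) * x' t) (t + \<alpha>)) = (LBINT t=ereal a..ereal (a + T). \<gamma> (t - \<alpha>) * x' t)"
    proof (rule LBINT_periodic_shift)
      show "\<gamma> (t + T - \<alpha>) * x' (t + T) = \<gamma> (t - \<alpha>) * x' t" for t
        using \<gamma>_T[of "t - \<alpha>"] x'_T[of t] by (simp add: algebra_simps)
    qed (use T in \<open>auto intro!: continuous_intros cc\<close>)
    then show "M \<alpha> = (LBINT t=ereal a..ereal (a + T). \<gamma> (t - \<alpha>) * x' t)"
      by (simp add: M_def' mult.commute)
  qed
  have bij: "bij_betw (primitive h) I J" and h0: "\<And>u. u \<in> I \<Longrightarrow> h u \<noteq> 0"
    using C1 by (auto simp: cond_C1_def diffeo_def)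
  let ?K = "inv_into I (primitive h)"
  define z0 where "z0 = ?K (c - d)"
  have z0: "z0 \<in> I" "primitive h z0 = c - d"
    using H2(2) bij by (auto simp: z0_def bij_betw_def intro: inv_into_into f_inv_into_f)
  have energy_x: "(x' t)\<^sup>2 / 2 - primitive f (x t) - d = primitive h z0" for t
    using H2(1)[of t] z0(2) by (simp add: energy_def x_def x'_def)
  \<comment> \<open>A \<open>T\<close>-periodic solution of the variational equation is already
    \<tau>-periodic, with \<open>u = x'\<close> as the known periodic solution, so the hypothesis
    for the period \<tau> applies.\<close>
  have nondeg: "\<exists>k. \<forall>t. w t = k * x' t"
    if w: "\<And>t. (w has_real_derivative w' t) (at t)" "\<And>t. (w' has_real_derivative deriv f (x t) * w t) (at t)"
      and per: "\<And>t. w (t + T) = w t" for w w'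
  proof -
    have fx: "f (x (t + \<tau>)) = f (x t)" for t by (simp add: x_\<tau>)
    have "w (t + \<tau>) = w t" for t
    proof (rule periodic_multiple_imp_periodic[where A = "\<lambda>t. deriv f (x t)" and u = x' and u' = "\<lambda>t. f (x t)"
          and a = a and w' = w' and q = q])
      show "((\<lambda>t. f (x t)) has_real_derivative deriv f (x t) * x' t) (at t)" for t
        by (rule DERIV_chain2[OF f(1) x])
    qed (use w per a \<tau> R x' x'_\<tau> x_\<tau> in \<open>auto intro!: continuous_intros cc\<close>)
    moreover have "deriv w = w'" using w(1) by (auto intro: DERIV_imp_deriv)
    ultimately have "solves2 (\<lambda>t u v. deriv f (x t) * u) w \<and> periodic w \<tau>"
      using w by (simp add: solves2_def periodic_def)
    then show ?thesis using nd by (auto simp: nondegenerate_periodic_def x'_def)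
  qed
  define \<kappa> where "\<kappa> = deriv M \<alpha>0"
  have mel: "(LBINT t=ereal a..ereal (a + T). \<gamma> (t - \<alpha>0) * x' t) = 0" using M(1) by (simp add: M_eq)
  have mel': "((\<lambda>\<alpha>. LBINT t=ereal a..ereal (a + T). \<gamma> (t - \<alpha>) * x' t) has_real_derivative \<kappa>) (at \<alpha>0)"
    and \<kappa>: "\<kappa> \<noteq> 0"
    using M(2,3) unfolding \<kappa>_def[symmetric] by (simp_all add: M_eq)
  interpret melnikov_setting f "deriv f" h "deriv h" \<gamma> "deriv \<gamma>" x x' T a d \<alpha>0 z0 \<kappa>
    by unfold_locales (fact f h \<gamma> T \<gamma>_T x x' x_T x'_T a nondeg energy_x h0[OF z0(1)] mel mel' \<kappa>)+
  obtain e \<rho> \<alpha> D y v z where "melnikov_branch f (deriv f) h (deriv h) \<gamma> (deriv \<gamma>) x x' T a d \<alpha>0 z0 \<kappa> e \<rho> \<alpha> D y v z"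
    using branch_exists by blast
  then interpret melnikov_branch f "deriv f" h "deriv h" \<gamma> "deriv \<gamma>" x x' T a d \<alpha>0 z0 \<kappa> e \<rho> \<alpha> D y v z .
  interpret melnikov_perturbation f "deriv f" h "deriv h" \<gamma> "deriv \<gamma>" x x' T a d \<alpha>0 z0 \<kappa> e \<rho> \<alpha> D y v z I J
    by unfold_locales (use C1 z0 in auto)
  show ?thesis using bifurcation unfolding x_def T_def .
qed

end
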